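(* For every $c\in(0,1)$, suppose there are $d,d',N\in\mathbb{N}$ satisfying $$\mathrm{gap}\big(A_N(g_{d,d'}^{(c)})\big)>\frac{5\pi}{2}\cot\Big(\frac{\pi}{2^{d}}\Big)2^{-N}.$$ Then the maximizing measure for $g_{d,d'}^{(c)}$ (with respect to the doubling map), say $\mu$, is supported on a periodic orbit. If, further, $$g_{d,d'}^{(c)}(x)=g^{(c)}(x)\qquad\text{for all }x\in\mathrm{supp}\,\mu,$$ then $\mu$ is also the unique maximizing measure for $g^{(c)}$.
   Context: Dynamics. $f(x)=2x \pmod 1$ is the doubling map on the circle $\mathcal{S}=\mathbb{R}/\mathbb{Z}$, identified with $[0,1)$; $\mathrm{Inv}(f)$ is the set of $f$-invariant Borel probability measures. For an upper semi-continuous potential $\varphi$ (possibly taking the value $-\infty$), a measure $\mu\in\mathrm{Inv}(f)$ is maximizing for $\varphi$ if $\int\varphi\,d\mu=\sup_{\nu\in\mathrm{Inv}(f)}\int\varphi\,d\nu$. Potentials. $g^{(c)}(x):=\log|\cos\pi(x+c)|$ (with $\log 0=-\infty$). For an integer $d\ge2$, $g_d^{(c)}(x):=\max\{g^{(c)}(x),\log|\sin\frac{\pi}{2^d}|\}$; both functions are $1$-periodic. For an integer $d'\ge2$, suppose without loss of generality that $$\inf_{[0,2^{-d'})} g_d^{(c)}\ \ge\ \sup_{[1-2^{-d'},1)} g_d^{(c)}=g_d^{(c)}(0),$$ and put $$g_{d,d'}^{(c)}(x):=\begin{cases} g_d^{(c)}(x), & x\in[0,1-2^{-d'}),\\ g_d^{(c)}(1-x),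 & x\in[1-2^{-d'},1).\end{cases}$$ The words "without loss of generality" refer to the reflection $x\mapsto 1-x$, which commutes with $f$ and exchanges $g^{(c)}$ and $g^{(1-c)}$. In the opposite case $\inf_{[1-2^{-d'},1)} g_d^{(c)}\ge\sup_{[0,2^{-d'})} g_d^{(c)}=g_d^{(c)}(0)$, the mirrored definition is used: $g_{d,d'}^{(c)}(x):=g_d^{(c)}(1-x)$ for $x\in[0,2^{-d'})$ and $g_{d,d'}^{(c)}(x):=g_d^{(c)}(x)$ for $x\in[2^{-d'},1)$. (If both inequalities hold, the two definitions agree. For each $c\in(0,1)$ and $d$, at least one of them holds once $d'$ is large enough.) Truncation. For a finite word $\omega\in\{0,1\}^n$, $[\omega]$ denotes the cylinder of infinite binary sequences with initial subword $\omega$, identified via binary expansion with the corresponding dyadic interval of length $2^{-n}$ in $[0,1)$. For an integrable $\varphi$, $$A_n(\varphi):=\sum_{|\omega|=n}\Big(2^n\int_{[\omega]}\varphi\,dx\Big)\chi_{[\omega]},$$ where $\chi$ denotes the characteristic function. Quotient de Bruijn graphs. The de Bruijn graph $\widetilde G_n$ is the directed graph whose nodes are the words of length $n-1$ over $\{0,1\}$ and whose edges are the words of length $n$; the edge $\omega$ goes from the initial subword of $\omega$ of length $n-1$ to its final subword of length $n-1$. The quotient de Bruijn graph $G_n=(V_n,E_n)$ is obtained from $\widetilde G_n$ by identifying the two nodes $0\cdots0$ and $1\cdots1$ (of length $n-1$) and gluing the self-loops $0^n$ and $1^n$ at these nodes; all other nodes and edges are kept. For $n\ge d'$ one has $\int_{[0^n]}g_{d,d'}^{(c)}dx=\int_{[1^n]}g_{d,d'}^{(c)}dx$,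 so the edge weights $\mathrm{wgh}_n(e):=A_n(g_{d,d'}^{(c)})|_{[\omega]}$, for $e\in E_n$ the edge given by the word $\omega\in\{0,1\}^n$, are well defined on $G_n$. Accordingly $d,d'\ge2$ and $N\ge d'$ throughout. Gap. For a (simple, directed) cycle $\mathcal{C}$ in $G_n$, its mean weight $\lambda(\mathcal{C})$ is the sum of the weights of its edges divided by the number $|\mathcal{C}|$ of its edges. Let $\lambda_1:=\max_{\mathcal{C}\subset G_n}\lambda(\mathcal{C})$. If the cycle $\gamma_1$ attaining $\lambda_1$ is unique, let $\lambda_2:=\max_{\mathcal{C}\subset G_n,\,\mathcal{C}\ne\gamma_1}\lambda(\mathcal{C})$, and define $\mathrm{gap}(A_n(g_{d,d'}^{(c)})):=\lambda_1-\lambda_2>0$. (The hypothesis on the gap includes that $\gamma_1$ is unique.) *)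

theory Defs
  imports "HOL-Probability.Probability" "Graph_Theory.Arc_Walk"
begin

section \<open>The doubling map on the circle\<close>

text \<open>The circle is the fundamental domain \<open>{0..<1}\<close> with the quotient topology of the real line
  modulo the integers, so neighbourhoods of 0 also contain points close to 1.\<close>

definition circle_open :: "real set \<Rightarrow> bool" where
  "circle_open U \<longleftrightarrow> U \<subseteq> {0..<1} \<and> open (frac -` U)"

definition circle_borel :: "real measure" where
  "circle_borel = sigma {0..<1} {U. circle_open U}"

definition doubling :: "real \<Rightarrow> real" where
  "doubling x = frac (2 * x)"

definition invariant_measures :: "real measure set" where
  "invariant_measures =
     {\<mu>. prob_space \<mu> \<and> space \<mu> = {0..<1} \<and> sets \<mu> = sets circle_borel \<and>
         (\<forall>A\<in>sets \<mu>. emeasure \<mu> (doubling -` A \<inter> space \<mu>) = emeasure \<mu> A)}"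

definition msupport :: "real measure \<Rightarrow> real set" where
  "msupport \<mu> = {x \<in> {0..<1}. \<forall>U. circle_open U \<longrightarrow> x \<in> U \<longrightarrow> emeasure \<mu> U > 0}"

definition periodic_orbit :: "real set \<Rightarrow> bool" where
  "periodic_orbit X \<longleftrightarrow>
     (\<exists>x\<in>{0..<1}. \<exists>p>0. (doubling ^^ p) x = x \<and> X = {(doubling ^^ k) x |k. k < p})"

text \<open>Positive part minus negative part. The positive part is finite whenever \<open>\<phi>\<close> is bounded above
  and \<open>M\<close> is finite, so that the difference is then meaningful; its value may be \<open>-\<infinity>\<close>.\<close>

definition ereal_integral :: "'a measure \<Rightarrow> ('a \<Rightarrow> ereal) \<Rightarrow> ereal" where
  "ereal_integral M \<phi> =
     enn2ereal (\<integral>\<^sup>+x. e2ennreal (\<phi> x) \<partial>M) - enn2ereal (\<integral>\<^sup>+x. e2ennreal (- \<phi> x) \<partial>M)"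

definition maximizing :: "(real \<Rightarrow> ereal) \<Rightarrow> real measure \<Rightarrow> bool" where
  "maximizing \<phi> \<mu> \<longleftrightarrow> \<mu> \<in> invariant_measures \<and>
     ereal_integral \<mu> \<phi> = (SUP \<nu>\<in>invariant_measures. ereal_integral \<nu> \<phi>)"

definition unique_maximizing :: "(real \<Rightarrow> ereal) \<Rightarrow> real measure \<Rightarrow> bool" where
  "unique_maximizing \<phi> \<mu> \<longleftrightarrow> maximizing \<phi> \<mu> \<and> (\<forall>\<nu>. maximizing \<phi> \<nu> \<longrightarrow> \<nu> = \<mu>)"


section \<open>The potentials\<close>

definition g_pot :: "real \<Rightarrow> real \<Rightarrow> ereal" where
  "g_pot c x = (if cos (pi * (x + c)) = 0 then -\<infinity> else ereal (ln \<bar>cos (pi * (x + c))\<bar>))"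

definition g_cut :: "real \<Rightarrow> nat \<Rightarrow> real \<Rightarrow> ereal" where
  "g_cut c d x = max (g_pot c x) (ereal (ln \<bar>sin (pi / 2 ^ d)\<bar>))"

text \<open>The side of 0 on which \<open>g_cut c d\<close> dominates; it is copied to the other side.\<close>

definition right_dominant :: "real \<Rightarrow> nat \<Rightarrow> nat \<Rightarrow> bool" where
  "right_dominant c d d' \<longleftrightarrow>
     (INF x\<in>{0..<1 / 2 ^ d'}. g_cut c d x) \<ge> (SUP x\<in>{1 - 1 / 2 ^ d'..<1}. g_cut c d x) \<and>
     (SUP x\<in>{1 - 1 / 2 ^ d'..<1}. g_cut c d x) = g_cut c d 0"

definition left_dominant :: "real \<Rightarrow> nat \<Rightarrow> nat \<Rightarrow> bool" where
  "left_dominant c d d' \<longleftrightarrow>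
     (INF x\<in>{1 - 1 / 2 ^ d'..<1}. g_cut c d x) \<ge> (SUP x\<in>{0..<1 / 2 ^ d'}. g_cut c d x) \<and>
     (SUP x\<in>{0..<1 / 2 ^ d'}. g_cut c d x) = g_cut c d 0"

text \<open>Only meaningful on \<open>{0..<1}\<close> and if one of the sides is dominant. If both are, both branches
  agree.\<close>

definition g_sym :: "real \<Rightarrow> nat \<Rightarrow> nat \<Rightarrow> real \<Rightarrow> ereal" where
  "g_sym c d d' x =
     (if right_dominant c d d'
      then (if x < 1 - 1 / 2 ^ d' then g_cut c d x else g_cut c d (1 - x))
      else (if x < 1 / 2 ^ d' then g_cut c d (1 - x) else g_cut c d x))"


section \<open>Truncation\<close>

text \<open>Words over \<open>{0,1}\<close> are lists of Booleans, with \<open>True\<close> for the letter 1.\<close>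

definition words :: "nat \<Rightarrow> bool list set" where
  "words n = {\<omega>. length \<omega> = n}"

definition word_val :: "bool list \<Rightarrow> real" where
  "word_val \<omega> = (\<Sum>i<length \<omega>. of_bool (\<omega> ! i) / 2 ^ Suc i)"

definition cylinder :: "bool list \<Rightarrow> real set" where
  "cylinder \<omega> = {word_val \<omega>..<word_val \<omega> + 1 / 2 ^ length \<omega>}"

text \<open>For integrable \<open>\<phi>\<close>; the values \<open>\<plusminus>\<infinity>\<close> are then attained on a null set only.\<close>

definition truncation :: "nat \<Rightarrow> (real \<Rightarrow> ereal) \<Rightarrow> real \<Rightarrow> real" where
  "truncation n \<phi> x =
     (\<Sum>\<omega>\<in>words n. (2 ^ n * (LINT y:cylinder \<omega>|lborel. real_of_ereal (\<phi> y)))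
                     * indicator (cylinder \<omega>) x)"


section \<open>Quotient de Bruijn graphs and the gap\<close>

definition glue :: "bool list \<Rightarrow> bool list set" where
  "glue u = (let Z = {replicate (length u) False, replicate (length u) True}
             in if u \<in> Z then Z else {u})"

text \<open>Nodes and edges are classes of words. The unions range over at most two words, which yield
  the same class.\<close>

definition quotient_de_bruijn :: "nat \<Rightarrow> (bool list set, bool list set) pre_digraph" where
  "quotient_de_bruijn n =
     \<lparr> verts = glue ` words (n - 1),
       arcs = glue ` words n,
       tail = (\<lambda>e. \<Union>\<omega>\<in>e. glue (butlast \<omega>)),
       head = (\<lambda>e. \<Union>\<omega>\<in>e. glue (tl \<omega>)) \<rparr>"

text \<open>A simple cycle, up to the choice of its starting point, is its set of edges.\<close>

definition simple_cycles :: "nat \<Rightarrow> bool list set set set" where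
  "simple_cycles n = {set p |p. pre_digraph.cycle (quotient_de_bruijn n) p}"

text \<open>The constant value of \<open>\<psi>\<close> on the cylinders of the words representing the edge.\<close>

definition edge_weight :: "(real \<Rightarrow> real) \<Rightarrow> bool list set \<Rightarrow> real" where
  "edge_weight \<psi> e = (THE w. \<forall>\<omega>\<in>e. \<forall>x\<in>cylinder \<omega>. \<psi> x = w)"

definition mean_weight :: "(real \<Rightarrow> real) \<Rightarrow> bool list set set \<Rightarrow> real" where
  "mean_weight \<psi> C = (\<Sum>e\<in>C. edge_weight \<psi> e) / real (card C)"

definition max_mean :: "nat \<Rightarrow> (real \<Rightarrow> real) \<Rightarrow> real" where
  "max_mean n \<psi> = Max (mean_weight \<psi> ` simple_cycles n)"

definition max_cycle :: "nat \<Rightarrow> (real \<Rightarrow> real) \<Rightarrow> bool list set set \<Rightarrow> bool" where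
  "max_cycle n \<psi> C \<longleftrightarrow> C \<in> simple_cycles n \<and> mean_weight \<psi> C = max_mean n \<psi>"

text \<open>Only meaningful if there is exactly one maximal cycle.\<close>

definition gap :: "nat \<Rightarrow> (real \<Rightarrow> real) \<Rightarrow> real" where
  "gap n \<psi> = max_mean n \<psi>
     - Max (mean_weight \<psi> ` (simple_cycles n - {THE C. max_cycle n \<psi> C}))"

end

theory Submission
  imports Defs
begin

text \<open>The potential is Lipschitz with constant \<open>L = pi * cot (pi / 2 ^ d)\<close> on cylinders of length \<open>N\<close>, so
  its values along an orbit differ from the edge weights by at most \<open>L / 2 ^ Suc N\<close> per step. An orbit
  of the doubling map is a walk in the quotient de Bruijn graph; it decomposes into runs along the
  maximal cycle \<open>\<gamma>\<close> and excursions. Along a run the orbit shadows the periodic orbit coded by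
  \<open>\<gamma>\<close> at distances that decrease geometrically backwards in time, which costs at most
  \<open>2 * L / 2 ^ N\<close>. An excursion, closed up by an arc of \<open>\<gamma>\<close>, is a closed walk that misses an edge of
  \<open>\<gamma>\<close> and thus loses the gap at every step. Hence the Birkhoff sums, normalized by the mean over the
  periodic orbit, are bounded above by a constant minus a multiple of the number of steps off
  \<open>\<gamma>\<close>; integrating this against an invariant measure yields the claim.

  A cycle through the glued node need not code a periodic orbit, since it may enter the node as
  \<open>0\<dots>0\<close> and leave it as \<open>1\<dots>1\<close>. Unless it is the loop, the maximal cycle avoids the node:
  otherwise deleting a letter, or changing the letters of the constant block, gives a closed walk
  whose weight contradicts the gap.\<close>

section \<open>The truncated logarithm of the cosine\<close>

text \<open>The potential is centred at its peak p = 1 - c, since \<open>cos (pi * (x + c))\<close>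
  is \<open>- cos (pi * (x - p))\<close>; the left dominant case becomes the right dominant one with
  peak c by complementing letters. The obstacle is that copying one side of 0 to the other creates a
  jump at 1 - e, with \<open>e = 1 / 2 ^ d'\<close>, upwards as x increases. Lipschitz comparison of
  two walks is therefore available only towards larger points, or if both stay on one side of the
  jump. One kind of cycle through the glued node escapes it: leaving the node as 1...1 and returning
  as 0...0. There the whole departure is compared with competing departures by explicit
  trigonometric estimates, and the winner depends on p and on the point q reached behind the node.
  In the constant 5/2, an excursion uses 1/2 + 1/2 per step for exchanging averages and values, on
  itself and on the maximal orbit, and 1 more to pay for a run; the exclusion of the node has 5/2
  units per edge of the cycle for all its exchange costs. All weights lie between
  \<open>ln (sin \<alpha>)\<close> and 0, which bounds the gap and forces
  \<open>4 \<le> N\<close>.\<close>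

definition lcut :: "real \<Rightarrow> real \<Rightarrow> real \<Rightarrow> real" where
  "lcut \<alpha> p x = ln (max \<bar>cos (pi * (x - p))\<bar> (sin \<alpha>))"

lemma cos_sq_diff: "(cos A)\<^sup>2 - (cos B)\<^sup>2 = sin (A + B) * sin (B - (A::real))"
proof -
  have "sin (A + B) * sin (B - A) = (sin B * cos A)\<^sup>2 - (cos B * sin A)\<^sup>2"
    by (simp add: sin_add sin_diff algebra_simps power2_eq_square)
  also have "\<dots> = (1 - (cos B)\<^sup>2) * (cos A)\<^sup>2 - (cos B)\<^sup>2 * (1 - (cos A)\<^sup>2)"
    by (simp add: power_mult_distrib sin_squared_eq)
  also have "\<dots> = (cos A)\<^sup>2 - (cos B)\<^sup>2" by (simp add: algebra_simps)
  finally show ?thesis by simp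
qed

lemma sin_mult_pi_nonneg: "0 \<le> t \<Longrightarrow> t \<le> 1 \<Longrightarrow> 0 \<le> sin (pi * t)"
  by (rule sin_ge_zero) (auto simp: mult_left_le)

lemma cos_gt_zero_abs: "\<bar>t\<bar> < 1/2 \<Longrightarrow> 0 < cos (pi * t)"
proof -
  assume "\<bar>t\<bar> < 1/2"
  then have "pi * \<bar>t\<bar> < pi * (1/2)" by (intro mult_strict_left_mono) auto
  moreover have "\<bar>pi * t\<bar> = pi * \<bar>t\<bar>" by (simp add: abs_mult)
  ultimately have "\<bar>pi * t\<bar> < pi / 2" by linarith
  then have "- (pi / 2) < pi * t" "pi * t < pi / 2" unfolding abs_less_iff by simp_all
  then show ?thesis by (rule cos_gt_zero_pi)
qed

lemma cos_ge_cos_abs: "\<bar>t\<bar> \<le> s \<Longrightarrow> s \<le> 1 \<Longrightarrow> cos (pi * s) \<le> cos (pi * t)"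
proof -
  assume "\<bar>t\<bar> \<le> s" "s \<le> 1"
  then have "cos (pi * s) \<le> cos (pi * \<bar>t\<bar>)"
    by (intro cos_monotone_0_pi_le) auto
  also have "pi * \<bar>t\<bar> = \<bar>pi * t\<bar>" by (simp add: abs_mult)
  finally show ?thesis by simp
qed

lemma tan_pi_8: "tan (pi / 8) = sqrt 2 - 1"
proof -
  let ?t = "tan (pi / 8)"
  have pos: "0 < ?t" by (rule tan_gt_zero) auto
  have c: "cos (pi/8) \<noteq> 0" using cos_gt_zero_pi[of "pi/8"] by auto
  have "1 = tan (2 * (pi / 8))" by (simp add: tan_45)
  also have "\<dots> = 2 * ?t / (1 - ?t\<^sup>2)"
    by (rule tan_double) (use c in \<open>auto simp: cos_45\<close>)
  finally have "2 * ?t / (1 - ?t\<^sup>2) = 1" by simp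
  then have "1 - ?t\<^sup>2 = 2 * ?t" by (auto simp: divide_eq_eq split: if_splits)
  then have "(?t + 1)\<^sup>2 = 2" by (simp add: power2_eq_square algebra_simps)
  then have "?t + 1 = sqrt 2" using pos by (intro real_sqrt_unique[symmetric]) auto
  then show ?thesis by simp
qed

lemma cos_pi_8_sq: "(cos (pi / 8))\<^sup>2 = (2 + sqrt 2) / 4"
proof -
  have "cos (2 * (pi/8)) = 2 * (cos (pi/8))\<^sup>2 - 1" by (rule cos_double_cos)
  then show ?thesis by (simp add: cos_45 field_simps)
qed

lemma ln_cos_mvt:
  assumes "a < b" "\<bar>a - p\<bar> < 1/2" "\<bar>b - p\<bar> < 1/2"
  shows "\<exists>\<xi>. a < \<xi> \<and> \<xi> < b \<and>
     ln (cos (pi * (b - p))) - ln (cos (pi * (a - p))) = (b - a) * (pi * tan (pi * (p - \<xi>)))"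
proof (rule MVT2[OF assms(1)])
  fix x assume x: "a \<le> x" "x \<le> b"
  then have "0 < cos (pi * (x - p))" using assms by (intro cos_gt_zero_abs) linarith
  moreover have "tan (pi * (p - x)) = - (sin (pi * (x - p)) / cos (pi * (x - p)))"
  proof -
    have "pi * (p - x) = - (pi * (x - p))" by (simp add: algebra_simps)
    then show ?thesis by (simp add: tan_def)
  qed
  ultimately show "((\<lambda>x. ln (cos (pi * (x - p)))) has_real_derivative pi * tan (pi * (p - x))) (at x)"
    by (auto intro!: derivative_eq_intros simp: field_simps)
qed

lemma tan_mono_pi:
  assumes "s \<le> t" "t < 1/2" "-1/2 < s" shows "tan (pi * s) \<le> tan (pi * t)"
proof (rule tan_mono_le)
  show "- (pi/2) < pi * s" using mult_strict_left_mono[OF assms(3) pi_gt_zero] by simp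
  show "pi * t < pi/2" using mult_strict_left_mono[OF assms(2) pi_gt_zero] by simp
qed (use assms in simp)

text \<open>The slope \<open>pi * tan (pi * (p - x))\<close> decreases in x, so its value at any s
  to the left of the interval bounds the increment. Keeping s apart from a permits one slope for a
  whole family of intervals.\<close>

lemma ln_cos_upper:
  assumes "a \<le> b" "\<bar>a - p\<bar> < 1/2" "\<bar>b - p\<bar> < 1/2" "s \<le> a" "p - s < 1/2"
  shows "ln (cos (pi * (b - p))) - ln (cos (pi * (a - p))) \<le> pi * tan (pi * (p - s)) * (b - a)"
proof (cases "a = b")
  case False
  then obtain \<xi> where \<xi>: "a < \<xi>" "\<xi> < b"
    "ln (cos (pi * (b - p))) - ln (cos (pi * (a - p))) = (b - a) * (pi * tan (pi * (p - \<xi>)))"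
    using ln_cos_mvt[of a b p] assms by auto
  have "tan (pi * (p - \<xi>)) \<le> tan (pi * (p - s))"
    by (rule tan_mono_pi) (use \<xi>(1,2) assms in linarith)+
  then have "(b - a) * (pi * tan (pi * (p - \<xi>))) \<le> (b - a) * (pi * tan (pi * (p - s)))"
    using assms by (intro mult_left_mono) auto
  then show ?thesis using \<xi> by (simp add: mult_ac)
qed simp

lemma ln_cos_lower:
  assumes "a \<le> b" "\<bar>a - p\<bar> < 1/2" "\<bar>b - p\<bar> < 1/2"
  shows "pi * tan (pi * (p - b)) * (b - a) \<le> ln (cos (pi * (b - p))) - ln (cos (pi * (a - p)))"
proof (cases "a = b")
  case False
  then obtain \<xi> where \<xi>: "a < \<xi>" "\<xi> < b"
    "ln (cos (pi * (b - p))) - ln (cos (pi * (a - p))) = (b - a) * (pi * tan (pi * (p - \<xi>)))"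
    using ln_cos_mvt[of a b p] assms by auto
  have "tan (pi * (p - b)) \<le> tan (pi * (p - \<xi>))"
    by (rule tan_mono_pi) (use \<xi>(1,2) assms in linarith)+
  then have "(b - a) * (pi * tan (pi * (p - b))) \<le> (b - a) * (pi * tan (pi * (p - \<xi>)))"
    using assms by (intro mult_left_mono) auto
  then show ?thesis using \<xi> by (simp add: mult_ac)
qed simp

section \<open>Comparison and Lipschitz estimates for the cut potential\<close>

context
  fixes \<alpha> :: real
  assumes \<alpha>: "0 < \<alpha>" "\<alpha> \<le> pi / 4"
begin

lemma sin_alpha_pos: "0 < sin \<alpha>" using \<alpha> by (intro sin_gt_zero) auto

lemma sin_alpha_le: "sin \<alpha> \<le> sqrt 2 / 2"
proof -
  have "sin \<alpha> \<le> sin (pi/4)" using \<alpha> by (intro sin_monotone_2pi_le) auto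
  then show ?thesis by (simp add: sin_45)
qed

lemma cot_alpha_ge_1: "1 \<le> cot \<alpha>"
proof -
  have "cos (pi/4) \<le> cos \<alpha>" using \<alpha> by (intro cos_monotone_0_pi_le) auto
  then have "sin \<alpha> \<le> cos \<alpha>" using sin_alpha_le by (simp add: cos_45)
  then show ?thesis using sin_alpha_pos by (simp add: cot_def)
qed

lemma lcut_le_0: "lcut \<alpha> p x \<le> 0"
  using sin_alpha_pos by (auto simp: lcut_def ln_le_zero_iff max_def)

lemma lcut_ge: "ln (sin \<alpha>) \<le> lcut \<alpha> p x"
  using sin_alpha_pos by (auto simp: lcut_def)

lemma lcut_eq_ln_cos:
  assumes "\<bar>x - p\<bar> \<le> 1/4" shows "lcut \<alpha> p x = ln (cos (pi * (x - p)))"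
proof -
  have "cos (pi * (1/4)) \<le> cos (pi * (x - p))" using assms by (intro cos_ge_cos_abs) auto
  then have "sqrt 2 / 2 \<le> cos (pi * (x - p))" by (simp add: cos_45)
  moreover have "0 < sqrt (2::real)" by simp
  ultimately have "0 < cos (pi * (x - p))" "sin \<alpha> \<le> cos (pi * (x - p))" using sin_alpha_le by linarith+
  then have "max \<bar>cos (pi * (x - p))\<bar> (sin \<alpha>) = cos (pi * (x - p))" by simp
  then show ?thesis by (simp add: lcut_def)
qed

lemma lcut_mono_cos:
  assumes "(cos (pi * (y - p)))\<^sup>2 \<le> (cos (pi * (x - p)))\<^sup>2"
  shows "lcut \<alpha> p y \<le> lcut \<alpha> p x"
proof -
  have "\<bar>cos (pi * (y - p))\<bar> \<le> \<bar>cos (pi * (x - p))\<bar>" using assms by (simp add: abs_le_square_iff)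
  then show ?thesis using sin_alpha_pos unfolding lcut_def by (subst ln_le_cancel_iff) auto
qed

text \<open>The difference of the squared cosines factors into sines of the difference and of the
  sum of the points, so its sign says which point is nearer to p modulo 1. Comparing values becomes
  checking signs.\<close>

lemma lcut_compare:
  assumes "0 \<le> sin (pi * (y - x)) * sin (pi * (x + y - 2 * p))"
  shows "lcut \<alpha> p y \<le> lcut \<alpha> p x"
proof (rule lcut_mono_cos)
  have e: "pi * (x - p) + pi * (y - p) = pi * (x + y - 2 * p)" "pi * (y - p) - pi * (x - p) = pi * (y - x)"
    by (auto simp: algebra_simps)
  have "(cos (pi * (x - p)))\<^sup>2 - (cos (pi * (y - p)))\<^sup>2 = sin (pi * (x + y - 2 * p)) * sin (pi * (y - x))"
    using cos_sq_diff[of "pi * (x - p)" "pi * (y - p)"] unfolding e .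
  then show "(cos (pi * (y - p)))\<^sup>2 \<le> (cos (pi * (x - p)))\<^sup>2" using assms by (simp add: mult.commute)
qed

lemma lcut_compare_right:
  assumes "b \<le> a" "a - b \<le> 1" "0 \<le> 2 * p - a - b" "2 * p - a - b \<le> 1"
  shows "lcut \<alpha> p b \<le> lcut \<alpha> p a"
proof (rule lcut_compare)
  have "0 \<le> sin (pi * (a - b)) * sin (pi * (2 * p - a - b))"
    using assms by (intro mult_nonneg_nonneg sin_mult_pi_nonneg) auto
  also have "\<dots> = sin (- (pi * (a - b))) * sin (- (pi * (2 * p - a - b)))" by simp
  also have "\<dots> = sin (pi * (b - a)) * sin (pi * (a + b - 2 * p))" by (simp add: algebra_simps)
  finally show "0 \<le> sin (pi * (b - a)) * sin (pi * (a + b - 2 * p))" .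
qed

text \<open>By periodicity -b stands for the point 1 - b of the circle, on the far side of
  0.\<close>

lemma lcut_compare_left:
  assumes "0 \<le> a + b" "a + b \<le> 1" "0 \<le> 2 * p - (a - b)" "2 * p - (a - b) \<le> 1"
  shows "lcut \<alpha> p (- b) \<le> lcut \<alpha> p a"
  using lcut_compare_right[of "-b" a p] assms by simp

lemma lcut_reflect: "lcut \<alpha> (1 - p) (1 - x) = lcut \<alpha> p x"
proof -
  have "cos (pi * (1 - x - (1 - p))) = cos (- (pi * (x - p)))" by (simp add: algebra_simps)
  then show ?thesis by (simp add: lcut_def)
qed

lemma lcut_minus_1: "lcut \<alpha> p (x - 1) = lcut \<alpha> p x"
proof -
  have "cos (pi * (x - 1 - p)) = - cos (pi * (x - p))"
    using cos_minus_pi[of "pi * (x - p)"] by (simp add: algebra_simps)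
  then show ?thesis by (simp add: lcut_def)
qed

lemma lcut_1_minus: "lcut \<alpha> p (1 - x) = lcut \<alpha> p (- x)"
  using lcut_minus_1[of p "1 - x"] by simp

lemma continuous_lcut: "continuous_on UNIV (lcut \<alpha> p)"
  unfolding lcut_def using sin_alpha_pos by (intro continuous_intros) auto

text \<open>Since \<open>cos (\<theta> + t)\<close> is at most \<open>cos \<theta> + t * sin \<theta>\<close> in absolute value, the ratio of two values
  of \<open>\<bar>cos\<bar>\<close> is at most \<open>1 + t * cot \<alpha>\<close> as long as the smaller one is at least \<open>sin \<alpha>\<close>.\<close>

lemma ln_cos_ratio:
  assumes "sin \<alpha> \<le> \<bar>cos B\<bar>" "\<bar>cos B\<bar> \<le> \<bar>cos A\<bar>"
  shows "ln \<bar>cos A\<bar> - ln \<bar>cos B\<bar> \<le> cot \<alpha> * \<bar>A - B\<bar>"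
proof -
  define t where "t = A - B"
  have pB: "0 < \<bar>cos B\<bar>" and pA: "0 < \<bar>cos A\<bar>" using assms sin_alpha_pos by linarith+
  have "cos A = cos B * cos t - sin B * sin t" using cos_add[of B t] by (simp add: t_def)
  then have "\<bar>cos A\<bar> \<le> \<bar>cos B\<bar> * \<bar>cos t\<bar> + \<bar>sin B\<bar> * \<bar>sin t\<bar>"
    by (metis abs_mult abs_triangle_ineq4)
  also have "\<dots> \<le> \<bar>cos B\<bar> * 1 + \<bar>sin B\<bar> * \<bar>t\<bar>"
    by (intro add_mono mult_left_mono) (auto simp: abs_sin_x_le_abs_x)
  also have "\<bar>sin B\<bar> \<le> cot \<alpha> * \<bar>cos B\<bar>"
  proof (rule power2_le_imp_le)
    have s: "(sin \<alpha>)\<^sup>2 \<le> (cos B)\<^sup>2" using assms(1) sin_alpha_pos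
      by (metis abs_le_square_iff abs_of_pos)
    have "(sin B)\<^sup>2 * (sin \<alpha>)\<^sup>2 \<le> (cos \<alpha>)\<^sup>2 * (cos B)\<^sup>2"
      using s unfolding sin_squared_eq[of B] cos_squared_eq[of \<alpha>] by (simp add: algebra_simps)
    then show "\<bar>sin B\<bar>\<^sup>2 \<le> (cot \<alpha> * \<bar>cos B\<bar>)\<^sup>2"
      using sin_alpha_pos by (simp add: cot_def power_mult_distrib power_divide field_simps)
    show "0 \<le> cot \<alpha> * \<bar>cos B\<bar>" using cot_alpha_ge_1 by simp
  qed
  finally have "\<bar>cos A\<bar> \<le> \<bar>cos B\<bar> * (1 + cot \<alpha> * \<bar>t\<bar>)"
    by (simp add: algebra_simps mult_right_mono)
  then have "\<bar>cos A\<bar> / \<bar>cos B\<bar> \<le> 1 + cot \<alpha> * \<bar>t\<bar>" using pB by (simp add: field_simps)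
  moreover have "ln (\<bar>cos A\<bar> / \<bar>cos B\<bar>) \<le> \<bar>cos A\<bar> / \<bar>cos B\<bar> - 1"
    using pA pB by (intro ln_le_minus_one) simp
  moreover have "ln (\<bar>cos A\<bar> / \<bar>cos B\<bar>) = ln \<bar>cos A\<bar> - ln \<bar>cos B\<bar>" using pA pB by (intro ln_divide_pos)
  ultimately show ?thesis by (simp add: t_def)
qed

lemma ln_max_cos_lipschitz:
  assumes "\<bar>cos B\<bar> \<le> \<bar>cos A\<bar>"
  shows "ln (max \<bar>cos A\<bar> (sin \<alpha>)) - ln (max \<bar>cos B\<bar> (sin \<alpha>)) \<le> cot \<alpha> * \<bar>A - B\<bar>"
proof -
  have c: "0 \<le> cot \<alpha>" using cot_alpha_ge_1 by simp
  consider "sin \<alpha> \<le> \<bar>cos B\<bar>" | "\<bar>cos A\<bar> \<le> sin \<alpha>" | "\<bar>cos B\<bar> < sin \<alpha>" "sin \<alpha> < \<bar>cos A\<bar>" by linarith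
  then show ?thesis
  proof cases
    case 1
    then have "sin \<alpha> \<le> \<bar>cos A\<bar>" using assms by (rule order_trans)
    then have "max \<bar>cos A\<bar> (sin \<alpha>) = \<bar>cos A\<bar>" "max \<bar>cos B\<bar> (sin \<alpha>) = \<bar>cos B\<bar>"
      using 1 by (simp_all add: max_absorb1)
    then show ?thesis using ln_cos_ratio[OF 1 assms] by simp
  next
    case 2 then show ?thesis using assms c by (simp add: max_def)
  next
    case 3
    \<comment> \<open>The cut lies strictly between the two values. Stop where
      \<open>\<bar>cos\<bar>\<close> equals \<open>sin \<alpha>\<close>; only the remaining fraction
      1 - s of the interval counts.\<close>
    have "continuous_on UNIV (\<lambda>s. \<bar>cos (B + s * (A - B))\<bar>)" by (intro continuous_intros)
    then have "\<exists>s. 0 \<le> s \<and> s \<le> 1 \<and> \<bar>cos (B + s * (A - B))\<bar> = sin \<alpha>"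
      using 3 by (intro IVT') (auto intro: continuous_on_subset)
    then obtain s where s: "0 \<le> s" "s \<le> 1" "\<bar>cos (B + s * (A - B))\<bar> = sin \<alpha>" by blast
    have "ln \<bar>cos A\<bar> - ln \<bar>cos (B + s * (A - B))\<bar> \<le> cot \<alpha> * \<bar>A - (B + s * (A - B))\<bar>"
      using s 3 by (intro ln_cos_ratio) auto
    also have "A - (B + s * (A - B)) = (1 - s) * (A - B)" by (simp add: algebra_simps)
    also have "cot \<alpha> * \<bar>(1 - s) * (A - B)\<bar> \<le> cot \<alpha> * \<bar>A - B\<bar>"
      using s c by (intro mult_left_mono) (auto simp: abs_mult mult_left_le_one_le)
    finally show ?thesis using 3 s by (simp add: max_def)
  qed
qed

text \<open>\<open>pi * cot \<alpha>\<close> is the absolute slope of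
  \<open>ln \<bar>cos (pi * (x - p))\<bar>\<close> where it meets the cut, the steepest slope that
  survives cutting.\<close>

lemma lcut_lipschitz: "\<bar>lcut \<alpha> p x - lcut \<alpha> p y\<bar> \<le> pi * cot \<alpha> * \<bar>x - y\<bar>"
proof -
  have *: "lcut \<alpha> p x - lcut \<alpha> p y \<le> pi * cot \<alpha> * \<bar>x - y\<bar>"
    if "\<bar>cos (pi * (y - p))\<bar> \<le> \<bar>cos (pi * (x - p))\<bar>" for x y
  proof -
    have e: "pi * (x - p) - pi * (y - p) = pi * (x - y)" by (simp add: algebra_simps)
    have "cot \<alpha> * \<bar>pi * (x - p) - pi * (y - p)\<bar> = pi * cot \<alpha> * \<bar>x - y\<bar>"
      unfolding e by (simp add: abs_mult)
    then show ?thesis using ln_max_cos_lipschitz[OF that] unfolding lcut_def by linarith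
  qed
  have mono: "lcut \<alpha> p y \<le> lcut \<alpha> p x" if "\<bar>cos (pi * (y - p))\<bar> \<le> \<bar>cos (pi * (x - p))\<bar>" for x y
    using that by (intro lcut_mono_cos) (simp add: abs_le_square_iff)
  show ?thesis
  proof (cases "\<bar>cos (pi * (y - p))\<bar> \<le> \<bar>cos (pi * (x - p))\<bar>")
    case True then show ?thesis using *[OF True] mono[OF True] by simp
  next
    case False
    then have F: "\<bar>cos (pi * (x - p))\<bar> \<le> \<bar>cos (pi * (y - p))\<bar>" by simp
    show ?thesis using *[OF F] mono[OF F] by (simp add: abs_minus_commute)
  qed
qed

lemma ln_sin_alpha_le: "ln (sin \<alpha>) \<le> - (ln 2 / 2)"
proof -
  have "ln (sin \<alpha>) \<le> ln (sqrt 2 / 2)" using sin_alpha_pos sin_alpha_le by (subst ln_le_cancel_iff) auto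
  also have "\<dots> = - (ln 2 / 2)" by (simp add: ln_div ln_sqrt)
  finally show ?thesis .
qed

text \<open>The shift by a half turns the cosine into \<open>sin (pi * (t - p))\<close>, with t
  within 1/4 of p. The cut does not spoil the bound because
  \<open>sin \<alpha> \<le> sqrt 2 / 2\<close>.\<close>

lemma lcut_half_le:
  assumes "\<bar>p - t\<bar> \<le> 1/4" shows "lcut \<alpha> p (- (1/2 - t)) \<le> - (ln 2 / 2)"
proof -
  have "pi * (- (1/2 - t) - p) = pi * (t - p) - pi / 2" by (simp add: algebra_simps)
  then have e: "cos (pi * (- (1/2 - t) - p)) = sin (pi * (t - p))" by (simp add: cos_diff)
  have "cos (pi * (1/4)) \<le> cos (pi * (t - p))" using assms by (intro cos_ge_cos_abs) linarith+
  then have "sqrt 2 / 2 \<le> cos (pi * (t - p))" by (simp add: cos_45)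
  then have "(sqrt 2 / 2)\<^sup>2 \<le> (cos (pi * (t - p)))\<^sup>2" by (intro power_mono) auto
  then have "(sin (pi * (t - p)))\<^sup>2 \<le> (sqrt 2 / 2)\<^sup>2"
    by (simp add: sin_squared_eq power_divide)
  then have "\<bar>sin (pi * (t - p))\<bar> \<le> sqrt 2 / 2"
    by (metis abs_le_square_iff abs_of_nonneg divide_nonneg_nonneg real_sqrt_ge_zero zero_le_numeral)
  then have "max \<bar>cos (pi * (- (1/2 - t) - p))\<bar> (sin \<alpha>) \<le> sqrt 2 / 2" using e sin_alpha_le by simp
  then have "lcut \<alpha> p (- (1/2 - t)) \<le> ln (sqrt 2 / 2)"
    unfolding lcut_def using sin_alpha_pos by (subst ln_le_cancel_iff) auto
  also have "\<dots> = - (ln 2 / 2)" by (simp add: ln_div ln_sqrt)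
  finally show ?thesis .
qed

end

section \<open>Departures from the glued node\<close>

text \<open>On \<open>{0..<1}\<close> this is \<open>g_sym\<close> in the right dominant case, for p
  = 1 - c and \<open>e = 1 / 2 ^ d'\<close>.\<close>

definition lsym :: "real \<Rightarrow> real \<Rightarrow> real \<Rightarrow> real \<Rightarrow> real" where
  "lsym \<alpha> p e x = (if x < 1 - e then lcut \<alpha> p x else lcut \<alpha> p (1 - x))"

lemma sum_half_powers_le: "(\<Sum>j\<in>{m..<n}. 1 / 2 ^ j) \<le> 2 / (2 ^ m :: real)"
proof (cases "m \<le> n")
  case True
  then have "(\<Sum>j\<in>{m..<n}. 1 / 2 ^ j) = 2 * (1 / 2 ^ m :: real) - 2 * (1 / 2 ^ n)"
  proof (induction n rule: dec_induct)
    case (step n)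
    have "(1 / 2 ^ n :: real) = 2 * (1 / 2 ^ Suc n)" by simp
    with step show ?case by (simp only: sum.atLeastLessThan_Suc)
  qed simp
  then show ?thesis by simp
qed simp

lemma one_minus_inverse_le_ln: "0 < x \<Longrightarrow> 1 - 1 / x \<le> ln (x::real)"
  using ln_le_minus_one[of "1 / x"] by (simp add: ln_div)

lemma sqrt_2_bounds: "1.41421 < sqrt 2" "sqrt 2 < 1.41422"
  by (rule real_less_rsqrt, simp add: power2_eq_square) (rule real_less_lsqrt, simp_all add: power2_eq_square)

lemma pi_less: "pi < 3.1416" using pi_approx by simp

lemma ln_cos_pi_8: "ln (cos (pi / 8)) = ln ((2 + sqrt 2) / 4) / 2"
proof -
  have "0 < cos (pi/8)" by (rule cos_gt_zero_pi) auto
  then have "ln ((cos (pi/8))\<^sup>2) = 2 * ln (cos (pi/8))" by (simp add: ln_realpow)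
  then show ?thesis by (simp add: cos_pi_8_sq)
qed

text \<open>The first point of a departure has value at most \<open>- (ln 2 / 2)\<close>, a
  competitor within 1/8 of the peak at least \<open>ln (cos (pi / 8))\<close>. The difference is
  half of \<open>ln ((2 + sqrt 2) / 2)\<close>.\<close>

lemma first_step_gain: "(sqrt 2 - 1) / 2 \<le> ln 2 / 2 + ln (cos (pi / 8))"
proof -
  have s: "sqrt 2 * sqrt 2 = (2::real)" by simp
  have "1 - 1 / ((2 + sqrt 2) / 2) \<le> ln ((2 + sqrt 2) / 2)" by (rule one_minus_inverse_le_ln) (simp add: add_pos_pos)
  moreover have "1 / ((2 + sqrt 2) / 2) = 2 - sqrt 2"
  proof -
    have "(2 - sqrt 2) * ((2 + sqrt 2) / 2) = 1" by (simp add: algebra_simps)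
    then show ?thesis using sqrt_2_bounds by (simp add: field_simps)
  qed
  moreover have "ln ((2 + sqrt 2) / 2) = ln (2 * ((2 + sqrt 2) / 4))" by (rule arg_cong[of _ _ ln]) simp
  moreover have "\<dots> = ln 2 + ln ((2 + sqrt 2) / 4)" by (rule ln_mult_pos) (auto intro: add_pos_pos)
  ultimately show ?thesis unfolding ln_cos_pi_8 by argo
qed

lemma first_two_steps_gain: "0.1785 \<le> ln 2 / 2 + 2 * ln (cos (pi / 8))"
proof -
  \<comment> \<open>1.098 is just below the square root of \<open>(sqrt 2 + 1) / 2\<close>. Taking
    the root before using \<open>1 - 1 / x \<le> ln x\<close> keeps that bound sharp enough.\<close>
  have "1 - 1 / 1.098 \<le> ln (1.098::real)" by (rule one_minus_inverse_le_ln) simp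
  then have "0.1785 \<le> 2 * ln (1.098::real)" by simp
  also have "2 * ln (1.098::real) = ln (1.098 ^ 2)" by (subst ln_realpow) simp_all
  also have "\<dots> \<le> ln (sqrt 2 * ((2 + sqrt 2) / 4))"
  proof (subst ln_le_cancel_iff)
    have "sqrt 2 * ((2 + sqrt 2) / 4) = (sqrt 2 + 1) / 2" by (simp add: algebra_simps)
    then show "(1.098::real) ^ 2 \<le> sqrt 2 * ((2 + sqrt 2) / 4)"
      using sqrt_2_bounds by (simp add: power2_eq_square)
  qed (use sqrt_2_bounds in auto)
  also have "\<dots> = ln 2 / 2 + ln ((2 + sqrt 2) / 4)"
    by (subst ln_mult_pos) (auto simp: ln_sqrt intro: add_pos_pos)
  finally show ?thesis unfolding ln_cos_pi_8 by simp
qed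

section \<open>Departures against their competitors, in the presence of a jump\<close>

context
  fixes \<alpha> p q e :: real and m N :: nat
  assumes \<alpha>: "0 < \<alpha>" "\<alpha> \<le> pi / 4"
    and e: "e = 1 / 2 ^ m" and m: "2 \<le> m" and mN: "m \<le> N" and N: "4 \<le> N"
    and p: "e / 2 \<le> p" "p < 1 / 2" and q: "0 \<le> q" "q < 1 / 2"
begin

lemma e_bounds: "0 < e" "e \<le> 1 / 4"
proof -
  show "0 < e" by (simp add: e)
  have "(2::real) ^ 2 \<le> 2 ^ m" using m by (intro power_increasing) auto
  then show "e \<le> 1/4" by (simp add: e field_simps)
qed

lemma p_pos: "0 < p" using p e_bounds by linarith

lemma lsym_far: "e < b \<Longrightarrow> lsym \<alpha> p e (1 - b) = lcut \<alpha> p (- b)"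
  by (simp add: lsym_def lcut_1_minus[OF \<alpha>])

lemma lsym_near: "b \<le> e \<Longrightarrow> lsym \<alpha> p e (1 - b) = lcut \<alpha> p b"
  by (simp add: lsym_def)

lemma half_pow_le: "i \<le> j \<Longrightarrow> 1 / 2 ^ j \<le> 1 / (2 ^ i :: real)"
  by (intro divide_left_mono) (auto intro: power_increasing)

lemma near_imp:
  assumes "(1 - q) / 2 ^ j \<le> e" shows "m \<le> j"
proof -
  have "1 / 2 / 2 ^ j < (1 - q) / 2 ^ j" using q by (intro divide_strict_right_mono) auto
  with assms have "1 / 2 / 2 ^ j < 1 / (2::real) ^ m" by (simp add: e)
  then have "(2::real) ^ m < 2 ^ (Suc j)" by (simp add: field_simps)
  then have "m < Suc j" by (subst (asm) power_strict_increasing_iff) auto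
  then show ?thesis by simp
qed

text \<open>Because \<open>1 / 2 < 1 - q \<le> 1\<close>, the distance
  \<open>(1 - q) / 2 ^ j\<close> lies in the dyadic shell above \<open>1 / 2 ^ Suc j\<close> and up
  to \<open>1 / 2 ^ j\<close>. Whether it falls into the mirrored interval depends on j
  alone.\<close>

lemma far_iff: "e < (1 - q) / 2 ^ j \<longleftrightarrow> j < m"
proof
  assume "e < (1 - q) / 2 ^ j"
  show "j < m"
  proof (rule ccontr)
    assume "\<not> j < m"
    then have "1 / 2 ^ j \<le> 1 / (2 ^ m :: real)" by (intro half_pow_le) auto
    moreover have "(1 - q) / 2 ^ j \<le> 1 / 2 ^ j" using q by (intro divide_right_mono) auto
    ultimately show False using \<open>e < _\<close> by (simp add: e)
  qed
next
  assume "j < m" then show "e < (1 - q) / 2 ^ j" using near_imp[of j] by linarith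
qed

lemma far_step:
  assumes "1 \<le> j" "j < m" "0 \<le> a + (1 - q) / 2 ^ j" "a + (1 - q) / 2 ^ j \<le> 1"
    "0 \<le> 2 * p - (a - (1 - q) / 2 ^ j)" "2 * p - (a - (1 - q) / 2 ^ j) \<le> 1"
  shows "lsym \<alpha> p e (1 - (1 - q) / 2 ^ j) \<le> lcut \<alpha> p a"
proof -
  have "lsym \<alpha> p e (1 - (1 - q) / 2 ^ j) = lcut \<alpha> p (- ((1 - q) / 2 ^ j))"
    using assms by (intro lsym_far) (simp add: far_iff)
  also have "\<dots> \<le> lcut \<alpha> p a" using assms by (intro lcut_compare_left[OF \<alpha>])
  finally show ?thesis .
qed

text \<open>Here all comparisons hold term by term.\<close>

lemma departure_C0:
  assumes "q = 0 \<or> e \<le> p \<and> q \<le> 4 * p"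
  shows "(\<Sum>j\<in>{1..<N}. lsym \<alpha> p e (1 - (1 - q) / 2 ^ j)) \<le> (\<Sum>j\<in>{1..<N}. lcut \<alpha> p ((1 + q) / 2 ^ j))"
proof (rule sum_mono)
  fix j assume j: "j \<in> {1..<N}"
  define t u where "t = 1 / (2::real) ^ j" and "u = q / 2 ^ j"
  have ab: "(1 + q) / 2 ^ j = t + u" "(1 - q) / 2 ^ j = t - u"
    by (auto simp: t_def u_def field_simps)
  show "lsym \<alpha> p e (1 - (1 - q) / 2 ^ j) \<le> lcut \<alpha> p ((1 + q) / 2 ^ j)"
  proof (cases "j = 1")
    case True
    \<comment> \<open>The first points of both walks coincide:
      \<open>1 - (1 - q) / 2 = (1 + q) / 2\<close>.\<close>
    have "lsym \<alpha> p e (1 - (1 - q) / 2 ^ j) = lcut \<alpha> p (- ((1 - q) / 2 ^ j))"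
      using True m by (intro lsym_far) (simp only: far_iff)
    also have "- ((1 - q) / 2 ^ j) = (1 + q) / 2 ^ j - 1" using True by (simp add: field_simps)
    finally show ?thesis by (simp add: lcut_minus_1[OF \<alpha>])
  next
    case False
    with j have j2: "2 \<le> j" by simp
    have j4: "t \<le> 1 / 4" using half_pow_le[OF j2] by (simp add: t_def)
    have "q * t \<le> q * (1 / 4)" using j4 q by (intro mult_left_mono)
    then have qj: "u \<le> q / 4" by (simp add: t_def u_def)
    have qj0: "0 \<le> u" "0 \<le> t" using q by (simp_all add: t_def u_def)
    show ?thesis
    proof (cases "j < m")
      case True
      have "q / 4 \<le> p" using assms p_pos by auto
      then show ?thesis using far_step[of j "t + u"] j True qj qj0 j4 p unfolding ab by simp
    next
      case False
      then have "lsym \<alpha> p e (1 - (1 - q) / 2 ^ j) = lcut \<alpha> p ((1 - q) / 2 ^ j)"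
        using far_iff[of j] by (intro lsym_near) linarith
      moreover have "lcut \<alpha> p ((1 - q) / 2 ^ j) \<le> lcut \<alpha> p ((1 + q) / 2 ^ j)"
      proof (cases "q = 0")
        case F: False
        have "t \<le> e" unfolding e t_def using False by (intro half_pow_le) simp
        moreover have "e \<le> p" using F assms by auto
        ultimately show ?thesis using qj qj0 j4 p q unfolding ab by (intro lcut_compare_right[OF \<alpha>]) simp_all
      qed simp
      ultimately show ?thesis by simp
    qed
  qed
qed

text \<open>Concavity makes the slope at 0, \<open>pi * tan (pi * p)\<close>, the largest to the
  right of 0. Both points stay within 1/4 of p, where the cut is inactive.\<close>

lemma lcut_slope:
  assumes "0 \<le> a" "a \<le> b" "b - p \<le> 1 / 4" "p \<le> 1 / 4"
  shows "lcut \<alpha> p b - lcut \<alpha> p a \<le> pi * tan (pi * p) * (b - a)"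
proof -
  have "\<bar>a - p\<bar> \<le> 1/4" "\<bar>b - p\<bar> \<le> 1/4" using assms p_pos by linarith+
  moreover have "ln (cos (pi * (b - p))) - ln (cos (pi * (a - p))) \<le> pi * tan (pi * (p - 0)) * (b - a)"
    using assms p p_pos by (intro ln_cos_upper) linarith+
  ultimately show ?thesis by (simp add: lcut_eq_ln_cos[OF \<alpha>])
qed

lemma tan_p_nonneg: "0 \<le> tan (pi * p)"
proof -
  have "pi * p < pi * (1/2)" using p by (intro mult_strict_left_mono) auto
  then show ?thesis using p_pos by (intro less_imp_le[OF tan_gt_zero]) auto
qed

text \<open>From step m on the walk is mirrored to \<open>(1 - q) / 2 ^ j\<close> while the
  competitor sits at \<open>q / 2 ^ j\<close>; the distances \<open>(1 - 2 * q) / 2 ^ j\<close> form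
  a geometric series.\<close>

lemma lcut_sum_slope:
  assumes "p \<le> 1 / 4" "m \<le> i"
  shows "(\<Sum>j\<in>{i..<N}. lsym \<alpha> p e (1 - (1 - q) / 2 ^ j) - lcut \<alpha> p (q / 2 ^ j))
    \<le> pi * tan (pi * p) * (1 - 2 * q) * (2 / 2 ^ i)"
proof -
  have "(\<Sum>j\<in>{i..<N}. lsym \<alpha> p e (1 - (1 - q) / 2 ^ j) - lcut \<alpha> p (q / 2 ^ j))
     \<le> (\<Sum>j\<in>{i..<N}. pi * tan (pi * p) * (1 - 2 * q) * (1 / 2 ^ j))"
  proof (rule sum_mono)
    fix j assume j: "j \<in> {i..<N}"
    then have b: "(1 - q) / 2 ^ j \<le> e" using assms far_iff[of j] by auto
    then have "lsym \<alpha> p e (1 - (1 - q) / 2 ^ j) - lcut \<alpha> p (q / 2 ^ j)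
       = lcut \<alpha> p ((1 - q) / 2 ^ j) - lcut \<alpha> p (q / 2 ^ j)" by (simp add: lsym_near)
    also have "\<dots> \<le> pi * tan (pi * p) * ((1 - q) / 2 ^ j - q / 2 ^ j)"
    proof (rule lcut_slope)
      show "(1 - q) / 2 ^ j - p \<le> 1 / 4" using b e_bounds p_pos by linarith
    qed (use q assms in \<open>auto intro: divide_right_mono\<close>)
    also have "(1 - q) / 2 ^ j - q / 2 ^ j = (1 - 2 * q) * (1 / 2 ^ j)" by (simp add: field_simps)
    finally show "lsym \<alpha> p e (1 - (1 - q) / 2 ^ j) - lcut \<alpha> p (q / 2 ^ j)
      \<le> pi * tan (pi * p) * (1 - 2 * q) * (1 / 2 ^ j)" by (simp only: mult.assoc)
  qed
  also have "\<dots> = pi * tan (pi * p) * (1 - 2 * q) * (\<Sum>j\<in>{i..<N}. 1 / 2 ^ j)" by (simp add: sum_distrib_left)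
  also have "\<dots> \<le> pi * tan (pi * p) * (1 - 2 * q) * (2 / 2 ^ i)"
    using q tan_p_nonneg by (intro mult_left_mono sum_half_powers_le) auto
  finally show ?thesis .
qed

lemma far_steps_nonpos:
  assumes "1 \<le> j" "j < m" "p \<le> 1/4"
  shows "lsym \<alpha> p e (1 - (1 - q) / 2 ^ j) - lcut \<alpha> p (q / 2 ^ j) \<le> 0"
proof -
  define t u where "t = 1 / (2::real) ^ j" and "u = q / 2 ^ j"
  have ab: "q / 2 ^ j = u" "(1 - q) / 2 ^ j = t - u" by (auto simp: t_def u_def field_simps)
  have t: "t \<le> 1 / 2" using half_pow_le[OF assms(1)] by (simp add: t_def)
  have "q / 2 ^ j \<le> (1 / 2) / 2 ^ j" using q by (intro divide_right_mono) auto
  then have "u \<le> t / 2" by (simp add: t_def u_def)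
  moreover have "0 \<le> u" "0 \<le> t" using q by (auto simp: t_def u_def)
  ultimately have "lsym \<alpha> p e (1 - (1 - q) / 2 ^ j) \<le> lcut \<alpha> p (q / 2 ^ j)"
    using far_step[of j u] assms p_pos t unfolding ab by simp
  then show ?thesis by simp
qed

lemma first_step:
  assumes "p \<le> 1 / 4"
  shows "lsym \<alpha> p e (1 - (1 - q) / 2 ^ 1) \<le> - (ln 2 / 2)"
proof -
  have "lsym \<alpha> p e (1 - (1 - q) / 2 ^ 1) = lcut \<alpha> p (- ((1 - q) / 2 ^ 1))"
    using m by (intro lsym_far) (simp only: far_iff)
  moreover have "- ((1 - q) / 2 ^ 1) = - (1/2 - q / 2)" by (simp add: field_simps)
  moreover have "lcut \<alpha> p (- (1/2 - q / 2)) \<le> - (ln 2 / 2)"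
    using q p_pos assms by (intro lcut_half_le[OF \<alpha>]) linarith
  ultimately show ?thesis by simp
qed

lemma lcut_ge_pi_8: "\<bar>x - p\<bar> \<le> 1/8 \<Longrightarrow> ln (cos (pi / 8)) \<le> lcut \<alpha> p x"
proof -
  assume x: "\<bar>x - p\<bar> \<le> 1/8"
  then have "cos (pi * (1/8)) \<le> cos (pi * (x - p))" by (intro cos_ge_cos_abs) auto
  moreover have "0 < cos (pi / 8)" by (rule cos_gt_zero_pi) auto
  ultimately have "ln (cos (pi / 8)) \<le> ln (cos (pi * (x - p)))" by (subst ln_le_cancel_iff) auto
  then show ?thesis using x by (simp add: lcut_eq_ln_cos[OF \<alpha>])
qed

lemma sum_split_steps:
  assumes "1 \<le> i" "i \<le> N"
  shows "(\<Sum>j\<in>{1..<N}. f j) = (\<Sum>j\<in>{1..<i}. f j) + (\<Sum>j\<in>{i..<N}. (f j :: real))"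
  using assms by (simp add: sum.atLeastLessThan_concat)

lemma pi_tan_pi_8: "pi * (sqrt 2 - 1) \<le> 1.3014"
proof -
  have "pi * (sqrt 2 - 1) \<le> 3.1416 * 0.41422" using pi_less sqrt_2_bounds by (intro mult_mono) auto
  then show ?thesis by simp
qed

text \<open>The loss of the mirrored steps is paid by step m - 1, the last one before the mirrored
  interval. There the walk sits at -b with \<open>b = 2 * e * (1 - q)\<close>, and the competitor
  has at least the value at 0. Between -b and 0 the slope is at least \<open>\<sigma>\<close>, so
  the gain \<open>\<sigma> * b\<close> covers the loss
  \<open>\<sigma> * (1 - 2 * q) * (2 * e)\<close>. If -b is already cut off, the fixed gain g takes
  its place.\<close>

lemma departure_B_small:
  assumes "3 \<le> m" "p < 1 / 8"
  shows "(\<Sum>j\<in>{1..<N}. lsym \<alpha> p e (1 - (1 - q) / 2 ^ j)) \<le> (\<Sum>j\<in>{1..<N}. lcut \<alpha> p (q / 2 ^ j))"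
proof -
  define D where "D j = lsym \<alpha> p e (1 - (1 - q) / 2 ^ j) - lcut \<alpha> p (q / 2 ^ j)" for j
  define \<sigma> where "\<sigma> = pi * tan (pi * p)"
  define g where "g = ln 2 / 2 + ln (cos (pi / 8))"
  have g: "(sqrt 2 - 1) / 2 \<le> g" using first_step_gain by (simp add: g_def)
  have \<sigma>: "0 \<le> \<sigma>" "\<sigma> \<le> 1.3014"
  proof -
    show "0 \<le> \<sigma>" using tan_p_nonneg by (simp add: \<sigma>_def)
    have "tan (pi * p) \<le> tan (pi * (1/8))" using assms p_pos by (intro tan_mono_pi) auto
    then have "\<sigma> \<le> pi * (sqrt 2 - 1)" by (simp add: \<sigma>_def tan_pi_8)
    then show "\<sigma> \<le> 1.3014" using pi_tan_pi_8 by linarith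
  qed
  have e8: "e \<le> 1/8"
  proof -
    have "1 / 2 ^ m \<le> 1 / (2 ^ 3 :: real)" using assms by (intro half_pow_le)
    then show ?thesis by (simp add: e)
  qed
  have pow: "2 / 2 ^ m = 2 * e" "1 / 2 ^ (m - 1) = 2 * e"
  proof -
    show "2 / 2 ^ m = 2 * e" by (simp add: e)
    have "(2::real) ^ m = 2 * 2 ^ (m - 1)" using m by (metis Suc_diff_1 less_le_trans pos2 power_Suc)
    then show "1 / 2 ^ (m - 1) = 2 * e" by (simp add: e)
  qed
  have tail: "(\<Sum>j\<in>{m..<N}. D j) \<le> \<sigma> * (1 - 2 * q) * (2 * e)"
    using lcut_sum_slope[of m] assms unfolding D_def \<sigma>_def pow by simp
  have near0: "ln (cos (pi / 8)) \<le> lcut \<alpha> p 0" using assms p_pos by (intro lcut_ge_pi_8) auto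
  have far: "D j \<le> 0" if "1 \<le> j" "j < m" for j
    using far_steps_nonpos[OF that] assms unfolding D_def by simp
  define b where "b = 2 * e * (1 - q)"
  have "D (m - 1) = lcut \<alpha> p (- b) - lcut \<alpha> p (2 * e * q)"
  proof -
    have "e < (1 - q) / 2 ^ (m - 1)" unfolding far_iff using m by simp
    moreover have "(1 - q) / 2 ^ (m - 1) = b" "q / 2 ^ (m - 1) = 2 * e * q"
      using pow(2) by (simp_all add: b_def field_simps)
    ultimately show ?thesis by (simp add: D_def lsym_far)
  qed
  moreover have "lcut \<alpha> p 0 \<le> lcut \<alpha> p (2 * e * q)"
  proof (rule lcut_compare_right[OF \<alpha>])
    have "e * q \<le> e * (1/2)" using q e_bounds by (intro mult_left_mono) auto
    then show "0 \<le> 2 * p - 2 * e * q - 0" "2 * e * q - 0 \<le> 1" using p e_bounds by linarith+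
    have "0 \<le> e * q" using q e_bounds by simp
    then show "2 * p - 2 * e * q - 0 \<le> 1" "0 \<le> 2 * e * q" using p by auto
  qed
  ultimately have Dm: "D (m - 1) \<le> lcut \<alpha> p (- b) - lcut \<alpha> p 0" by simp
  have b: "0 \<le> b" "b \<le> 1/4" "e * q \<le> e"
  proof -
    show "0 \<le> b" using q e_bounds by (simp add: b_def)
    show "e * q \<le> e" using q e_bounds by (simp add: mult_left_le)
    have "0 \<le> e * q" using q e_bounds by simp
    then show "b \<le> 1/4" using e8 by (simp add: b_def algebra_simps)
  qed
  have split: "(\<Sum>j\<in>{1..<N}. D j) = (\<Sum>j\<in>{1..<m-1}. D j) + D (m - 1) + (\<Sum>j\<in>{m..<N}. D j)"
  proof -
    have "(\<Sum>j\<in>{1..<m}. D j) = (\<Sum>j\<in>{1..<m-1}. D j) + D (m - 1)"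
      using assms(1) sum.atLeastLessThan_Suc[of 1 "m - 1" D] by simp
    then show ?thesis using sum_split_steps[of m D] m mN by simp
  qed
  have "(\<Sum>j\<in>{1..<m-1}. D j) \<le> 0" by (intro sum_nonpos far) auto
  moreover have sum1: "(\<Sum>j\<in>{1..<m-1}. D j) \<le> D 1"
  proof -
    have "(\<Sum>j\<in>{1..<m-1}. D j) = D 1 + (\<Sum>j\<in>{Suc 1..<m-1}. D j)"
      using assms(1) by (intro sum.atLeast_Suc_lessThan) auto
    moreover have "(\<Sum>j\<in>{Suc 1..<m-1}. D j) \<le> 0" by (intro sum_nonpos far) auto
    ultimately show ?thesis by simp
  qed
  ultimately have "(\<Sum>j\<in>{1..<N}. D j) \<le> min 0 (D 1) + D (m - 1) + \<sigma> * (1 - 2 * q) * (2 * e)"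
    using split tail by simp
  also have "\<dots> \<le> 0"
  proof (cases "sin \<alpha> \<le> cos (pi * (- b - p))")
    case True
    have ab: "\<bar>- b - p\<bar> < 1/2" "\<bar>0 - p\<bar> < 1/2" using b p_pos assms by auto
    have "lcut \<alpha> p (- b) = ln (cos (pi * (- b - p)))"
      using True cos_gt_zero_abs[OF ab(1)] unfolding lcut_def by simp
    moreover have "lcut \<alpha> p 0 = ln (cos (pi * (0 - p)))" using assms p_pos by (intro lcut_eq_ln_cos[OF \<alpha>]) auto
    moreover have "pi * tan (pi * (p - 0)) * (0 - (- b)) \<le> ln (cos (pi * (0 - p))) - ln (cos (pi * (- b - p)))"
      using b ab by (intro ln_cos_lower) auto
    ultimately have "D (m - 1) \<le> - (\<sigma> * b)" using Dm by (simp add: \<sigma>_def)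
    moreover have "\<sigma> * (1 - 2 * q) * (2 * e) \<le> \<sigma> * b"
    proof -
      have "(1 - 2 * q) * (2 * e) \<le> b" using q e_bounds by (simp add: b_def algebra_simps)
      then show ?thesis using \<sigma> by (simp add: mult.assoc mult_left_mono)
    qed
    ultimately show ?thesis by linarith
  next
    case False
    have "0 < cos (pi * (- b - p))" using b p_pos assms by (intro cos_gt_zero_abs) auto
    then have "lcut \<alpha> p (- b) = ln (sin \<alpha>)" using False by (simp add: lcut_def)
    then have Dg: "D (m - 1) \<le> - g" using Dm near0 ln_sin_alpha_le[OF \<alpha>] by (simp add: g_def)
    have t1: "\<sigma> * (1 - 2 * q) * (2 * e) \<le> 1.3014 * (1 - 2 * q) * (2 * e)"
      using \<sigma> q e_bounds by (intro mult_right_mono) auto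
    show ?thesis
    proof (cases "4 \<le> m")
      case True
      have "1 / 2 ^ m \<le> 1 / (2 ^ 4 :: real)" using True by (intro half_pow_le)
      then have "e \<le> 1/16" by (simp add: e)
      then have "1.3014 * (1 - 2 * q) * (2 * e) \<le> 1.3014 * 1 * (2 * (1/16))"
        using q e_bounds by (intro mult_mono) auto
      then show ?thesis using t1 Dg g sqrt_2_bounds by simp
    next
      case False
      \<comment> \<open>For m = 3 a single gain g no longer covers the bound for the tail. The first
        step gives a second one if \<open>q \<le> 4 * p\<close>; otherwise
        \<open>q > 4 * p \<ge> 2 * e = 1/4\<close> and the tail is halved.\<close>
      then have m3: "m = 3" using assms by simp
      then have e3: "e = 1/8" by (simp add: e)
      show ?thesis
      proof (cases "q \<le> 4 * p")
        case True
        have "lcut \<alpha> p 0 \<le> lcut \<alpha> p (q / 2)"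
          using q p True p_pos by (intro lcut_compare_right[OF \<alpha>]) auto
        then have "D 1 \<le> - g"
          using first_step near0 assms unfolding D_def g_def by simp
        moreover have "1.3014 * (1 - 2 * q) * (2 * e) \<le> 1.3014 * 1 * (1/4)"
          using q e3 by (intro mult_mono) auto
        ultimately show ?thesis using t1 Dg g sqrt_2_bounds by simp
      next
        case False
        then have "1/4 < q" using p e3 by simp
        then have "1.3014 * (1 - 2 * q) * (2 * e) \<le> 1.3014 * (1/2) * (1/4)"
          using q e3 by (intro mult_mono) auto
        then show ?thesis using t1 Dg g sqrt_2_bounds by simp
      qed
    qed
  qed
  finally show ?thesis by (simp add: D_def sum_subtractf)
qed

lemma tan_quarter: "0 \<le> t \<Longrightarrow> t \<le> 1/4 \<Longrightarrow> tan (pi * t) \<le> 1"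
  using tan_mono_pi[of t "1/4"] by (simp add: tan_45)

text \<open>Up to 1/4 the tangent is at most 1, so the derivative
  \<open>pi * (1 + (tan (pi * z))\<^sup>2)\<close> is at most \<open>2 * pi\<close>.\<close>

lemma tan_near_8:
  assumes "0 \<le> t" "t \<le> 1/8"
  shows "tan (pi * (1/8 + t)) \<le> (sqrt 2 - 1) + 2 * pi * t"
proof (cases "t = 0")
  case False
  then have t: "0 < t" using assms by simp
  have "\<exists>z. 1/8 < z \<and> z < 1/8 + t \<and> tan (pi * (1/8 + t)) - tan (pi * (1/8)) = (1/8 + t - 1/8) * (pi * (1 + (tan (pi * z))\<^sup>2))"
  proof (rule MVT2)
    fix z assume "1/8 \<le> z" "z \<le> 1/8 + t"
    then have "cos (pi * z) \<noteq> 0" using assms cos_gt_zero_abs[of z] by auto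
    moreover from this have "1 + (tan (pi * z))\<^sup>2 = inverse ((cos (pi * z))\<^sup>2)"
      by (simp add: tan_sec power_inverse)
    ultimately show "((\<lambda>z. tan (pi * z)) has_real_derivative pi * (1 + (tan (pi * z))\<^sup>2)) (at z)"
      by (auto intro!: derivative_eq_intros simp: mult.commute)
  qed (use t in simp)
  then obtain z where z: "1/8 < z" "z < 1/8 + t"
    "tan (pi * (1/8 + t)) - tan (pi * (1/8)) = t * (pi * (1 + (tan (pi * z))\<^sup>2))" by auto
  have "0 \<le> tan (pi * z)" using z assms tan_mono_pi[of 0 z] by simp
  moreover have "tan (pi * z) \<le> 1" using z assms by (intro tan_quarter) auto
  ultimately have "(tan (pi * z))\<^sup>2 \<le> 1" by (simp add: power_le_one)
  then have "t * (pi * (1 + (tan (pi * z))\<^sup>2)) \<le> t * (pi * 2)" using t by (intro mult_left_mono) auto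
  then show ?thesis using z(3) by (simp add: tan_pi_8 algebra_simps)
qed (simp add: tan_pi_8)

text \<open>With m = 2 only step 1 precedes the mirrored interval, and it gains g. For q > 4/9 the
  factor \<open>1 - 2 * q\<close> keeps the whole tail below that gain; for smaller q the steps 2
  and 3 are estimated separately and only the tail from 4 on is treated by its slope.\<close>

lemma departure_B_quarter:
  assumes "m = 2" "p < 1 / 4" "p < 1/8 + 3 * q / 32 \<or> 4 / 9 < q"
  shows "(\<Sum>j\<in>{1..<N}. lsym \<alpha> p e (1 - (1 - q) / 2 ^ j)) \<le> (\<Sum>j\<in>{1..<N}. lcut \<alpha> p (q / 2 ^ j))"
proof -
  define D where "D j = lsym \<alpha> p e (1 - (1 - q) / 2 ^ j) - lcut \<alpha> p (q / 2 ^ j)" for j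
  define g where "g = ln 2 / 2 + ln (cos (pi / 8))"
  have e4: "e = 1/4" using assms by (simp add: e)
  have p8: "1/8 \<le> p" using p e4 by simp
  have g: "(sqrt 2 - 1) / 2 \<le> g" using first_step_gain by (simp add: g_def)
  have "ln (cos (pi / 8)) \<le> lcut \<alpha> p (q / 2)"
    using assms p8 q by (intro lcut_ge_pi_8) (auto simp: abs_if)
  then have D1: "D 1 \<le> - g" using first_step assms by (simp add: D_def g_def)
  have s1: "(\<Sum>j\<in>{1..<N}. D j) = D 1 + (\<Sum>j\<in>{2..<N}. D j)"
    using sum_split_steps[of 2 D] N by (simp add: numeral_2_eq_2)
  show ?thesis
  proof (cases "4/9 < q")
    case True
    have "(\<Sum>j\<in>{2..<N}. D j) \<le> pi * tan (pi * p) * (1 - 2 * q) * (2 / 2 ^ 2)"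
      unfolding D_def using assms by (intro lcut_sum_slope) auto
    also have "\<dots> \<le> 3.1416 * 1 * (1/9) * (2 / 2 ^ 2)"
      using True pi_less q tan_p_nonneg assms p_pos by (intro mult_mono tan_quarter) auto
    finally have "(\<Sum>j\<in>{2..<N}. D j) \<le> 0.175" by simp
    then have "(\<Sum>j\<in>{1..<N}. D j) \<le> 0" using s1 D1 g sqrt_2_bounds by simp
    then show ?thesis by (simp add: D_def sum_subtractf)
  next
    case False
    then have p9: "p < 1/8 + 3 * q / 32" using assms by auto
    have s2: "(\<Sum>j\<in>{2..<N}. D j) = D 2 + D 3 + (\<Sum>j\<in>{4..<N}. D j)"
      using N by (simp add: sum.atLeast_Suc_lessThan numeral_eq_Suc)
    have near: "D j = lcut \<alpha> p ((1 - q) / 2 ^ j) - lcut \<alpha> p (q / 2 ^ j)" if "2 \<le> j" for j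
      using that assms(1) far_iff[of j] by (simp add: D_def lsym_near)
    have "lcut \<alpha> p ((1 - q) / 2 ^ 2) - lcut \<alpha> p (q / 2 ^ 2) \<le> pi * (sqrt 2 - 1) * (3 * q / 16)"
    proof -
      \<comment> \<open>r is the mirror image of \<open>(1 - q) / 4\<close> in p, with the same
        value. Then \<open>r - q / 4 = 2 * p - 1 / 4\<close> is below \<open>3 * q / 16\<close>
        exactly by the assumed bound on p.\<close>
      define r where "r = 2 * p - 1 / 4 + q / 4"
      have r: "q / 4 \<le> r" "r - q / 4 \<le> 3 * q / 16" "\<bar>r - p\<bar> \<le> 1/4" "\<bar>q / 4 - p\<bar> \<le> 1/4" "0 \<le> p - q / 4" "p - q / 4 \<le> 1/8"
        using p8 p9 q assms(2) unfolding r_def by linarith+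
      have "lcut \<alpha> p ((1 - q) / 4) \<le> lcut \<alpha> p r"
      proof (rule lcut_mono_cos[OF \<alpha>])
        have "pi * (r - p) = - (pi * ((1 - q) / 4 - p))" by (simp add: r_def field_simps)
        then show "(cos (pi * ((1 - q) / 4 - p)))\<^sup>2 \<le> (cos (pi * (r - p)))\<^sup>2" by simp
      qed
      moreover have "lcut \<alpha> p r - lcut \<alpha> p (q / 4) \<le> pi * tan (pi * (p - q / 4)) * (r - q / 4)"
      proof -
        have "ln (cos (pi * (r - p))) - ln (cos (pi * (q / 4 - p))) \<le> pi * tan (pi * (p - q / 4)) * (r - q / 4)"
          using r by (intro ln_cos_upper) auto
        then show ?thesis using r by (simp only: lcut_eq_ln_cos[OF \<alpha>])
      qed
      moreover have "pi * tan (pi * (p - q / 4)) * (r - q / 4) \<le> pi * (sqrt 2 - 1) * (3 * q / 16)"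
      proof (intro mult_mono)
        show "tan (pi * (p - q / 4)) \<le> sqrt 2 - 1"
          using tan_mono_pi[of "p - q / 4" "1/8"] r by (simp add: tan_pi_8)
        show "0 \<le> tan (pi * (p - q / 4))" using tan_mono_pi[of 0 "p - q / 4"] r by simp
      qed (use r in simp_all)
      ultimately have "lcut \<alpha> p ((1 - q) / 4) - lcut \<alpha> p (q / 4) \<le> pi * (sqrt 2 - 1) * (3 * q / 16)" by linarith
      then show ?thesis by simp
    qed
    then have D2: "D 2 \<le> pi * (sqrt 2 - 1) * (3 * q / 16)" by (simp add: near)
    have "ln (cos (pi / 8)) \<le> lcut \<alpha> p (q / 8)" using p8 p9 q by (intro lcut_ge_pi_8) auto
    then have D3: "D 3 \<le> - ln (cos (pi / 8))" using lcut_le_0[OF \<alpha>, of p "(1 - q) / 8"] by (simp add: near)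
    have "(\<Sum>j\<in>{4..<N}. D j) \<le> pi * tan (pi * p) * (1 - 2 * q) * (2 / 2 ^ 4)"
      unfolding D_def using assms by (intro lcut_sum_slope) auto
    also have "\<dots> \<le> 3.1416 * (0.41422 + 0.58905 * q) * (1 - 2 * q) * (2 / 2 ^ 4)"
    proof (intro mult_mono)
      have "tan (pi * p) \<le> tan (pi * (1/8 + 3 * q / 32))" using p8 p9 q by (intro tan_mono_pi) auto
      also have "\<dots> \<le> (sqrt 2 - 1) + 2 * pi * (3 * q / 32)" using q by (intro tan_near_8) auto
      also have "\<dots> \<le> 0.41422 + 2 * 3.1416 * (3 * q / 32)"
        using sqrt_2_bounds pi_less q by (intro add_mono mult_right_mono) auto
      also have "\<dots> \<le> 0.41422 + 0.58905 * q" using q by simp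
      finally show "tan (pi * p) \<le> 0.41422 + 0.58905 * q" .
    qed (use pi_less q tan_p_nonneg in auto)
    finally have D4: "(\<Sum>j\<in>{4..<N}. D j) \<le> 3.1416 * (0.41422 + 0.58905 * q) * (1 - 2 * q) * (2 / 2 ^ 4)" .
    have D2': "D 2 \<le> 1.3014 * (3 * q / 16)"
    proof -
      have "pi * (sqrt 2 - 1) * (3 * q / 16) \<le> 1.3014 * (3 * q / 16)"
        using pi_tan_pi_8 q by (intro mult_right_mono) auto
      then show ?thesis using D2 by linarith
    qed
    \<comment> \<open>0.162 is close to the maximizer of the quadratic bound in q, so this square
      yields nearly its maximum.\<close>
    have "0 \<le> (q - 0.162)\<^sup>2" by simp
    then have "0 \<le> q * q - 0.324 * q + 0.026244" by (simp add: power2_eq_square algebra_simps)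
    then have "0.162664194 + 0.150004047 * q - 0.46263987 * (q * q) \<le> 0.1785"
      using q by simp
    moreover have "1.3014 * (3 * q / 16) + 3.1416 * (0.41422 + 0.58905 * q) * (1 - 2 * q) * (2 / 2 ^ 4)
      = 0.162664194 + 0.150004047 * q - 0.46263987 * (q * q)" by (simp add: field_simps)
    ultimately have quad: "1.3014 * (3 * q / 16) + 3.1416 * (0.41422 + 0.58905 * q) * (1 - 2 * q) * (2 / 2 ^ 4) \<le> 0.1785"
      by (simp only:)
    \<comment> \<open>The gain g of step 1 less the loss \<open>- ln (cos (pi / 8))\<close> of step
      3 leaves \<open>ln 2 / 2 + 2 * ln (cos (pi / 8))\<close> for the rest.\<close>
    have "(\<Sum>j\<in>{1..<N}. D j) \<le> 0"
      using s1 s2 D1 D2' D3 D4 quad first_two_steps_gain unfolding g_def by linarith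
    then show ?thesis by (simp add: D_def sum_subtractf)
  qed
qed

text \<open>The two terms that do not compare one by one are compared through the product of their
  cosines.\<close>

lemma departure_C1:
  assumes "m = 2" "p < 1 / 4" "1/8 + 3 * q / 32 \<le> p" "q \<le> 4/9"
  shows "(\<Sum>j\<in>{1..<N}. lsym \<alpha> p e (1 - (1 - q) / 2 ^ j))
    \<le> (\<Sum>j\<in>{1..<N-1}. lcut \<alpha> p ((1 + q / 2) / 2 ^ j)) + lcut \<alpha> p (q / 2) + 2 * (pi * cot \<alpha>) / 2 ^ N"
proof -
  define X where "X j = lsym \<alpha> p e (1 - (1 - q) / 2 ^ j)" for j
  define A where "A j = lcut \<alpha> p ((1 + q / 2) / 2 ^ j)" for j
  have e4: "e = 1/4" using assms by (simp add: e)
  have p8: "1/8 \<le> p" using p e4 by simp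
  have near: "X j = lcut \<alpha> p ((1 - q) / 2 ^ j)" if "2 \<le> j" for j
    using that assms(1) far_iff[of j] by (simp add: X_def lsym_near)
  have X1: "X 1 \<le> A 1"
  proof -
    have "X 1 = lcut \<alpha> p (- ((1 - q) / 2 ^ 1))"
      unfolding X_def using m by (intro lsym_far) (simp only: far_iff)
    also have "\<dots> = lcut \<alpha> p (1 - (1 - q) / 2)" by (simp add: lcut_1_minus[OF \<alpha>])
    also have "\<dots> \<le> lcut \<alpha> p ((1 + q / 2) / 2)"
    proof (rule lcut_compare[OF \<alpha>])
      have e1: "1 - (1 - q) / 2 - (1 + q / 2) / 2 = q / 4"
        and e2: "(1 + q / 2) / 2 + (1 - (1 - q) / 2) - 2 * p = 1 - (2 * p - 3 * q / 4)"
        by (auto simp: field_simps)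
      have "sin (pi * (1 - t)) = sin (pi * t)" for t by (simp add: right_diff_distrib)
      moreover have "0 \<le> sin (pi * (q / 4))" "0 \<le> sin (pi * (2 * p - 3 * q / 4))"
        using q p assms by (intro sin_mult_pi_nonneg, linarith, linarith)+
      ultimately show "0 \<le> sin (pi * (1 - (1 - q) / 2 - (1 + q / 2) / 2)) *
        sin (pi * ((1 + q / 2) / 2 + (1 - (1 - q) / 2) - 2 * p))"
        unfolding e1 e2 by (simp only: mult_nonneg_nonneg)
    qed
    finally show ?thesis by (simp add: A_def)
  qed
  have Xj: "X j \<le> A j" if "3 \<le> j" for j
  proof -
    define t u where "t = 1 / (2::real) ^ j" and "u = q / 2 ^ j"
    have ab: "(1 + q / 2) / 2 ^ j = t + u / 2" "(1 - q) / 2 ^ j = t - u"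
      by (auto simp: t_def u_def field_simps)
    have t: "0 \<le> t" "t \<le> 1 / 8" using half_pow_le[OF that] by (simp_all add: t_def)
    have "q / 2 ^ j \<le> 1 / 2 ^ j" using q by (intro divide_right_mono) auto
    then have "u \<le> t" "0 \<le> u" using q by (simp_all add: t_def u_def)
    then have "lcut \<alpha> p ((1 - q) / 2 ^ j) \<le> lcut \<alpha> p ((1 + q / 2) / 2 ^ j)"
      unfolding ab using p8 p t by (intro lcut_compare_right[OF \<alpha>]) linarith+
    then show ?thesis using that by (simp add: near A_def)
  qed
  \<comment> \<open>The competitor's extra term at \<open>q / 2\<close> is paired with a value at 0
    that stands for the last step N - 1. Product-to-sum turns both products into cosines of a
    difference and of a sum, and these compare separately.\<close>
  have X2: "X 2 + lcut \<alpha> p 0 \<le> A 2 + lcut \<alpha> p (q / 2)"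
  proof -
    let ?c = "\<lambda>x. cos (pi * (x - p))"
    define b a where "b = 1/4 - q / 4" and "a = 1/4 + q / 8"
    have ba: "(1 - q) / 4 = b" "(1 + q / 2) / 4 = a" by (simp_all add: a_def b_def field_simps)
    have bd: "\<bar>b - p\<bar> \<le> 1/4" "\<bar>0 - p\<bar> \<le> 1/4" "\<bar>a - p\<bar> \<le> 1/4" "\<bar>q / 2 - p\<bar> \<le> 1/4"
      using assms(2-) p8 q unfolding a_def b_def by linarith+
    have pos: "0 < ?c b" "0 < ?c 0" "0 < ?c a" "0 < ?c (q / 2)"
      using bd by (intro cos_gt_zero_abs, linarith)+
    have prod: "?c x * ?c y = (cos (pi * (x - y)) + cos (pi * (x + y - 2 * p))) / 2" for x y
    proof -
      have "pi * (x - p) - pi * (y - p) = pi * (x - y)" "pi * (x - p) + pi * (y - p) = pi * (x + y - 2 * p)"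
        by (auto simp: algebra_simps)
      then show ?thesis using cos_times_cos[of "pi * (x - p)" "pi * (y - p)"] by metis
    qed
    have "cos (pi * (b - 0)) \<le> cos (pi * (a - q / 2))"
      using q unfolding a_def b_def by (intro cos_ge_cos_abs) linarith+
    moreover have "cos (pi * (b + 0 - 2 * p)) \<le> cos (pi * (a + q / 2 - 2 * p))"
    proof -
      have "cos (pi * (2 * p - b)) \<le> cos (pi * (a + q / 2 - 2 * p))"
        using q p assms(2-) unfolding a_def b_def by (intro cos_ge_cos_abs) linarith+
      moreover have "pi * (2 * p - b) = - (pi * (b + 0 - 2 * p))" by (simp add: algebra_simps)
      ultimately show ?thesis by (simp only: cos_minus)
    qed
    ultimately have "?c b * ?c 0 \<le> ?c a * ?c (q / 2)" unfolding prod by simp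
    then have "ln (?c b * ?c 0) \<le> ln (?c a * ?c (q / 2))"
      using pos by (subst ln_le_cancel_iff) auto
    then have "ln (?c b) + ln (?c 0) \<le> ln (?c a) + ln (?c (q / 2))"
      using pos by (simp only: ln_mult_pos)
    then have "lcut \<alpha> p b + lcut \<alpha> p 0 \<le> lcut \<alpha> p a + lcut \<alpha> p (q / 2)"
      using bd by (simp only: lcut_eq_ln_cos[OF \<alpha>])
    then show ?thesis by (simp add: near A_def ba)
  qed
  \<comment> \<open>The last mirrored point is within \<open>1 / 2 ^ (N - 1)\<close> of 0, which
    produces the extra term of the claim.\<close>
  have last: "X (N - 1) \<le> lcut \<alpha> p 0 + 2 * (pi * cot \<alpha>) / 2 ^ N"
  proof -
    have "\<bar>lcut \<alpha> p ((1 - q) / 2 ^ (N - 1)) - lcut \<alpha> p 0\<bar> \<le> pi * cot \<alpha> * \<bar>(1 - q) / 2 ^ (N - 1) - 0\<bar>"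
      by (rule lcut_lipschitz[OF \<alpha>])
    also have "\<dots> \<le> pi * cot \<alpha> * (1 / 2 ^ (N - 1))"
      using q cot_alpha_ge_1[OF \<alpha>] by (intro mult_left_mono) (auto intro: divide_right_mono)
    also have "1 / 2 ^ (N - 1) = 2 / (2::real) ^ N"
    proof -
      have "(2::real) ^ N = 2 * 2 ^ (N - 1)" using N by (simp flip: power_Suc)
      then show ?thesis by simp
    qed
    finally have "lcut \<alpha> p ((1 - q) / 2 ^ (N - 1)) \<le> lcut \<alpha> p 0 + pi * cot \<alpha> * (2 / 2 ^ N)" by linarith
    moreover have "X (N - 1) = lcut \<alpha> p ((1 - q) / 2 ^ (N - 1))" using N by (intro near) simp
    ultimately show ?thesis by (simp add: mult_ac)
  qed
  have sX: "(\<Sum>j\<in>{1..<N}. X j) = X 1 + X 2 + (\<Sum>j\<in>{3..<N-1}. X j) + X (N - 1)"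
  proof -
    have "(\<Sum>j\<in>{1..<N}. X j) = (\<Sum>j\<in>{1..<N-1}. X j) + X (N - 1)"
      using N sum.atLeastLessThan_Suc[of 1 "N - 1" X] by simp
    moreover have "(\<Sum>j\<in>{1..<N-1}. X j) = X 1 + X 2 + (\<Sum>j\<in>{3..<N-1}. X j)"
      using N by (simp add: sum.atLeast_Suc_lessThan numeral_eq_Suc)
    ultimately show ?thesis by simp
  qed
  have sA: "(\<Sum>j\<in>{1..<N-1}. A j) = A 1 + A 2 + (\<Sum>j\<in>{3..<N-1}. A j)"
    using N by (simp add: sum.atLeast_Suc_lessThan numeral_eq_Suc)
  have "(\<Sum>j\<in>{3..<N-1}. X j) \<le> (\<Sum>j\<in>{3..<N-1}. A j)" by (intro sum_mono Xj) auto
  then have "(\<Sum>j\<in>{1..<N}. X j) \<le> (\<Sum>j\<in>{1..<N-1}. A j) + lcut \<alpha> p (q / 2) + 2 * (pi * cot \<alpha>) / 2 ^ N"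
    using sX sA X1 X2 last by linarith
  then show ?thesis by (simp only: X_def A_def)
qed

text \<open>A walk \<open>1\<^sup>N\<^sup>-\<^sup>1x\<close> that leaves the glued node on the side of 0 visits the points \<open>1 - (1 - q) / 2 ^ j\<close>,
  where \<open>q\<close> is the point coded by \<open>x\<close>. The right-hand sides belong to the competitors
  \<open>0\<^sup>N\<^sup>-\<^sup>1x\<close>, \<open>0\<^sup>N\<^sup>-\<^sup>2 1x\<close> and \<open>0\<^sup>N\<^sup>-\<^sup>3 10x\<close>.\<close>

lemma departure:
  "(\<Sum>j\<in>{1..<N}. lsym \<alpha> p e (1 - (1 - q) / 2 ^ j)) \<le> (\<Sum>j\<in>{1..<N}. lcut \<alpha> p (q / 2 ^ j)) \<or>
   (\<Sum>j\<in>{1..<N}. lsym \<alpha> p e (1 - (1 - q) / 2 ^ j)) \<le> (\<Sum>j\<in>{1..<N}. lcut \<alpha> p ((1 + q) / 2 ^ j)) \<or>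
   0 < q \<and> (\<Sum>j\<in>{1..<N}. lsym \<alpha> p e (1 - (1 - q) / 2 ^ j))
    \<le> (\<Sum>j\<in>{1..<N-1}. lcut \<alpha> p ((1 + q / 2) / 2 ^ j)) + lcut \<alpha> p (q / 2) + 2 * (pi * cot \<alpha>) / 2 ^ N"
proof -
  \<comment> \<open>If \<open>e \<le> 1/8 \<le> p\<close> or \<open>1/4 \<le> p\<close>, then
    \<open>q < 1/2 \<le> 4 * p\<close> and the first case applies. The last case has q > 0 because q
    = 0 belongs to the first.\<close>
  consider "q = 0 \<or> e \<le> p \<and> q \<le> 4 * p" | "3 \<le> m" "p < 1/8"
    | "m = 2" "p < 1/4" "p < 1/8 + 3 * q / 32 \<or> 4 / 9 < q"
    | "m = 2" "p < 1/4" "1/8 + 3 * q / 32 \<le> p" "q \<le> 4/9" "0 < q"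
  proof -
    have e8: "e \<le> 1/8" if "3 \<le> m"
      using half_pow_le[OF that] by (simp add: e)
    show ?thesis using that e8 e_bounds m q p by (cases "m = 2") force+
  qed
  then show ?thesis using departure_C0 departure_B_small departure_B_quarter departure_C1 by cases auto
qed

end

section \<open>Binary sequences, cylinders and averages\<close>

definition win :: "nat \<Rightarrow> (nat \<Rightarrow> bool) \<Rightarrow> nat \<Rightarrow> bool list" where
  "win n s i = map s [i..<i + n]"

definition bval :: "(nat \<Rightarrow> bool) \<Rightarrow> real" where
  "bval s = (\<Sum>k. of_bool (s k) / 2 ^ Suc k)"

definition digits :: "real \<Rightarrow> nat \<Rightarrow> bool" where
  "digits x k \<longleftrightarrow> 1 / 2 \<le> (doubling ^^ k) x"

definition avg :: "(real \<Rightarrow> real) \<Rightarrow> bool list \<Rightarrow> real" where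
  "avg \<phi> \<omega> = 2 ^ length \<omega> * (LINT y:cylinder \<omega>|lborel. \<phi> y)"

lemma length_win [simp]: "length (win n s i) = n"
  by (simp add: win_def)

lemma nth_win: "k < n \<Longrightarrow> win n s i ! k = s (i + k)"
  by (simp add: win_def)

lemma win_eqI: "(\<And>k. k < n \<Longrightarrow> s (i + k) = t (j + k)) \<Longrightarrow> win n s i = win n t j"
  by (rule nth_equalityI) (auto simp: nth_win)

lemma win_Suc: "win (Suc n) s i = s i # win n s (Suc i)"
  by (simp add: win_def upt_rec)

lemma tl_win: "tl (win n s i) = win (n - 1) s (Suc i)"
proof (cases n)
  case (Suc m) then show ?thesis by (simp only: win_Suc) simp
qed (simp add: win_def)

lemma butlast_win: "butlast (win n s i) = win (n - 1) s i"
  by (cases n) (auto simp: win_def)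

lemma map_Not_win: "map Not (win n s i) = win n (\<lambda>k. \<not> s k) i"
  by (simp add: win_def)

lemma word_val_Cons: "word_val (b # \<omega>) = (of_bool b + word_val \<omega>) / 2"
proof -
  have "word_val (b # \<omega>) = of_bool b / 2 + (\<Sum>i<length \<omega>. of_bool (\<omega> ! i) / 2 ^ Suc (Suc i))"
    unfolding word_val_def by (simp add: sum.lessThan_Suc_shift del: sum.lessThan_Suc power_Suc)
  also have "(\<Sum>i<length \<omega>. of_bool (\<omega> ! i) / 2 ^ Suc (Suc i)) = word_val \<omega> / 2"
    unfolding word_val_def sum_divide_distrib by (rule sum.cong) auto
  finally show ?thesis by simp
qed

lemma word_val_Nil [simp]: "word_val [] = 0"
  by (simp add: word_val_def)

lemma word_val_bounds: "0 \<le> word_val \<omega>" "word_val \<omega> + 1 / 2 ^ length \<omega> \<le> 1"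
proof -
  show "0 \<le> word_val \<omega>" by (induction \<omega>) (auto simp: word_val_Cons)
  show "word_val \<omega> + 1 / 2 ^ length \<omega> \<le> 1"
  proof (induction \<omega>)
    case (Cons b \<omega>)
    have "word_val (b # \<omega>) + 1 / 2 ^ length (b # \<omega>) = (of_bool b + (word_val \<omega> + 1 / 2 ^ length \<omega>)) / 2"
      by (simp add: word_val_Cons add_divide_distrib)
    also have "\<dots> \<le> (1 + 1) / 2" using Cons.IH by (intro divide_right_mono add_mono) auto
    finally show ?case by simp
  qed simp
qed

lemma word_val_map_Not: "word_val (map Not \<omega>) = 1 - 1 / 2 ^ length \<omega> - word_val \<omega>"
  by (induction \<omega>) (auto simp: word_val_Cons field_simps)

lemma cylinder_subset: "cylinder \<omega> \<subseteq> {0..<1}"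
  using word_val_bounds[of \<omega>] by (auto simp: cylinder_def)

lemma cylinder_Cons: "x \<in> cylinder (b # \<omega>) \<longleftrightarrow> 2 * x - of_bool b \<in> cylinder \<omega>"
  by (auto simp: cylinder_def word_val_Cons field_simps)

lemma doubling_eq: "x \<in> {0..<1} \<Longrightarrow> doubling x = 2 * x - of_bool (1 / 2 \<le> x)"
proof -
  assume x: "x \<in> {0..<1}"
  then have "\<lfloor>2 * x\<rfloor> = (if 1 / 2 \<le> x then 1 else 0)" by (auto simp: floor_eq_iff)
  then show ?thesis by (simp add: doubling_def frac_def)
qed

lemma doubling_in: "doubling x \<in> {0..<1}"
  by (simp add: doubling_def frac_lt_1)

lemma funpow_doubling_in: "x \<in> {0..<1} \<Longrightarrow> (doubling ^^ k) x \<in> {0..<1}"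
  by (induction k) (simp_all add: doubling_in del: atLeastLessThan_iff)

lemma digits_0: "digits x 0 \<longleftrightarrow> 1 / 2 \<le> x"
  by (simp add: digits_def)

lemma digits_doubling: "digits (doubling x) k = digits x (Suc k)"
  by (simp add: digits_def funpow_swap1)

lemma digits_funpow: "digits ((doubling ^^ i) x) k = digits x (i + k)"
  by (simp add: digits_def add.commute[of i] funpow_add)

lemma in_cylinder_digits: "x \<in> {0..<1} \<Longrightarrow> x \<in> cylinder (win n (digits x) 0)"
proof (induction n arbitrary: x)
  case 0 then show ?case by (simp add: win_def cylinder_def)
next
  case (Suc n)
  have "win n (digits x) (Suc 0) = win n (digits (doubling x)) 0"
    by (rule win_eqI) (simp add: digits_doubling)
  then show ?case using Suc.IH[OF doubling_in, of x] Suc.prems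
    by (simp add: win_Suc cylinder_Cons digits_0 doubling_eq)
qed

lemma in_cylinder_funpow:
  assumes "x \<in> {0..<1}" shows "(doubling ^^ i) x \<in> cylinder (win n (digits x) i)"
proof -
  have "win n (digits ((doubling ^^ i) x)) 0 = win n (digits x) i"
    by (rule win_eqI) (simp add: digits_funpow)
  then show ?thesis using in_cylinder_digits[OF funpow_doubling_in[OF assms], of i n] by simp
qed

lemma cylinder_unique:
  assumes "x \<in> cylinder \<omega>" shows "win (length \<omega>) (digits x) 0 = \<omega>"
  using assms
proof (induction \<omega> arbitrary: x)
  case (Cons b \<omega>)
  have x: "x \<in> {0..<1}" using Cons.prems cylinder_subset by blast
  have y: "2 * x - of_bool b \<in> cylinder \<omega>" using Cons.prems by (simp add: cylinder_Cons)
  then have "2 * x - of_bool b \<in> {0..<1}" using cylinder_subset by blast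
  then have b: "b \<longleftrightarrow> 1 / 2 \<le> x" by (cases b) auto
  then have "2 * x - of_bool b = doubling x" using x by (simp add: doubling_eq)
  then have "win (length \<omega>) (digits (doubling x)) 0 = \<omega>" using Cons.IH[OF y] by simp
  moreover have "win (length \<omega>) (digits (doubling x)) 0 = win (length \<omega>) (digits x) (Suc 0)"
    by (rule win_eqI) (simp add: digits_doubling)
  ultimately show ?case using b by (simp add: win_Suc digits_0)
qed (simp add: win_def)

section \<open>Points coded by binary sequences\<close>

lemma bval_summable: "summable (\<lambda>k. of_bool (s k) / 2 ^ Suc k :: real)"
proof (rule summable_comparison_test')
  show "summable (\<lambda>k. (1 / 2) ^ Suc k :: real)" by (intro summable_Suc_iff[THEN iffD2] summable_geometric) simp
  show "norm (of_bool (s k) / 2 ^ Suc k :: real) \<le> (1 / 2) ^ Suc k" for k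
    by (simp add: power_one_over)
qed

lemma bval_Suc: "bval s = (of_bool (s 0) + bval (\<lambda>k. s (Suc k))) / 2"
proof -
  have "bval s = of_bool (s 0) / 2 + (\<Sum>k. of_bool (s (Suc k)) / 2 ^ Suc (Suc k))"
    unfolding bval_def using suminf_split_head[OF bval_summable[of s]] by simp
  also have "(\<Sum>k. of_bool (s (Suc k)) / 2 ^ Suc (Suc k) :: real) = (\<Sum>k. (of_bool (s (Suc k)) / 2 ^ Suc k) / 2)"
    by simp
  also have "\<dots> = bval (\<lambda>k. s (Suc k)) / 2" unfolding bval_def by (rule suminf_divide[OF bval_summable])
  finally show ?thesis by simp
qed

lemma suminf_half: "(\<Sum>k. 1 / 2 ^ Suc k) = (1::real)"
proof -
  have "(\<lambda>k. (1 / 2) * (1 / 2) ^ k) sums ((1 / 2) * (1 / (1 - 1 / 2)) :: real)"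
    by (intro sums_mult geometric_sums) simp
  then show ?thesis by (simp add: sums_iff power_one_over)
qed

lemma bval_nonneg: "0 \<le> bval s"
  unfolding bval_def by (intro suminf_nonneg bval_summable) simp

lemma bval_le_1: "bval s \<le> 1"
proof -
  have "bval s \<le> (\<Sum>k. 1 / 2 ^ Suc k)" unfolding bval_def
    using bval_summable[of "\<lambda>_. True"] by (intro suminf_le bval_summable) auto
  then show ?thesis using suminf_half by simp
qed

lemma bval_less_1: "\<not> s i \<Longrightarrow> bval s < 1"
proof (induction i arbitrary: s)
  case 0 then show ?case using bval_Suc[of s] bval_le_1[of "\<lambda>k. s (Suc k)"] by simp
next
  case (Suc i)
  then have "bval (\<lambda>k. s (Suc k)) < 1" by simp
  then show ?case using bval_Suc[of s] by (cases "s 0") auto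
qed

lemma bval_const_False: "bval (\<lambda>_. False) = 0"
  by (simp add: bval_def)

lemma bval_replicate_False:
  "(\<And>k. k < j \<Longrightarrow> \<not> s k) \<Longrightarrow> bval s = bval (\<lambda>k. s (j + k)) / 2 ^ j"
proof (induction j arbitrary: s)
  case (Suc j)
  have "bval (\<lambda>k. s (Suc k)) = bval (\<lambda>k. s (Suc (j + k))) / 2 ^ j"
    using Suc.IH[of "\<lambda>k. s (Suc k)"] Suc.prems by simp
  then show ?case using bval_Suc[of s] Suc.prems[of 0] by simp
qed simp

lemma bval_replicate_True:
  "(\<And>k. k < j \<Longrightarrow> s k) \<Longrightarrow> bval s = 1 - (1 - bval (\<lambda>k. s (j + k))) / 2 ^ j"
proof (induction j arbitrary: s)
  case (Suc j)
  have "bval (\<lambda>k. s (Suc k)) = 1 - (1 - bval (\<lambda>k. s (Suc (j + k)))) / 2 ^ j"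
    using Suc.IH[of "\<lambda>k. s (Suc k)"] Suc.prems by simp
  moreover have "bval s = (1 + bval (\<lambda>k. s (Suc k))) / 2" using bval_Suc[of s] Suc.prems[of 0] by simp
  ultimately show ?case by simp
qed simp

text \<open>Infinitely many zeros exclude the expansions that end in ones. Those code 1, or a dyadic
  point for a second time, and fall out of the half-open cylinders of their own windows.\<close>

lemma bval_in:
  assumes "\<And>i. \<exists>k\<ge>i. \<not> s k" shows "bval s \<in> {0..<1}"
proof -
  obtain k where "\<not> s k" using assms[of 0] by auto
  then show ?thesis using bval_nonneg bval_less_1 by auto
qed

lemma doubling_bval:
  assumes "\<And>i. \<exists>k\<ge>i. \<not> s k"
  shows "doubling (bval s) = bval (\<lambda>k. s (Suc k))" "1 / 2 \<le> bval s \<longleftrightarrow> s 0"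
proof -
  have sh: "\<exists>k\<ge>i. \<not> s (Suc k)" for i 
  proof -
    obtain k where "k \<ge> Suc i" "\<not> s k" using assms by blast
    then show ?thesis by (intro exI[of _ "k - 1"]) auto
  qed
  have r: "bval (\<lambda>k. s (Suc k)) \<in> {0..<1}" using bval_in[of "\<lambda>k. s (Suc k)"] sh by blast
  show b: "1 / 2 \<le> bval s \<longleftrightarrow> s 0" using r bval_Suc[of s] by (auto simp: of_bool_def)
  show "doubling (bval s) = bval (\<lambda>k. s (Suc k))"
    using bval_Suc[of s] doubling_eq[OF bval_in[of s, OF assms]] unfolding b by simp
qed

lemma funpow_doubling_bval:
  assumes "\<And>i. \<exists>k\<ge>i. \<not> s k"
  shows "(doubling ^^ n) (bval s) = bval (\<lambda>k. s (n + k))"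
proof (induction n)
  case (Suc n)
  have "\<exists>k\<ge>i. \<not> s (n + k)" for i
  proof -
    obtain k where "k \<ge> n + i" "\<not> s k" using assms by blast
    then show ?thesis by (intro exI[of _ "k - n"]) auto
  qed
  then show ?case using Suc doubling_bval(1)[of "\<lambda>k. s (n + k)"] by simp
qed simp

lemma digits_bval:
  assumes "\<And>i. \<exists>k\<ge>i. \<not> s k" shows "digits (bval s) = s"
proof
  fix n
  have "\<exists>k\<ge>i. \<not> s (n + k)" for i
  proof -
    obtain k where "k \<ge> n + i" "\<not> s k" using assms by blast
    then show ?thesis by (intro exI[of _ "k - n"]) auto
  qed
  then show "digits (bval s) n = s n"
    using doubling_bval(2)[of "\<lambda>k. s (n + k)"] funpow_doubling_bval[OF assms, of n] by (simp add: digits_def)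
qed

lemma bval_in_cylinder:
  assumes "\<And>i. \<exists>k\<ge>i. \<not> s k" shows "bval (\<lambda>k. s (i + k)) \<in> cylinder (win n s i)"
  using in_cylinder_funpow[OF bval_in[OF assms], of i n]
  by (simp add: digits_bval[OF assms] funpow_doubling_bval[OF assms])

text \<open>Makes averages over different cylinders comparable.\<close>

lemma avg_unit:
  "avg \<phi> \<omega> = (LINT u:{0..1}|lborel. \<phi> (word_val \<omega> + u / 2 ^ length \<omega>))"
proof -
  let ?a = "word_val \<omega>" and ?h = "1 / 2 ^ length \<omega> :: real"
  have "(LINT y:cylinder \<omega>|lborel. \<phi> y) = \<bar>?h\<bar> *\<^sub>R (LINT u|lborel. indicator (cylinder \<omega>) (?a + ?h * u) *\<^sub>R \<phi> (?a + ?h * u))"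
    unfolding set_lebesgue_integral_def by (rule lborel_integral_real_affine) simp
  also have "(LINT u|lborel. indicator (cylinder \<omega>) (?a + ?h * u) *\<^sub>R \<phi> (?a + ?h * u))
      = (LINT u:{0..<1}|lborel. \<phi> (?a + u / 2 ^ length \<omega>))"
    unfolding set_lebesgue_integral_def
    by (rule Bochner_Integration.integral_cong) (auto simp: cylinder_def indicator_def field_simps)
  also have "\<dots> = (LINT u:{0..1}|lborel. \<phi> (?a + u / 2 ^ length \<omega>))"
    unfolding set_lebesgue_integral_def
  proof (rule integral_discrete_difference[where X="{1}"])
    show "indicat_real {0..<1} u *\<^sub>R \<phi> (?a + u / 2 ^ length \<omega>) = indicat_real {0..1} u *\<^sub>R \<phi> (?a + u / 2 ^ length \<omega>)"
      if "u \<notin> {1}" for u using that by (auto simp: indicator_def)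
  qed auto
  finally show ?thesis by (simp add: avg_def)
qed

lemma unit_integral_const: "(LINT u:{0..1::real}|lborel. (c::real)) = c"
  by (simp add: set_lebesgue_integral_def)

lemma unit_integral_id: "(LINT u:{0..1::real}|lborel. u) = 1 / 2"
  using integral_power[of 0 1 1] by (simp add: set_lebesgue_integral_def mult.commute)

lemma unit_integral_reflect: "(LINT u:{0..1::real}|lborel. f (1 - u)) = (LINT u:{0..1}|lborel. (f u :: real))"
proof -
  have "(LINT u:{0..1}|lborel. f u) = \<bar>-1\<bar> *\<^sub>R (LINT u|lborel. indicator {0..1} (1 + -1 * u) *\<^sub>R f (1 + -1 * u))"
    unfolding set_lebesgue_integral_def by (rule lborel_integral_real_affine) simp
  also have "\<dots> = (LINT u:{0..1}|lborel. f (1 - u))"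
    unfolding set_lebesgue_integral_def by (auto intro!: Bochner_Integration.integral_cong simp: indicator_def)
  finally show ?thesis by simp
qed

text \<open>Complementing the letters reflects the cylinder, which on the unit interval is the
  substitution of 1 - u. The finite set S absorbs points where half-open case distinctions do not
  match their mirror images.\<close>

lemma avg_reflect:
  assumes S: "finite S" and eq: "\<And>x. x \<in> cylinder \<omega> \<Longrightarrow> x \<notin> S \<Longrightarrow> \<psi> (1 - x) = \<phi> x"
  shows "avg \<psi> (map Not \<omega>) = avg \<phi> \<omega>"
proof -
  let ?a = "word_val \<omega>" and ?n = "length \<omega>"
  have "avg \<psi> (map Not \<omega>) = (LINT u:{0..1}|lborel. \<psi> (1 - (?a + (1 - u) / 2 ^ ?n)))"
    unfolding avg_unit by (simp add: word_val_map_Not diff_divide_distrib algebra_simps)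
  also have "\<dots> = (LINT u:{0..1}|lborel. \<psi> (1 - (?a + u / 2 ^ ?n)))"
    by (rule unit_integral_reflect)
  also have "\<dots> = (LINT u:{0..1}|lborel. \<phi> (?a + u / 2 ^ ?n))"
    unfolding set_lebesgue_integral_def
  proof (rule integral_discrete_difference[where X="insert 1 ((\<lambda>x. (x - ?a) * 2 ^ ?n) ` S)"])
    fix u :: real assume u: "u \<notin> insert 1 ((\<lambda>x. (x - ?a) * 2 ^ ?n) ` S)"
    show "indicat_real {0..1} u *\<^sub>R \<psi> (1 - (?a + u / 2 ^ ?n)) = indicat_real {0..1} u *\<^sub>R \<phi> (?a + u / 2 ^ ?n)"
    proof (cases "u \<in> {0..1}")
      case True
      then have "?a + u / 2 ^ ?n \<in> cylinder \<omega>" using u by (auto simp: cylinder_def field_simps)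
      moreover have "?a + u / 2 ^ ?n \<notin> S"
      proof
        assume "?a + u / 2 ^ ?n \<in> S"
        then have "(?a + u / 2 ^ ?n - ?a) * 2 ^ ?n \<in> (\<lambda>x. (x - ?a) * 2 ^ ?n) ` S" by blast
        then show False using u by simp
      qed
      ultimately show ?thesis by (simp add: eq)
    qed simp
  qed (use S in \<open>auto intro!: countable_finite\<close>)
  finally show ?thesis by (simp add: avg_unit)
qed

section \<open>Averages of bounded measurable functions over cylinders\<close>

context
  fixes \<phi> :: "real \<Rightarrow> real" and B :: real
  assumes meas: "\<phi> \<in> borel_measurable borel" and bdd: "\<And>x. \<bar>\<phi> x\<bar> \<le> B"
begin

lemma unit_integrable: "set_integrable lborel {0..1::real} (\<lambda>u. \<phi> (a + u / 2 ^ n))"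
proof -
  have "set_integrable lborel {0..1::real} (\<lambda>u. B)" by (simp add: set_integrable_def)
  then show ?thesis
  proof (rule set_integrable_bound)
    show "set_borel_measurable lborel {0..1} (\<lambda>u. \<phi> (a + u / 2 ^ n))"
      unfolding set_borel_measurable_def using meas by measurable
    show "AE u in lborel. u \<in> {0..1} \<longrightarrow> norm (\<phi> (a + u / 2 ^ n)) \<le> norm B"
      using bdd by (auto intro!: AE_I2 order_trans[OF bdd abs_ge_self])
  qed
qed

lemma avg_le:
  assumes "\<And>x. x \<in> cylinder \<omega> \<Longrightarrow> \<phi> x \<le> c" shows "avg \<phi> \<omega> \<le> c"
proof -
  have "avg \<phi> \<omega> = (LINT u:{0..<1}|lborel. \<phi> (word_val \<omega> + u / 2 ^ length \<omega>))"
    unfolding avg_unit set_lebesgue_integral_def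
  proof (rule integral_discrete_difference[where X="{1}"])
    show "indicat_real {0..1} u *\<^sub>R \<phi> (word_val \<omega> + u / 2 ^ length \<omega>) = indicat_real {0..<1} u *\<^sub>R \<phi> (word_val \<omega> + u / 2 ^ length \<omega>)"
      if "u \<notin> {1}" for u using that by (auto simp: indicator_def)
  qed auto
  also have "\<dots> \<le> (LINT u:{0..<1::real}|lborel. c)"
  proof (rule set_integral_mono)
    show "set_integrable lborel {0..<1} (\<lambda>u. \<phi> (word_val \<omega> + u / 2 ^ length \<omega>))"
      using unit_integrable by (rule set_integrable_subset) auto
    show "\<phi> (word_val \<omega> + u / 2 ^ length \<omega>) \<le> c" if "u \<in> {0..<1}" for u
      using that by (intro assms) (auto simp: cylinder_def field_simps)
  qed (simp add: set_integrable_def)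
  also have "\<dots> = c" by (simp add: set_lebesgue_integral_def)
  finally show ?thesis .
qed

lemma avg_compare:
  assumes "length \<omega> = length \<omega>'"
    and "\<And>u. 0 \<le> u \<Longrightarrow> u < 1 / 2 ^ length \<omega> \<Longrightarrow> \<phi> (word_val \<omega> + u) \<le> \<phi> (word_val \<omega>' + u) + c"
  shows "avg \<phi> \<omega> \<le> avg \<phi> \<omega>' + c"
proof -
  let ?h = "2 ^ length \<omega> :: real"
  let ?D = "\<lambda>u. \<phi> (word_val \<omega> + u / ?h) - \<phi> (word_val \<omega>' + u / ?h)"
  have int: "set_integrable lborel {0..1} ?D"
    by (intro set_integral_diff(1) unit_integrable)
  have "avg \<phi> \<omega> - avg \<phi> \<omega>' = (LINT u:{0..1}|lborel. ?D u)"
    unfolding avg_unit using assms(1) by (simp add: set_integral_diff(2) unit_integrable)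
  also have "\<dots> = (LINT u:{0..<1}|lborel. ?D u)"
    unfolding set_lebesgue_integral_def
  proof (rule integral_discrete_difference[where X="{1}"])
    show "indicat_real {0..1} u *\<^sub>R ?D u = indicat_real {0..<1} u *\<^sub>R ?D u"
      if "u \<notin> {1}" for u using that by (auto simp: indicator_def)
  qed auto
  also have "\<dots> \<le> (LINT u:{0..<1::real}|lborel. c)"
  proof (rule set_integral_mono)
    show "set_integrable lborel {0..<1} ?D"
      using int by (rule set_integrable_subset) auto
    show "?D u \<le> c" if "u \<in> {0..<1}" for u
      using assms(2)[of "u / ?h"] that by (auto simp: field_simps)
  qed (simp add: set_integrable_def)
  also have "\<dots> = c" by (simp add: set_lebesgue_integral_def)
  finally show ?thesis by simp
qed

text \<open>The mean distance of a point of an interval to the others is at most half the length, because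
  \<open>\<bar>u - \<theta>\<bar> \<le> (1 - \<theta>) * u + \<theta> * (1 - u)\<close> on the unit interval.\<close>

lemma avg_point:
  assumes L: "0 \<le> L" and z: "z \<in> cylinder \<omega>"
    and lip: "\<And>x. x \<in> cylinder \<omega> \<Longrightarrow> \<bar>\<phi> x - \<phi> z\<bar> \<le> L * \<bar>x - z\<bar>"
  shows "\<bar>avg \<phi> \<omega> - \<phi> z\<bar> \<le> L / 2 / 2 ^ length \<omega>"
proof -
  let ?h = "2 ^ length \<omega> :: real" and ?a = "word_val \<omega>"
  define \<theta> where "\<theta> = (z - ?a) * ?h"
  have \<theta>: "0 \<le> \<theta>" "\<theta> \<le> 1" "z = ?a + \<theta> / ?h" using z by (auto simp: \<theta>_def cylinder_def field_simps)
  define K where "K = L / ?h"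
  let ?D = "\<lambda>u. \<phi> (?a + u / ?h) - \<phi> z" and ?E = "\<lambda>u. \<phi> z - \<phi> (?a + u / ?h)"
  let ?b = "\<lambda>u. K * (1 - 2 * \<theta>) * u + K * \<theta>"
  have ic: "set_integrable lborel {0..1::real} (\<lambda>u. c)" for c :: real by (simp add: set_integrable_def)
  have iu: "set_integrable lborel {0..1::real} (\<lambda>u. K * (1 - 2 * \<theta>) * u)"
    using borel_integrable_atLeastAtMost'[of 0 1 "\<lambda>u::real. u"] by (intro set_integrable_mult_right) simp
  have ib: "set_integrable lborel {0..1} ?b" by (rule set_integral_add(1)[OF iu ic])
  have iD: "set_integrable lborel {0..1} ?D" by (rule set_integral_diff(1)[OF unit_integrable ic])
  have iE: "set_integrable lborel {0..1} ?E" by (rule set_integral_diff(1)[OF ic unit_integrable])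
  have b: "(LINT u:{0..1}|lborel. ?b u) = L / 2 / ?h"
  proof -
    have "(LINT u:{0..1}|lborel. ?b u) = K * (1 - 2 * \<theta>) * (1 / 2) + K * \<theta>"
      unfolding set_integral_add(2)[OF iu ic] set_integral_mult_right unit_integral_id unit_integral_const ..
    also have "\<dots> = K / 2" by (simp add: algebra_simps)
    also have "\<dots> = L / 2 / ?h" by (simp add: K_def)
    finally show ?thesis .
  qed
  have D: "(LINT u:{0..1}|lborel. ?D u) = avg \<phi> \<omega> - \<phi> z"
    unfolding set_integral_diff(2)[OF unit_integrable ic] avg_unit unit_integral_const ..
  have E: "(LINT u:{0..1}|lborel. ?E u) = \<phi> z - avg \<phi> \<omega>"
    unfolding set_integral_diff(2)[OF ic unit_integrable] avg_unit unit_integral_const ..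
  have ptw: "\<bar>?D u\<bar> \<le> ?b u" if "u \<in> {0..<1}" for u
  proof -
    have "?a + u / ?h \<in> cylinder \<omega>" using that by (auto simp: cylinder_def field_simps)
    then have "\<bar>?D u\<bar> \<le> L * \<bar>?a + u / ?h - z\<bar>" by (rule lip)
    also have "?a + u / ?h - z = (u - \<theta>) / ?h" by (simp add: \<theta>(3) diff_divide_distrib)
    also have "L * \<bar>(u - \<theta>) / ?h\<bar> = K * \<bar>u - \<theta>\<bar>" by (simp add: K_def abs_divide)
    also have "K * \<bar>u - \<theta>\<bar> \<le> K * ((1 - \<theta>) * u + \<theta> * (1 - u))"
    proof (rule mult_left_mono)
      show "0 \<le> K" using L by (simp add: K_def)
      have "u * \<theta> \<le> \<theta>" "u * \<theta> \<le> u" using that \<theta> by (auto intro: mult_left_le mult_left_le_one_le)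
      then show "\<bar>u - \<theta>\<bar> \<le> (1 - \<theta>) * u + \<theta> * (1 - u)" by (simp add: algebra_simps abs_le_iff)
    qed
    also have "\<dots> = ?b u" by (simp add: algebra_simps)
    finally show ?thesis .
  qed
  have *: "(LINT u:{0..1}|lborel. f u) = (LINT u:{0..<1}|lborel. f u)" for f :: "real \<Rightarrow> real"
    unfolding set_lebesgue_integral_def
  proof (rule integral_discrete_difference[where X="{1}"])
    show "indicat_real {0..1} u *\<^sub>R f u = indicat_real {0..<1} u *\<^sub>R f u"
      if "u \<notin> {1}" for u using that by (auto simp: indicator_def)
  qed auto
  have sub: "set_integrable lborel {0..<1} f" if "set_integrable lborel {0..1} f" for f :: "real \<Rightarrow> real"
    using that by (rule set_integrable_subset) auto
  have "(LINT u:{0..<1}|lborel. ?D u) \<le> (LINT u:{0..<1}|lborel. ?b u)"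
    by (rule set_integral_mono[OF sub[OF iD] sub[OF ib]]) (use ptw in \<open>auto simp: abs_le_iff\<close>)
  moreover have "(LINT u:{0..<1}|lborel. ?E u) \<le> (LINT u:{0..<1}|lborel. ?b u)"
    by (rule set_integral_mono[OF sub[OF iE] sub[OF ib]]) (use ptw in \<open>auto simp: abs_le_iff\<close>)
  ultimately show ?thesis using b D E by (simp add: * abs_le_iff)
qed

end

lemma avg_ge:
  assumes "\<phi> \<in> borel_measurable borel" "\<And>x. \<bar>\<phi> x\<bar> \<le> B" "\<And>x. c \<le> \<phi> x"
  shows "c \<le> avg \<phi> \<omega>"
proof -
  have "avg (\<lambda>x. - \<phi> x) \<omega> \<le> - c" using assms by (intro avg_le[of _ B]) auto
  moreover have "avg (\<lambda>x. - \<phi> x) \<omega> = - avg \<phi> \<omega>"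
    by (simp add: avg_def set_lebesgue_integral_def)
  ultimately show ?thesis by simp
qed

section \<open>Cycles do not pass through the constant words\<close>

text \<open>The end points of a cylinder of length n are neighbouring multiples of
  \<open>1 / 2 ^ n\<close>, so no such multiple t separates two of its points.\<close>

lemma cylinder_dyadic_side:
  assumes t: "t * 2 ^ length \<omega> = of_int j" and "x \<in> cylinder \<omega>" "y \<in> cylinder \<omega>"
  shows "x < t \<longleftrightarrow> y < t"
proof -
  have "\<exists>k. word_val \<omega> * 2 ^ length \<omega> = of_int k" for \<omega>
  proof (induction \<omega>)
    case (Cons b \<omega>)
    then obtain k where "word_val \<omega> * 2 ^ length \<omega> = of_int k" by blast
    then have "word_val (b # \<omega>) * 2 ^ length (b # \<omega>) = of_int (of_bool b * 2 ^ length \<omega> + k)"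
      by (auto simp: word_val_Cons algebra_simps)
    then show ?case by blast
  qed simp
  then obtain k where k: "word_val \<omega> * 2 ^ length \<omega> = of_int k" by blast
  have side: "z < t \<longleftrightarrow> k < j" if "z \<in> cylinder \<omega>" for z
  proof -
    have "word_val \<omega> \<le> z" "z < word_val \<omega> + 1 / 2 ^ length \<omega>" using that by (auto simp: cylinder_def)
    then have "word_val \<omega> * 2 ^ length \<omega> \<le> z * 2 ^ length \<omega>" "z * 2 ^ length \<omega> < (word_val \<omega> + 1 / 2 ^ length \<omega>) * 2 ^ length \<omega>"
      by simp_all
    then have z: "of_int k \<le> z * 2 ^ length \<omega>" "z * 2 ^ length \<omega> < of_int k + 1" using k by (simp_all add: distrib_right)
    have "z < t \<longleftrightarrow> z * 2 ^ length \<omega> < t * 2 ^ length \<omega>" by simp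
    also have "\<dots> \<longleftrightarrow> k < j" unfolding t using z by linarith
    finally show ?thesis .
  qed
  show ?thesis using side assms(2,3) by simp
qed

lemma dyadic_int: "m \<le> N \<Longrightarrow> 1 / 2 ^ m * 2 ^ N = (of_int (2 ^ (N - m)) :: real)"
proof -
  assume "m \<le> N"
  then have "(2::real) ^ N / 2 ^ m = 2 ^ (N - m)" by (simp add: power_diff)
  then show ?thesis by simp
qed

lemma word_val_append: "word_val (u @ v) = word_val u + word_val v / 2 ^ length u"
  by (induction u) (auto simp: word_val_Cons add_divide_distrib)

lemma word_val_replicate_False: "word_val (replicate j False) = 0"
  by (induction j) (auto simp: word_val_Cons)

lemma word_val_replicate_True: "word_val (replicate j True) = 1 - 1 / 2 ^ j"
  by (induction j) (auto simp: word_val_Cons diff_divide_distrib)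

text \<open>The carry of binary addition: the cylinders are neighbours although all letters after u
  differ.\<close>

lemma word_val_adjacent:
  "word_val (u @ True # replicate j False) = word_val (u @ False # replicate j True) + 1 / 2 ^ (Suc (length u + j))"
  by (simp add: word_val_append word_val_Cons word_val_replicate_False word_val_replicate_True
      diff_divide_distrib add_divide_distrib power_add)

lemma win_split: "k \<le> n \<Longrightarrow> win n s i = win k s i @ win (n - k) s (i + k)"
  unfolding win_def using upt_add_eq_append[of i "i + k" "n - k"] by simp

lemma win_snoc: "0 < n \<Longrightarrow> win n s i = win (n - 1) s i @ [s (i + (n - 1))]"
  by (cases n) (auto simp: win_def)

lemma win_const: "(\<And>k. k < n \<Longrightarrow> s (i + k) = a) \<Longrightarrow> win n s i = replicate n a"
  by (rule nth_equalityI) (auto simp: nth_win)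

lemma word_val_win_diff_last:
  assumes "\<And>k. k < n \<Longrightarrow> s (i + k) = t (i + k)"
  shows "word_val (win (Suc n) s i) - word_val (win (Suc n) t i) = (of_bool (s (i + n)) - of_bool (t (i + n))) / 2 ^ Suc n"
proof -
  have "win (Suc n) r i = win n r i @ [r (i + n)]" for r by (simp add: win_def)
  moreover have "win n s i = win n t i" using assms by (rule win_eqI)
  ultimately show ?thesis by (simp add: word_val_append word_val_Cons diff_divide_distrib)
qed

text \<open>Moving the end of a walk \<open>0\<^sup>N\<^sup>-\<^sup>1\<dots>01\<^sup>N\<^sup>-\<^sup>1\<close> to the adjacent cylinders \<open>\<dots>10\<^sup>N\<^sup>-\<^sup>1\<close> closes it up.\<close>

lemma no_mixed_flip:
  fixes W :: "bool list \<Rightarrow> real"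
  assumes N: "3 \<le> N" and K: "0 \<le> K"
    and cmp: "\<And>\<omega> \<omega>'. length \<omega> = N \<Longrightarrow> length \<omega>' = N \<Longrightarrow> word_val \<omega> \<le> word_val \<omega>' \<Longrightarrow>
      W \<omega> \<le> W \<omega>' + K * (word_val \<omega>' - word_val \<omega>)"
    and \<tau>0: "\<And>k. k < N - 1 \<Longrightarrow> \<not> \<tau> k" and \<tau>1: "\<And>k. l \<le> k \<Longrightarrow> \<tau> k" and l: "N - 1 \<le> l" and last: "\<not> \<tau> (l - 1)"
    and opt: "\<And>s. (\<And>k. s (k + l) = s k) \<Longrightarrow>
      (\<Sum>i<l. W (win N s i)) \<le> (\<Sum>i<l. W (win N \<tau> i)) - real l * g"
    and g: "5 / 2 * K / 2 ^ N < g"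
  shows False
proof -
  define \<sigma> where "\<sigma> = \<tau>(l - 1 := True)"
  define s where "s k = \<sigma> (k mod l)" for k
  \<comment> \<open>r stands between \<tau> and the periodic s. It changes the seam 01...1 to
    10...0, which moves every window that reaches it to the adjacent cylinder on the right. From r
    to s the zeros behind l are replaced by the initial block of the period, which is zero too,
    except possibly for one letter of the last window.\<close>
  define r where "r k = (if k < l then \<sigma> k else False)" for k
  have l0: "0 < l" using l N by simp
  have step1: "W (win N \<tau> i) \<le> W (win N r i) + (if l \<le> i + N then K / 2 ^ N else 0)" if i: "i < l" for i
  proof (cases "l \<le> i + N")
    case False
    then have "win N \<tau> i = win N r i" by (intro win_eqI) (auto simp: r_def \<sigma>_def)
    then show ?thesis using False by simp
  next
    case True
    define n where "n = l - 1 - i"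
    have n: "n < N" "i + n = l - 1" using True i by (auto simp: n_def)
    let ?u = "win n \<tau> i" and ?j = "N - Suc n"
    have u: "win n r i = ?u" using n i by (intro win_eqI) (auto simp: r_def \<sigma>_def)
    have e: "win N t i = win n t i @ t (l - 1) # win ?j t l" for t
    proof -
      have "win N t i = win n t i @ win (N - n) t (l - 1)" using win_split[of n N t i] n by simp
      also have "N - n = Suc ?j" using n by simp
      also have "win (Suc ?j) t (l - 1) = t (l - 1) # win ?j t l" using l0 by (simp add: win_Suc)
      finally show ?thesis .
    qed
    have "win N \<tau> i = ?u @ False # replicate ?j True"
      using e[of \<tau>] last \<tau>1 win_const[of ?j \<tau> l True] by simp
    moreover have "win N r i = ?u @ True # replicate ?j False"
      using e[of r] u l0 win_const[of ?j r l False] by (simp add: r_def \<sigma>_def)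
    ultimately have "word_val (win N r i) = word_val (win N \<tau> i) + 1 / 2 ^ (Suc (n + ?j))"
      by (simp add: word_val_adjacent del: power_Suc)
    moreover have "Suc (n + ?j) = N" using n by simp
    ultimately have "word_val (win N r i) = word_val (win N \<tau> i) + 1 / 2 ^ N" by (simp del: power_Suc)
    then show ?thesis using cmp[of "win N \<tau> i" "win N r i"] True by simp
  qed
  have step2: "W (win N r i) \<le> W (win N s i) + (if i = l - 1 then K / 2 ^ N else 0)" if i: "i < l" for i
  proof -
    have agree: "r (i + k) = s (i + k)" if "k < N" "i \<noteq> l - 1 \<or> k < N - 1" for k
    proof (cases "i + k < l")
      case False
      then have "(i + k) mod l = i + k - l" using that i l by (simp add: mod_if)
      moreover have "i + k - l < N - 2" using False that i by auto
      ultimately show ?thesis using False \<tau>0[of "i + k - l"] l by (auto simp: r_def s_def \<sigma>_def)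
    qed (simp add: r_def s_def)
    show ?thesis
    proof (cases "i = l - 1")
      case False
      then have "win N r i = win N s i" using agree by (intro win_eqI) auto
      then show ?thesis using False by simp
    next
      case True
      have N': "N = Suc (N - 1)" using N by simp
      have "word_val (win N s i) - word_val (win N r i) = (of_bool (s (i + (N - 1))) - of_bool (r (i + (N - 1)))) / 2 ^ N"
        using agree word_val_win_diff_last[of "N - 1" s i r] N' by simp
      moreover have "l \<le> i + (N - 1)" using True N l0 by simp
      then have "\<not> r (i + (N - 1))" by (simp add: r_def)
      ultimately have d: "word_val (win N s i) - word_val (win N r i) = of_bool (s (i + (N - 1))) / 2 ^ N" by simp
      then have "0 \<le> word_val (win N s i) - word_val (win N r i)" "word_val (win N s i) - word_val (win N r i) \<le> 1 / 2 ^ N"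
        by (auto simp: divide_right_mono)
      moreover from this have "K * (word_val (win N s i) - word_val (win N r i)) \<le> K * (1 / 2 ^ N)"
        using K by (intro mult_left_mono)
      ultimately show ?thesis using cmp[of "win N r i" "win N s i"] True by simp
    qed
  qed
  have "(\<Sum>i<l. W (win N \<tau> i)) \<le> (\<Sum>i<l. W (win N s i) + (if l \<le> i + N then K / 2 ^ N else 0) + (if i = l - 1 then K / 2 ^ N else 0))"
  proof (rule sum_mono)
    fix i assume "i \<in> {..<l}"
    then have "i < l" by simp
    from add_mono[OF step1[OF this] step2[OF this]]
    show "W (win N \<tau> i) \<le> W (win N s i) + (if l \<le> i + N then K / 2 ^ N else 0) + (if i = l - 1 then K / 2 ^ N else 0)"
      by (simp add: add_ac del: if_split)
  qed
  also have "\<dots> = (\<Sum>i<l. W (win N s i)) + (\<Sum>i<l. if l \<le> i + N then K / 2 ^ N else 0) + K / 2 ^ N"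
    using l0 by (simp add: sum.distrib)
  also have "(\<Sum>i<l. if l \<le> i + N then K / 2 ^ N else 0) \<le> real N * (K / 2 ^ N)"
  proof -
    have "(\<Sum>i<l. if l \<le> i + N then K / 2 ^ N else 0) = (\<Sum>i\<in>{i. i < l \<and> l \<le> i + N}. K / 2 ^ N)"
      by (subst sum.inter_filter[symmetric]) (auto intro!: sum.cong)
    also have "\<dots> = real (card {i. i < l \<and> l \<le> i + N}) * (K / 2 ^ N)" by simp
    also have "card {i. i < l \<and> l \<le> i + N} \<le> card {l - N..<l}" by (intro card_mono) auto
    then have "real (card {i. i < l \<and> l \<le> i + N}) * (K / 2 ^ N) \<le> real N * (K / 2 ^ N)"
      using K by (intro mult_right_mono) auto
    finally show ?thesis .
  qed
  finally have "(\<Sum>i<l. W (win N \<tau> i)) \<le> (\<Sum>i<l. W (win N s i)) + (real N + 1) * (K / 2 ^ N)"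
    by (simp add: distrib_right add_divide_distrib)
  moreover have "(\<Sum>i<l. W (win N s i)) \<le> (\<Sum>i<l. W (win N \<tau> i)) - real l * g"
    by (rule opt) (simp add: s_def)
  ultimately have "real l * g \<le> (real N + 1) * (K / 2 ^ N)" by simp
  \<comment> \<open>At most N windows reach the changed seam and one more the wrap-around;
    \<open>N + 1 \<le> 5 / 2 * (N - 1)\<close> holds from N = 3 on.\<close>
  also have "\<dots> \<le> (real l * (5 / 2)) * (K / 2 ^ N)"
  proof (rule mult_right_mono)
    have "real N - 1 \<le> real l" using l by simp
    then show "real N + 1 \<le> real l * (5 / 2)" using N by simp
  qed (use K in simp)
  also have "\<dots> = real l * (5 / 2 * K / 2 ^ N)" by simp
  also have "\<dots> < real l * g" using g l0 by (intro mult_strict_left_mono) auto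
  finally show False by simp
qed

text \<open>The competitor arises by deleting one letter of the block \<open>a\<^sup>N\<^sup>-\<^sup>1\<close>.\<close>

lemma no_pure:
  fixes W :: "bool list \<Rightarrow> real"
  assumes N: "3 \<le> N" and K: "0 \<le> K"
    and c1: "W ((\<not> a) # replicate (N - 1) a) \<le> W ((\<not> a) # replicate (N - 2) a @ [\<not> a]) + K / 2 ^ N"
    and c2: "W (replicate (N - 1) a @ [\<not> a]) \<le> W (replicate N a) + K / 2 ^ N"
    and \<tau>per: "\<And>k. \<tau> (k + l) = \<tau> k" and \<tau>0: "\<And>k. k < N - 1 \<Longrightarrow> \<tau> k = a" and \<tau>N: "\<tau> (N - 1) = (\<not> a)"
    and l: "0 < l" and last: "\<tau> (l - 1) = (\<not> a)"
    and opt: "\<And>s. (\<And>k. s (k + (l - 1)) = s k) \<Longrightarrow>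
      (\<Sum>i<l - 1. W (win N s i)) \<le> real (l - 1) * (M - g)"
    and Z: "W (replicate N a) \<le> M - g"
    and M: "(\<Sum>i<l. W (win N \<tau> i)) = real l * M"
    and g: "5 / 2 * K / 2 ^ N < g"
  shows False
proof -
  have lN: "N \<le> l"
  proof (rule ccontr)
    assume "\<not> N \<le> l" then have "l - 1 < N - 1" using l N by simp
    then show False using \<tau>0 last by simp
  qed
  \<comment> \<open>The period drops the letter \<open>\<tau> 0\<close> of the block. The window at
    0 is charged to the loop, whose weight is at most M - g. Of the other windows only the one
    starting just before the block changes: it now sees the block one letter shorter.\<close>
  define s where "s k = \<tau> (Suc (k mod (l - 1)))" for k
  have l1: "0 < l - 1" using lN N by simp
  have win0: "win N \<tau> 0 = replicate (N - 1) a @ [\<not> a]"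
    using win_snoc[of N \<tau> 0] N \<tau>0 \<tau>N win_const[of "N - 1" \<tau> 0 a] by simp
  have step: "W (win N \<tau> (Suc i)) \<le> W (win N s i) + (if i = l - 2 then K / 2 ^ N else 0)" if i: "i < l - 1" for i
  proof -
    have agree: "\<tau> (Suc i + k) = s (i + k)" if "k < N" "i \<noteq> l - 2 \<or> k < N - 1" for k
    proof (cases "i + k < l - 1")
      case False
      then have m: "(i + k) mod (l - 1) = i + k - (l - 1)" using that i lN by (simp add: mod_if)
      have "i + k - (l - 1) < N - 2" using False that i by auto
      then have "\<tau> (i + k - (l - 1)) = a" "\<tau> (Suc (i + k - (l - 1))) = a" using \<tau>0 by auto
      moreover have "\<tau> (Suc i + k) = \<tau> (i + k - (l - 1))" using False \<tau>per[of "i + k - (l - 1)"] l by (simp add: add.commute)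
      ultimately show ?thesis using m by (simp add: s_def)
    qed (simp add: s_def)
    show ?thesis
    proof (cases "i = l - 2")
      case False
      then have "win N \<tau> (Suc i) = win N s i" using agree by (intro win_eqI) auto
      then show ?thesis using False by simp
    next
      case True
      then have Si: "Suc i = l - 1" using l1 by simp
      have t: "win N \<tau> (Suc i) = (\<not> a) # replicate (N - 1) a"
      proof -
        have "win N \<tau> (l - 1) = \<tau> (l - 1) # win (N - 1) \<tau> l" using N l win_Suc[of "N - 1" \<tau> "l - 1"] by simp
        moreover have "win (N - 1) \<tau> l = replicate (N - 1) a" using \<tau>per \<tau>0 by (intro win_const) (simp add: add.commute)
        ultimately show ?thesis using Si last by simp
      qed
      have "win N s i = win (N - 1) s i @ [s (i + (N - 1))]"
        using N by (intro win_snoc) simp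
      also have "win (N - 1) s i = win (N - 1) \<tau> (Suc i)" using agree by (intro win_eqI) auto
      also have "\<dots> = butlast (win N \<tau> (Suc i))" by (simp add: butlast_win)
      also have "\<dots> = (\<not> a) # replicate (N - 2) a" unfolding t using N
        by (intro nth_equalityI) (auto simp: nth_butlast nth_Cons split: nat.split)
      also have "s (i + (N - 1)) = (\<not> a)"
      proof -
        have "(i + (N - 1)) mod (l - 1) = N - 2" using True lN N l1 by (simp add: mod_if)
        then show ?thesis using \<tau>N N by (simp add: s_def Suc_diff_Suc numeral_2_eq_2)
      qed
      finally show ?thesis using t c1 True by simp
    qed
  qed
  have "(\<Sum>i<l. W (win N \<tau> i)) = W (win N \<tau> 0) + (\<Sum>i<l - 1. W (win N \<tau> (Suc i)))"
    using l by (cases l) (simp_all add: sum.lessThan_Suc_shift del: sum.lessThan_Suc)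
  also have "(\<Sum>i<l - 1. W (win N \<tau> (Suc i))) \<le> (\<Sum>i<l - 1. W (win N s i) + (if i = l - 2 then K / 2 ^ N else 0))"
    using step by (intro sum_mono) auto
  also have "\<dots> = (\<Sum>i<l - 1. W (win N s i)) + K / 2 ^ N" using l1 by (simp add: sum.distrib)
  also have "(\<Sum>i<l - 1. W (win N s i)) \<le> real (l - 1) * (M - g)" by (rule opt) (simp add: s_def)
  finally have "real l * M \<le> (M - g + K / 2 ^ N) + (real (l - 1) * (M - g) + K / 2 ^ N)"
    using M win0 c2 Z by simp
  then have "real l * g \<le> 2 * (K / 2 ^ N)" using l by (simp add: of_nat_diff algebra_simps)
  moreover have "1 * g \<le> real l * g" using l g K by (intro mult_right_mono) (auto intro: order_trans[OF _ less_imp_le[OF g]])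
  ultimately have "g \<le> 2 * (K / 2 ^ N)" by simp
  moreover have "2 * (K / 2 ^ N) \<le> 5 / 2 * (K / 2 ^ N)" using K by (intro mult_right_mono) auto
  ultimately show False using g by simp
qed

text \<open>\<open>dom\<close> restates \<open>right_dominant\<close> for \<open>lcut\<close>, with
  the end point e included. Both dominance cases become instances: p = 1 - c on the right, and p = c
  after reflection on the left.\<close>

locale right_potential =
  fixes \<alpha> p e :: real and m N :: nat
  assumes \<alpha>: "0 < \<alpha>" "\<alpha> \<le> pi / 4" and p: "0 < p" "p < 1"
    and e: "e = 1 / 2 ^ m" and m: "2 \<le> m" and mN: "m \<le> N" and N: "4 \<le> N"
    and dom: "\<And>s. 0 \<le> s \<Longrightarrow> s \<le> e \<Longrightarrow> lcut \<alpha> p (- s) \<le> lcut \<alpha> p 0 \<and> lcut \<alpha> p 0 \<le> lcut \<alpha> p s"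
begin

abbreviation "L \<equiv> pi * cot \<alpha>"
abbreviation "\<phi> \<equiv> lsym \<alpha> p e"

lemma L_nonneg: "0 \<le> L" using cot_alpha_ge_1[OF \<alpha>] by simp

lemma e_bounds: "0 < e" "e \<le> 1 / 4"
proof -
  show "0 < e" by (simp add: e)
  have "(2::real) ^ 2 \<le> 2 ^ m" using m by (intro power_increasing) auto
  then show "e \<le> 1/4" by (simp add: e field_simps)
qed

lemma lcut_diff: "lcut \<alpha> p x - lcut \<alpha> p y \<le> L * \<bar>x - y\<bar>"
  using lcut_lipschitz[OF \<alpha>, of p x y] by (simp add: abs_le_iff)

lemma phi_lipschitz_same_side:
  assumes "x < 1 - e \<longleftrightarrow> y < 1 - e"
  shows "\<bar>\<phi> x - \<phi> y\<bar> \<le> L * \<bar>x - y\<bar>"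
  using assms lcut_lipschitz[OF \<alpha>, of p x y] lcut_lipschitz[OF \<alpha>, of p "1 - x" "1 - y"]
  by (auto simp: lsym_def abs_minus_commute)

lemma lcut_dom_e: "lcut \<alpha> p (1 - e) \<le> lcut \<alpha> p e"
  using dom[of e] e_bounds by (auto simp: lcut_1_minus[OF \<alpha>])

text \<open>To the right the jump can only help: at 1 - e the value changes from
  \<open>lcut \<alpha> p (- e)\<close> to \<open>lcut \<alpha> p e\<close>, and \<open>dom\<close>
  orders these through the value at 0.\<close>

lemma phi_one_sided:
  assumes "x \<le> y"
  shows "\<phi> x \<le> \<phi> y + L * (y - x)"
proof (cases "x < 1 - e \<longleftrightarrow> y < 1 - e")
  case True then show ?thesis using phi_lipschitz_same_side[OF True] assms by (simp add: abs_le_iff)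
next
  case False
  then have xy: "x < 1 - e" "1 - e \<le> y" using assms by auto
  have "lcut \<alpha> p x - lcut \<alpha> p (1 - e) \<le> L * (1 - e - x)" using lcut_diff[of x "1 - e"] xy by simp
  moreover have "lcut \<alpha> p e - lcut \<alpha> p (1 - y) \<le> L * (y - (1 - e))" using lcut_diff[of e "1 - y"] xy by (simp add: algebra_simps)
  ultimately show ?thesis using lcut_dom_e xy by (simp add: lsym_def algebra_simps)
qed

text \<open>Together with \<open>dom\<close> the assumption makes both one-sided values at 1 - e
  agree, so the other direction holds as well.\<close>

lemma phi_one_sided_no_jump:
  assumes "lcut \<alpha> p e \<le> lcut \<alpha> p (- e)" "x \<le> y"
  shows "\<phi> y \<le> \<phi> x + L * (y - x)"
proof (cases "x < 1 - e \<longleftrightarrow> y < 1 - e")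
  case True then show ?thesis using phi_lipschitz_same_side[OF True] assms by (simp add: abs_le_iff)
next
  case False
  then have xy: "x < 1 - e" "1 - e \<le> y" using assms by auto
  have "lcut \<alpha> p (1 - e) - lcut \<alpha> p x \<le> L * (1 - e - x)" using lcut_diff[of "1 - e" x] xy by (simp add: algebra_simps)
  moreover have "lcut \<alpha> p (1 - y) - lcut \<alpha> p e \<le> L * (y - (1 - e))" using lcut_diff[of "1 - y" e] xy by (simp add: algebra_simps)
  ultimately show ?thesis using assms(1) xy by (simp add: lsym_def lcut_1_minus[OF \<alpha>] algebra_simps)
qed

text \<open>A strict jump locates the peak. For \<open>p \<ge> 1/2\<close> the point -e is at least
  as near to p modulo 1 as e is. For \<open>p < e / 2\<close> the point e is farther from p than 0,
  yet \<open>dom\<close> makes its value no smaller; so it lies at the cut, and nothing is below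
  that.\<close>

lemma jump_imp:
  assumes "lcut \<alpha> p (- e) < lcut \<alpha> p e"
  shows "e / 2 \<le> p" "p < 1 / 2"
proof -
  show "p < 1 / 2"
  proof (rule ccontr)
    assume "\<not> p < 1 / 2"
    then have "0 \<le> sin (pi * (2 * p - 1))" using p by (intro sin_mult_pi_nonneg) auto
    moreover have "sin (pi * (2 * p - 1)) = - sin (pi * (2 * p))" by (simp add: right_diff_distrib)
    moreover have "sin (pi * (- (2 * p))) = - sin (pi * (2 * p))" by simp
    ultimately have "0 \<le> sin (pi * (- (2 * p)))" by simp
    moreover have "0 \<le> sin (pi * (2 * e))" using e_bounds by (intro sin_mult_pi_nonneg) auto
    ultimately have "0 \<le> sin (pi * (2 * e)) * sin (pi * (- (2 * p)))" by (rule mult_nonneg_nonneg[rotated])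
    then have "lcut \<alpha> p e \<le> lcut \<alpha> p (- e)" using lcut_compare[OF \<alpha>, of e "- e" p] by simp
    then show False using assms by simp
  qed
  show "e / 2 \<le> p"
  proof (rule ccontr)
    assume *: "\<not> e / 2 \<le> p"
    have "\<bar>0 - p\<bar> < e - p" "e - p < 1/2" using * p e_bounds by auto
    then have "cos (pi * (e - p)) < cos (pi * \<bar>0 - p\<bar>)"
      using e_bounds by (intro cos_monotone_0_pi) auto
    moreover have "0 < cos (pi * (e - p))" using * p e_bounds by (intro cos_gt_zero_abs) auto
    moreover have "cos (pi * \<bar>0 - p\<bar>) = cos (pi * (0 - p))" using p by simp
    ultimately have c: "\<bar>cos (pi * (e - p))\<bar> < \<bar>cos (pi * (0 - p))\<bar>" by simp
    have "lcut \<alpha> p 0 \<le> lcut \<alpha> p e" using dom[of e] e_bounds by auto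
    then have "max \<bar>cos (pi * (0 - p))\<bar> (sin \<alpha>) \<le> max \<bar>cos (pi * (e - p))\<bar> (sin \<alpha>)"
      using sin_alpha_pos[OF \<alpha>] unfolding lcut_def by (subst (asm) ln_le_cancel_iff) auto
    with c have "\<bar>cos (pi * (e - p))\<bar> \<le> sin \<alpha>" by (auto simp: max_def split: if_splits)
    then have "lcut \<alpha> p e = ln (sin \<alpha>)" by (simp add: lcut_def max_def)
    then show False using assms lcut_ge[OF \<alpha>, of p "- e"] by simp
  qed
qed

lemma phi_meas: "\<phi> \<in> borel_measurable borel"
proof -
  have c: "lcut \<alpha> p \<in> borel_measurable borel"
    using continuous_lcut[OF \<alpha>] by (rule borel_measurable_continuous_onI)
  have "(\<lambda>x. lcut \<alpha> p (1 - x)) \<in> borel_measurable borel" using c by measurable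
  then show ?thesis unfolding lsym_def using c by measurable
qed

lemma phi_bdd: "\<bar>\<phi> x\<bar> \<le> - ln (sin \<alpha>)"
proof -
  have "ln (sin \<alpha>) \<le> \<phi> x" "\<phi> x \<le> 0" by (simp_all add: lsym_def lcut_ge[OF \<alpha>] lcut_le_0[OF \<alpha>])
  then show ?thesis by simp
qed

abbreviation "W \<equiv> avg \<phi>"

lemmas avg_cmp = avg_compare[OF phi_meas phi_bdd]
lemmas avg_pt = avg_point[OF phi_meas phi_bdd]

lemma W_up:
  assumes "length \<omega> = length \<omega>'" "word_val \<omega> \<le> word_val \<omega>'"
  shows "W \<omega> \<le> W \<omega>' + L * (word_val \<omega>' - word_val \<omega>)"
  using assms phi_one_sided[of "word_val \<omega> + u" "word_val \<omega>' + u" for u] by (intro avg_cmp) auto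

lemma W_down_no_jump:
  assumes "lcut \<alpha> p e \<le> lcut \<alpha> p (- e)" "length \<omega> = length \<omega>'" "word_val \<omega>' \<le> word_val \<omega>"
  shows "W \<omega> \<le> W \<omega>' + L * (word_val \<omega> - word_val \<omega>')"
  using assms phi_one_sided_no_jump[OF assms(1), of "word_val \<omega>' + u" "word_val \<omega> + u" for u] by (intro avg_cmp) auto

lemma W_down_left:
  assumes "length \<omega> = length \<omega>'" "word_val \<omega>' \<le> word_val \<omega>" "word_val \<omega> + 1 / 2 ^ length \<omega> \<le> 1 - e"
  shows "W \<omega> \<le> W \<omega>' + L * (word_val \<omega> - word_val \<omega>')"
proof (rule avg_cmp[OF assms(1)])
  fix u :: real assume u: "0 \<le> u" "u < 1 / 2 ^ length \<omega>"
  then have "\<bar>\<phi> (word_val \<omega> + u) - \<phi> (word_val \<omega>' + u)\<bar> \<le> L * \<bar>(word_val \<omega> + u) - (word_val \<omega>' + u)\<bar>"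
    using assms by (intro phi_lipschitz_same_side) linarith
  then show "\<phi> (word_val \<omega> + u) \<le> \<phi> (word_val \<omega>' + u) + L * (word_val \<omega> - word_val \<omega>')"
    using assms by (simp add: abs_le_iff)
qed

text \<open>Since \<open>1 - e\<close> is an endpoint of a cylinder of length \<open>N\<close>, no cylinder crosses the jump.\<close>

lemma cylinder_side:
  assumes "length \<omega> = N" "x \<in> cylinder \<omega>" "y \<in> cylinder \<omega>"
  shows "x < 1 - e \<longleftrightarrow> y < 1 - e"
proof (rule cylinder_dyadic_side[OF _ assms(2,3)])
  show "(1 - e) * 2 ^ length \<omega> = of_int (2 ^ N - 2 ^ (N - m))"
    using dyadic_int[OF mN] assms(1) by (simp add: e left_diff_distrib)
qed

lemma W_point:
  assumes "length \<omega> = N" "z \<in> cylinder \<omega>"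
  shows "\<bar>W \<omega> - \<phi> z\<bar> \<le> L / 2 / 2 ^ N"
  using avg_pt[OF L_nonneg assms(2)] phi_lipschitz_same_side cylinder_side[OF assms(1) _ assms(2)] assms(1) by blast

end

lemma word_val_win: "word_val (win n s i) = (\<Sum>k<n. of_bool (s (i + k)) / 2 ^ Suc k)"
  unfolding word_val_def by (auto intro!: sum.cong simp: nth_win)

lemma word_val_win_single:
  assumes "j < n" "s (i + j)" "\<not> t (i + j)" "\<And>k. k < n \<Longrightarrow> k \<noteq> j \<Longrightarrow> s (i + k) = t (i + k)"
  shows "word_val (win n s i) = word_val (win n t i) + 1 / 2 ^ Suc j"
proof -
  have "(\<Sum>k<n. of_bool (s (i + k)) / 2 ^ Suc k :: real)
      = of_bool (s (i + j)) / 2 ^ Suc j + (\<Sum>k\<in>{..<n} - {j}. of_bool (s (i + k)) / 2 ^ Suc k)" for s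
    using assms(1) by (intro sum.remove) auto
  moreover have "(\<Sum>k\<in>{..<n} - {j}. of_bool (s (i + k)) / 2 ^ Suc k :: real) = (\<Sum>k\<in>{..<n} - {j}. of_bool (t (i + k)) / 2 ^ Suc k)"
    using assms(4) by (intro sum.cong) auto
  ultimately show ?thesis using assms unfolding word_val_win by simp
qed

section \<open>Cycles that leave the node as ones and enter it as zeros\<close>

context right_potential
begin

context
  fixes \<tau> :: "nat \<Rightarrow> bool" and l :: nat and g :: real
  assumes \<tau>1: "\<And>k. k < N - 1 \<Longrightarrow> \<tau> k" and \<tau>0: "\<And>k. l \<le> k \<Longrightarrow> \<not> \<tau> k" and l: "N - 1 \<le> l"
    and opt: "\<And>s. (\<And>k. s (k + l) = s k) \<Longrightarrow>
      (\<Sum>i<l. W (win N s i)) \<le> (\<Sum>i<l. W (win N \<tau> i)) - real l * g"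
    and g: "5 / 2 * L / 2 ^ N < g"
begin

text \<open>In units of \<open>L / 2 ^ N\<close>, \<open>c\<close> is the cost of closing \<sigma>
  up to a periodic sequence and \<open>c'\<close> what the comparison of points leaves over. The
  other N - 1 units come from passing from averages to values and back, half a unit each, on the
  first N - 1 windows; the later windows of both sequences coincide.\<close>

lemma competitor_False:
  assumes \<sigma>: "\<And>k. N - 1 \<le> k \<Longrightarrow> \<sigma> k = \<tau> k"
    and wrap: "(\<Sum>i<l. W (win N \<sigma> i)) \<le> (\<Sum>i<l. W (win N (\<lambda>k. \<sigma> (k mod l)) i)) + c * (L / 2 ^ N)"
    and points: "(\<Sum>i<N - 1. \<phi> (bval (\<lambda>k. \<tau> (i + k)))) \<le> (\<Sum>i<N - 1. \<phi> (bval (\<lambda>k. \<sigma> (i + k)))) + c' * (L / 2 ^ N)"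
    and c: "c + c' + real (N - 1) \<le> 5 / 2 * real l"
  shows False
proof -
  have l0: "0 < l" using l N by simp
  have inf: "\<exists>k\<ge>i. \<not> \<tau> k" "\<exists>k\<ge>i. \<not> \<sigma> k" for i
  proof -
    have "N - 1 \<le> max i l" using l by simp
    then show "\<exists>k\<ge>i. \<not> \<tau> k" "\<exists>k\<ge>i. \<not> \<sigma> k"
      using \<tau>0[of "max i l"] \<sigma>[of "max i l"] by (auto intro!: exI[of _ "max i l"])
  qed
  have split: "(\<Sum>i<l. f i) = (\<Sum>i<N - 1. f i) + (\<Sum>i\<in>{N - 1..<l}. f i)" for f :: "nat \<Rightarrow> real"
    using l by (simp add: lessThan_atLeast0 sum.atLeastLessThan_concat)
  have tail: "(\<Sum>i\<in>{N - 1..<l}. W (win N \<tau> i)) = (\<Sum>i\<in>{N - 1..<l}. W (win N \<sigma> i))"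
  proof (rule sum.cong[OF refl])
    fix i assume "i \<in> {N - 1..<l}"
    then have "win N \<tau> i = win N \<sigma> i" using \<sigma> by (intro win_eqI) simp
    then show "W (win N \<tau> i) = W (win N \<sigma> i)" by simp
  qed
  have pt: "W (win N \<tau> i) \<le> \<phi> (bval (\<lambda>k. \<tau> (i + k))) + L / 2 / 2 ^ N"
    "\<phi> (bval (\<lambda>k. \<sigma> (i + k))) \<le> W (win N \<sigma> i) + L / 2 / 2 ^ N" for i
  proof -
    have "bval (\<lambda>k. \<tau> (i + k)) \<in> cylinder (win N \<tau> i)" by (rule bval_in_cylinder[OF inf(1)])
    then show "W (win N \<tau> i) \<le> \<phi> (bval (\<lambda>k. \<tau> (i + k))) + L / 2 / 2 ^ N"
      using W_point[of "win N \<tau> i"] by (force simp: abs_le_iff)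
    have "bval (\<lambda>k. \<sigma> (i + k)) \<in> cylinder (win N \<sigma> i)" by (rule bval_in_cylinder[OF inf(2)])
    then show "\<phi> (bval (\<lambda>k. \<sigma> (i + k))) \<le> W (win N \<sigma> i) + L / 2 / 2 ^ N"
      using W_point[of "win N \<sigma> i"] by (force simp: abs_le_iff)
  qed
  have h: "L / 2 / 2 ^ N = (L / 2 ^ N) / 2" by simp
  have "(\<Sum>i<N - 1. W (win N \<tau> i)) \<le> (\<Sum>i<N - 1. \<phi> (bval (\<lambda>k. \<tau> (i + k)))) + real (N - 1) * ((L / 2 ^ N) / 2)"
  proof -
    have "(\<Sum>i<N - 1. W (win N \<tau> i)) \<le> (\<Sum>i<N - 1. \<phi> (bval (\<lambda>k. \<tau> (i + k))) + (L / 2 ^ N) / 2)"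
      by (rule sum_mono) (use pt(1) in \<open>simp only: h\<close>)
    then show ?thesis by (simp add: sum.distrib)
  qed
  moreover have "(\<Sum>i<N - 1. \<phi> (bval (\<lambda>k. \<sigma> (i + k)))) \<le> (\<Sum>i<N - 1. W (win N \<sigma> i)) + real (N - 1) * ((L / 2 ^ N) / 2)"
  proof -
    have "(\<Sum>i<N - 1. \<phi> (bval (\<lambda>k. \<sigma> (i + k)))) \<le> (\<Sum>i<N - 1. W (win N \<sigma> i) + (L / 2 ^ N) / 2)"
      by (rule sum_mono) (use pt(2) in \<open>simp only: h\<close>)
    then show ?thesis by (simp add: sum.distrib)
  qed
  moreover have "real (N - 1) * ((L / 2 ^ N) / 2) + real (N - 1) * ((L / 2 ^ N) / 2) = real (N - 1) * (L / 2 ^ N)" by simp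
  ultimately have "(\<Sum>i<l. W (win N \<tau> i)) \<le> (\<Sum>i<l. W (win N \<sigma> i)) + (c' * (L / 2 ^ N) + real (N - 1) * (L / 2 ^ N))"
    unfolding split[of "\<lambda>i. W (win N \<tau> i)"] split[of "\<lambda>i. W (win N \<sigma> i)"] tail using points by linarith
  moreover have "(\<Sum>i<l. W (win N (\<lambda>k. \<sigma> (k mod l)) i)) \<le> (\<Sum>i<l. W (win N \<tau> i)) - real l * g"
    by (rule opt) simp
  ultimately have "real l * g \<le> c * (L / 2 ^ N) + (c' * (L / 2 ^ N) + real (N - 1) * (L / 2 ^ N))"
    using wrap by linarith
  also have "\<dots> = (c + c' + real (N - 1)) * (L / 2 ^ N)" by (simp only: distrib_right add.assoc)
  also have "\<dots> \<le> (5 / 2 * real l) * (L / 2 ^ N)" using c L_nonneg by (intro mult_right_mono) auto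
  also have "\<dots> = real l * (5 / 2 * L / 2 ^ N)" by simp
  also have "\<dots> < real l * g" using g l0 by (intro mult_strict_left_mono) auto
  finally show False by simp
qed

text \<open>Behind l the sequence \<sigma> has only zeros, while its periodic continuation repeats
  the initial block, whose only possible one sits at t. Wrapping thus changes at most one letter of
  a window, from 0 to 1, and so moves it to the right, where the jump does no harm.\<close>

lemma wrap_single:
  assumes \<sigma>: "\<And>k. N - 1 \<le> k \<Longrightarrow> \<sigma> k = \<tau> k" and t: "\<And>k. k < N - 1 \<Longrightarrow> \<sigma> k \<Longrightarrow> k = t" and i: "i < l"
  shows "W (win N \<sigma> i) \<le> W (win N (\<lambda>k. \<sigma> (k mod l)) i) + (if l + t - i < N then L / 2 ^ Suc (l + t - i) else 0)"
proof -
  let ?s = "\<lambda>k. \<sigma> (k mod l)"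
  have mod: "(i + k) mod l = (if i + k < l then i + k else i + k - l)" if "k < N" for k
    using that i l by (simp add: mod_if)
  have \<sigma>0: "\<not> \<sigma> k" if "l \<le> k" for k using \<sigma>[of k] \<tau>0[OF that] that l by simp
  have agree: "?s (i + k) = \<sigma> (i + k)" if "k < N" "i + k \<noteq> l + t" for k
  proof (cases "i + k < l")
    case False
    then have "i + k - l < N - 1" "i + k - l \<noteq> t" using that i by auto
    then have "\<not> \<sigma> (i + k - l)" using t by blast
    then show ?thesis using False mod[OF that(1)] \<sigma>0[of "i + k"] by simp
  qed (simp add: mod that)
  show ?thesis
  proof (cases "l + t - i < N \<and> ?s (l + t)")
    case False
    have "win N \<sigma> i = win N ?s i"
    proof (rule win_eqI)
      fix k assume k: "k < N"
      show "\<sigma> (i + k) = ?s (i + k)"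
      proof (cases "i + k = l + t")
        case True
        then have "l + t - i < N" using k by simp
        then have "\<not> ?s (i + k)" using False True by simp
        then show ?thesis using \<sigma>0[of "i + k"] True by simp
      qed (use agree[OF k] in simp)
    qed
    then show ?thesis using L_nonneg by simp
  next
    case True
    have "word_val (win N ?s i) = word_val (win N \<sigma> i) + 1 / 2 ^ Suc (l + t - i)"
      using True i \<sigma>0[of "l + t"] agree by (intro word_val_win_single) auto
    then show ?thesis using W_up[of "win N \<sigma> i" "win N ?s i"] True by simp
  qed
qed

definition "q = bval (\<lambda>k. \<tau> (N - 1 + k))"

lemma q_bounds:
  assumes "\<not> \<tau> (N - 1)" shows "0 \<le> q" "q < 1 / 2"
proof -
  show "0 \<le> q" unfolding q_def by (rule bval_nonneg)
  have "\<not> \<tau> (N - 1 + Suc l)" by (rule \<tau>0) simp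
  then have "bval (\<lambda>k. \<tau> (N - 1 + Suc k)) < 1" by (intro bval_less_1)
  then show "q < 1 / 2" using bval_Suc[of "\<lambda>k. \<tau> (N - 1 + k)"] assms by (simp add: q_def)
qed

lemma phi_left_end:
  assumes "0 \<le> a" "a \<le> 3 / 4" "a < 3 / 4" shows "\<phi> a = lcut \<alpha> p a"
  using assms e_bounds by (simp add: lsym_def)

lemma sum_reindex: "(\<Sum>i<n. f (n - i)) = (\<Sum>j\<in>{1..<Suc n}. f j :: real)"
  by (rule sum.reindex_bij_witness[of _ "\<lambda>j. n - j" "\<lambda>i. n - i"]) auto

lemma tau_points: "(\<Sum>i<N - 1. \<phi> (bval (\<lambda>k. \<tau> (i + k)))) = (\<Sum>j\<in>{1..<N}. \<phi> (1 - (1 - q) / 2 ^ j))"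
proof -
  have "bval (\<lambda>k. \<tau> (i + k)) = 1 - (1 - q) / 2 ^ (N - 1 - i)" if i: "i < N - 1" for i
  proof -
    have "bval (\<lambda>k. \<tau> (i + k)) = 1 - (1 - bval (\<lambda>k. \<tau> (i + (N - 1 - i + k)))) / 2 ^ (N - 1 - i)"
      using \<tau>1 i by (intro bval_replicate_True) auto
    moreover have "(\<lambda>k. \<tau> (i + (N - 1 - i + k))) = (\<lambda>k. \<tau> (N - 1 + k))"
      using i by (intro ext arg_cong[of _ _ \<tau>]) simp
    ultimately show ?thesis by (simp only: q_def)
  qed
  then have "(\<Sum>i<N - 1. \<phi> (bval (\<lambda>k. \<tau> (i + k)))) = (\<Sum>i<N - 1. \<phi> (1 - (1 - q) / 2 ^ (N - 1 - i)))"
    by (intro sum.cong) auto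
  also have "\<dots> = (\<Sum>j\<in>{1..<Suc (N - 1)}. \<phi> (1 - (1 - q) / 2 ^ j))" by (rule sum_reindex)
  finally show ?thesis using N by simp
qed

lemma right_points:
  assumes z: "0 \<le> z" "z < 3 / 2" and n: "n \<le> N - 1"
    and v: "\<And>i. i < n \<Longrightarrow> bval (\<lambda>k. \<sigma> (i + k)) = z / 2 ^ (n - i)"
  shows "(\<Sum>i<n. \<phi> (bval (\<lambda>k. \<sigma> (i + k)))) = (\<Sum>j\<in>{1..<Suc n}. lcut \<alpha> p (z / 2 ^ j))"
proof -
  have "(\<Sum>i<n. \<phi> (bval (\<lambda>k. \<sigma> (i + k)))) = (\<Sum>i<n. lcut \<alpha> p (z / 2 ^ (n - i)))"
  proof (rule sum.cong[OF refl])
    fix i assume i: "i \<in> {..<n}"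
    then obtain j where j: "n - i = Suc j" by (cases "n - i") auto
    have "z / 2 ^ j \<le> z / 1" using z by (intro divide_left_mono) auto
    then have "z / 2 ^ Suc j < 3 / 4" using z by simp
    then show "\<phi> (bval (\<lambda>k. \<sigma> (i + k))) = lcut \<alpha> p (z / 2 ^ (n - i))"
      using v[of i] i j z by (simp add: phi_left_end del: power_Suc)
  qed
  also have "\<dots> = (\<Sum>j\<in>{1..<Suc n}. lcut \<alpha> p (z / 2 ^ j))" by (rule sum_reindex)
  finally show ?thesis .
qed

lemma no_mixed_departure:
  assumes jump: "lcut \<alpha> p (- e) < lcut \<alpha> p e" and \<tau>N: "\<not> \<tau> (N - 1)"
  shows False
proof -
  note qb = q_bounds[OF \<tau>N]
  note dep = departure[OF \<alpha> e m mN N jump_imp[OF jump] qb]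
  have l0: "0 < l" using l N by simp
  have N1: "Suc (N - 1) = N" using N by simp
  from dep consider
      (B) "(\<Sum>j\<in>{1..<N}. \<phi> (1 - (1 - q) / 2 ^ j)) \<le> (\<Sum>j\<in>{1..<N}. lcut \<alpha> p (q / 2 ^ j))"
    | (C0) "(\<Sum>j\<in>{1..<N}. \<phi> (1 - (1 - q) / 2 ^ j)) \<le> (\<Sum>j\<in>{1..<N}. lcut \<alpha> p ((1 + q) / 2 ^ j))"
    | (C1) "0 < q" "(\<Sum>j\<in>{1..<N}. \<phi> (1 - (1 - q) / 2 ^ j))
        \<le> (\<Sum>j\<in>{1..<N-1}. lcut \<alpha> p ((1 + q / 2) / 2 ^ j)) + lcut \<alpha> p (q / 2) + 2 * L / 2 ^ N"
    by blast
  then show False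
  proof cases
    case B
    \<comment> \<open>The initial block of this competitor is all zeros, so closing it up changes no
      window.\<close>
    define \<sigma> where "\<sigma> k = (N - 1 \<le> k \<and> \<tau> k)" for k
    have "(\<Sum>i<l. W (win N \<sigma> i)) \<le> (\<Sum>i<l. W (win N (\<lambda>k. \<sigma> (k mod l)) i)) + 0 * (L / 2 ^ N)"
    proof -
      have "win N \<sigma> i = win N (\<lambda>k. \<sigma> (k mod l)) i" if i: "i < l" for i
      proof (rule win_eqI)
        fix k assume "k < N"
        then show "\<sigma> (i + k) = \<sigma> ((i + k) mod l)"
          using i l \<tau>0[of "i + k"] by (auto simp: \<sigma>_def mod_if)
      qed
      then show ?thesis by simp
    qed
    moreover have "(\<Sum>i<N - 1. \<phi> (bval (\<lambda>k. \<sigma> (i + k)))) = (\<Sum>j\<in>{1..<Suc (N - 1)}. lcut \<alpha> p (q / 2 ^ j))"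
    proof (rule right_points)
      fix i assume i: "i < N - 1"
      have "bval (\<lambda>k. \<sigma> (i + k)) = bval (\<lambda>k. \<sigma> (i + (N - 1 - i + k))) / 2 ^ (N - 1 - i)"
        using i by (intro bval_replicate_False) (auto simp: \<sigma>_def)
      moreover have "(\<lambda>k. \<sigma> (i + (N - 1 - i + k))) = (\<lambda>k. \<tau> (N - 1 + k))" using i by (intro ext) (auto simp: \<sigma>_def)
      ultimately show "bval (\<lambda>k. \<sigma> (i + k)) = q / 2 ^ (N - 1 - i)" by (simp only: q_def)
    qed (use qb in auto)
    moreover have \<sigma>\<tau>: "\<sigma> k = \<tau> k" if "N - 1 \<le> k" for k using that by (auto simp: \<sigma>_def)
    ultimately show False using B l competitor_False[of \<sigma> 0 0, OF \<sigma>\<tau>] unfolding N1 tau_points by simp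
  next
    case C0
    \<comment> \<open>Across the seam the one at N - 2 is seen only by the last window, in its last
      letter: one unit.\<close>
    define \<sigma> where "\<sigma> k = (N - 2 \<le> k \<and> \<tau> k)" for k
    have "(\<Sum>i<l. W (win N \<sigma> i)) \<le> (\<Sum>i<l. W (win N (\<lambda>k. \<sigma> (k mod l)) i)) + 1 * (L / 2 ^ N)"
    proof -
      have "W (win N \<sigma> i) \<le> W (win N (\<lambda>k. \<sigma> (k mod l)) i) + (if i = l - 1 then L / 2 ^ N else 0)" if i: "i < l" for i
      proof -
        have "W (win N \<sigma> i) \<le> W (win N (\<lambda>k. \<sigma> (k mod l)) i)
          + (if l + (N - 2) - i < N then L / 2 ^ Suc (l + (N - 2) - i) else 0)"
          using i by (intro wrap_single) (auto simp: \<sigma>_def)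
        moreover have "(l + (N - 2) - i < N) = (i = l - 1)" using i N by auto
        moreover have "Suc (l + (N - 2) - i) = N" if "i = l - 1" using that l0 N by simp
        ultimately show ?thesis by (cases "i = l - 1") (simp_all del: power_Suc)
      qed
      then have "(\<Sum>i<l. W (win N \<sigma> i)) \<le> (\<Sum>i<l. W (win N (\<lambda>k. \<sigma> (k mod l)) i) + (if i = l - 1 then L / 2 ^ N else 0))"
        by (intro sum_mono) (simp del: if_split)
      then show ?thesis using l0 by (simp add: sum.distrib)
    qed
    moreover have "(\<Sum>i<N - 1. \<phi> (bval (\<lambda>k. \<sigma> (i + k)))) = (\<Sum>j\<in>{1..<Suc (N - 1)}. lcut \<alpha> p ((1 + q) / 2 ^ j))"
    proof (rule right_points)
      fix i assume i: "i < N - 1"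
      have "bval (\<lambda>k. \<sigma> (i + k)) = bval (\<lambda>k. \<sigma> (i + (N - 2 - i + k))) / 2 ^ (N - 2 - i)"
        using i by (intro bval_replicate_False) (auto simp: \<sigma>_def)
      moreover have "(\<lambda>k. \<sigma> (i + (N - 2 - i + k))) = (\<lambda>k. \<tau> (N - 2 + k))" using i N by (intro ext) (auto simp: \<sigma>_def)
      moreover have "bval (\<lambda>k. \<tau> (N - 2 + k)) = (1 + q) / 2"
      proof -
        have "(\<lambda>k. \<tau> (N - 2 + Suc k)) = (\<lambda>k. \<tau> (N - 1 + k))" using N by (intro ext arg_cong[of _ _ \<tau>]) simp
        then have "bval (\<lambda>k. \<tau> (N - 2 + k)) = (of_bool (\<tau> (N - 2 + 0)) + q) / 2"
          using bval_Suc[of "\<lambda>k. \<tau> (N - 2 + k)"] by (simp only: q_def)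
        then show ?thesis using \<tau>1[of "N - 2"] N by simp
      qed
      moreover have "(2::real) ^ (N - 1 - i) = 2 * 2 ^ (N - 2 - i)"
        using i by (simp flip: power_Suc add: Suc_diff_Suc numeral_2_eq_2)
      ultimately show "bval (\<lambda>k. \<sigma> (i + k)) = (1 + q) / 2 ^ (N - 1 - i)" by (simp only: divide_divide_eq_left)
    qed (use qb in auto)
    moreover have "1 + 0 + real (N - 1) \<le> 5 / 2 * real l" using l N by simp
    moreover have \<sigma>\<tau>: "\<sigma> k = \<tau> k" if "N - 1 \<le> k" for k using that by (auto simp: \<sigma>_def)
    ultimately show False using C0 competitor_False[of \<sigma> 1 0, OF \<sigma>\<tau>] unfolding N1 tau_points by simp
  next
    case C1
    \<comment> \<open>q > 0 forces a one of \<tau> between N and l - 1. The longer cycle carries the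
      cost of 3 + 2 + (N - 1) units.\<close>
    have lN: "N + 1 \<le> l"
    proof (rule ccontr)
      assume "\<not> N + 1 \<le> l"
      have "\<not> \<tau> (N - 1 + k)" for k
        using \<tau>0[of "N - 1 + k"] \<tau>N \<open>\<not> N + 1 \<le> l\<close> by (cases k) auto
      then have "q = 0" by (simp add: q_def bval_const_False)
      then show False using C1 by simp
    qed
    \<comment> \<open>Across the seam the one at N - 3 is seen by the last two windows, in the last
      letter of one and the last but one of the other: 1 + 2 units.\<close>
    define \<sigma> where "\<sigma> k = (N - 3 \<le> k \<and> k \<noteq> N - 2 \<and> \<tau> k)" for k
    have "(\<Sum>i<l. W (win N \<sigma> i)) \<le> (\<Sum>i<l. W (win N (\<lambda>k. \<sigma> (k mod l)) i)) + 3 * (L / 2 ^ N)"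
    proof -
      have "W (win N \<sigma> i) \<le> W (win N (\<lambda>k. \<sigma> (k mod l)) i)
          + ((if i = l - 1 then 2 * (L / 2 ^ N) else 0) + (if i = l - 2 then L / 2 ^ N else 0))" if i: "i < l" for i
      proof -
        have w: "W (win N \<sigma> i) \<le> W (win N (\<lambda>k. \<sigma> (k mod l)) i)
          + (if l + (N - 3) - i < N then L / 2 ^ Suc (l + (N - 3) - i) else 0)"
          using i N by (intro wrap_single) (auto simp: \<sigma>_def)
        consider "i = l - 1" | "i = l - 2" | "i < l - 2" using i by linarith
        then show ?thesis
        proof cases
          case 1
          then have s: "Suc (l + (N - 3) - i) = N - 1" "i \<noteq> l - 2" using lN N by auto
          have "(2::real) ^ N = 2 * 2 ^ (N - 1)" using N by (simp flip: power_Suc)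
          then have "L / 2 ^ Suc (l + (N - 3) - i) = 2 * (L / 2 ^ N)" unfolding s(1) by simp
          moreover note s
          moreover have "l + (N - 3) - i < N" using 1 lN N by auto
          ultimately show ?thesis using w 1 by (simp del: power_Suc)
        next
          case 2
          then have "Suc (l + (N - 3) - i) = N" "i \<noteq> l - 1" "l + (N - 3) - i < N" using lN N by auto
          then show ?thesis using w 2 by (simp del: power_Suc)
        next
          case 3
          then have "\<not> l + (N - 3) - i < N" "i \<noteq> l - 1" "i \<noteq> l - 2" using lN N by auto
          then show ?thesis using w by simp
        qed
      qed
      then have "(\<Sum>i<l. W (win N \<sigma> i)) \<le> (\<Sum>i<l. W (win N (\<lambda>k. \<sigma> (k mod l)) i)
         + ((if i = l - 1 then 2 * (L / 2 ^ N) else 0) + (if i = l - 2 then L / 2 ^ N else 0)))"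
        by (intro sum_mono) (simp del: if_split)
      then show ?thesis using l0 by (simp add: sum.distrib)
    qed
    moreover have "(\<Sum>i<N - 1. \<phi> (bval (\<lambda>k. \<sigma> (i + k)))) = (\<Sum>j\<in>{1..<N - 1}. lcut \<alpha> p ((1 + q / 2) / 2 ^ j)) + lcut \<alpha> p (q / 2)"
    proof -
      have b2: "bval (\<lambda>k. \<sigma> (N - 2 + k)) = q / 2"
      proof -
        have "N - 2 + Suc k = N - 1 + k" for k using N by simp
        moreover have "\<sigma> (N - 1 + k) = \<tau> (N - 1 + k)" for k using N by (auto simp: \<sigma>_def)
        ultimately have "(\<lambda>k. \<sigma> (N - 2 + Suc k)) = (\<lambda>k. \<tau> (N - 1 + k))" by (simp only:)
        then have "bval (\<lambda>k. \<sigma> (N - 2 + k)) = (of_bool (\<sigma> (N - 2 + 0)) + q) / 2"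
          using bval_Suc[of "\<lambda>k. \<sigma> (N - 2 + k)"] by (simp only: q_def)
        then show ?thesis by (simp add: \<sigma>_def)
      qed
      have b3: "bval (\<lambda>k. \<sigma> (N - 3 + k)) = (1 + q / 2) / 2"
      proof -
        have "N - 3 + Suc k = N - 2 + k" for k using N by simp
        then have "bval (\<lambda>k. \<sigma> (N - 3 + k)) = (of_bool (\<sigma> (N - 3 + 0)) + q / 2) / 2"
          using bval_Suc[of "\<lambda>k. \<sigma> (N - 3 + k)"] b2 by (simp only:)
        moreover have "\<sigma> (N - 3)" using N \<tau>1[of "N - 3"] by (simp add: \<sigma>_def)
        ultimately show ?thesis by simp
      qed
      have "(\<Sum>i<N - 2. \<phi> (bval (\<lambda>k. \<sigma> (i + k)))) = (\<Sum>j\<in>{1..<Suc (N - 2)}. lcut \<alpha> p ((1 + q / 2) / 2 ^ j))"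
      proof (rule right_points)
        fix i assume i: "i < N - 2"
        have "bval (\<lambda>k. \<sigma> (i + k)) = bval (\<lambda>k. \<sigma> (i + (N - 3 - i + k))) / 2 ^ (N - 3 - i)"
          using i by (intro bval_replicate_False) (auto simp: \<sigma>_def)
        moreover have "(\<lambda>k. \<sigma> (i + (N - 3 - i + k))) = (\<lambda>k. \<sigma> (N - 3 + k))"
          using i by (intro ext arg_cong[of _ _ \<sigma>]) simp
        moreover have "(2::real) ^ (N - 2 - i) = 2 * 2 ^ (N - 3 - i)"
          using i by (simp flip: power_Suc add: Suc_diff_Suc numeral_eq_Suc)
        ultimately show "bval (\<lambda>k. \<sigma> (i + k)) = (1 + q / 2) / 2 ^ (N - 2 - i)" using b3 by (simp only: divide_divide_eq_left)
      qed (use qb in auto)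
      moreover have "(\<Sum>i<Suc (N - 2). \<phi> (bval (\<lambda>k. \<sigma> (i + k)))) = (\<Sum>i<N - 2. \<phi> (bval (\<lambda>k. \<sigma> (i + k)))) + \<phi> (q / 2)"
        by (simp only: sum.lessThan_Suc b2)
      moreover have "Suc (N - 2) = N - 1" using N by simp
      moreover have "\<phi> (q / 2) = lcut \<alpha> p (q / 2)" using qb by (intro phi_left_end) auto
      ultimately show ?thesis by simp
    qed
    moreover have "3 + 2 + real (N - 1) \<le> 5 / 2 * real l" using lN N by simp
    moreover have \<sigma>\<tau>: "\<sigma> k = \<tau> k" if "N - 1 \<le> k" for k using that N by (auto simp: \<sigma>_def)
    ultimately show False using C1 competitor_False[of \<sigma> 3 2, OF \<sigma>\<tau>] unfolding tau_points by simp
  qed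
qed

end

text \<open>If the node is left as 0...0 and entered as 1...1, the closing carry moves windows to
  the right, as \<open>W_up\<close> permits. In the opposite orientation it moves them to the left,
  which is harmless without a jump; with a jump the comparison of whole departures takes
  over.\<close>

lemma no_mixed_right:
  assumes \<tau>0: "\<And>k. k < N - 1 \<Longrightarrow> \<tau> k = a" and \<tau>1: "\<And>k. l \<le> k \<Longrightarrow> \<tau> k = (\<not> a)" and l: "N - 1 \<le> l"
    and first: "\<tau> (N - 1) = (\<not> a)" and last: "\<tau> (l - 1) = a"
    and opt: "\<And>s. (\<And>k. s (k + l) = s k) \<Longrightarrow>
      (\<Sum>i<l. W (win N s i)) \<le> (\<Sum>i<l. W (win N \<tau> i)) - real l * g"
    and g: "5 / 2 * L / 2 ^ N < g"
  shows False
proof (cases a)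
  case False
  show False
  proof (rule no_mixed_flip[of N L W \<tau> l g])
    show "W \<omega> \<le> W \<omega>' + L * (word_val \<omega>' - word_val \<omega>)"
      if "length \<omega> = N" "length \<omega>' = N" "word_val \<omega> \<le> word_val \<omega>'" for \<omega> \<omega>'
      using that by (intro W_up) auto
  qed (use assms False N L_nonneg in auto)
next
  case True
  show False
  proof (cases "lcut \<alpha> p (- e) < lcut \<alpha> p e")
    case jump: True
    show False by (rule no_mixed_departure[of \<tau> l g]) (use assms True jump in auto)
  next
    case False
    define W' where "W' \<omega> = W (map Not \<omega>)" for \<omega>
    define \<tau>' where "\<tau>' k = (\<not> \<tau> k)" for k
    have conv: "W' (win N s i) = W (win N (\<lambda>k. \<not> s k) i)" for s i by (simp add: W'_def map_Not_win)
    have t': "W' (win N \<tau>' i) = W (win N \<tau> i)" for i by (simp add: conv \<tau>'_def)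
    show False
    proof (rule no_mixed_flip[of N L W' \<tau>' l g])
      show "W' \<omega> \<le> W' \<omega>' + L * (word_val \<omega>' - word_val \<omega>)"
        if "length \<omega> = N" "length \<omega>' = N" "word_val \<omega> \<le> word_val \<omega>'" for \<omega> \<omega>'
        using that W_down_no_jump[of "map Not \<omega>" "map Not \<omega>'"] False by (simp add: W'_def word_val_map_Not)
      show "(\<Sum>i<l. W' (win N s i)) \<le> (\<Sum>i<l. W' (win N \<tau>' i)) - real l * g"
        if "\<And>k. s (k + l) = s k" for s
        using opt[of "\<lambda>k. \<not> s k"] that unfolding t' unfolding conv by simp
    qed (use assms True N L_nonneg in \<open>auto simp: \<tau>'_def\<close>)
  qed
qed

text \<open>Only the last letter changes. A move to the right is covered by \<open>W_up\<close>; a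
  move to the left occurs only for words whose cylinders lie left of 1 - e.\<close>

lemma neighbour_weights_right:
  "W ((\<not> a) # replicate (N - 1) a) \<le> W ((\<not> a) # replicate (N - 2) a @ [\<not> a]) + L / 2 ^ N" (is ?A)
  "W (replicate (N - 1) a @ [\<not> a]) \<le> W (replicate N a) + L / 2 ^ N" (is ?B)
proof -
  define n where "n = N - 2"
  have n: "N = Suc (Suc n)" "N - 1 = Suc n" "N - 2 = n" "2 \<le> n" using N by (auto simp: n_def)
  have r: "replicate (Suc n) a = replicate n a @ [a]" by (simp add: replicate_append_same)
  have pn: "(1::real) / 2 ^ n \<le> 1 / 4"
  proof -
    have "(2::real) ^ 2 \<le> 2 ^ n" using n by (intro power_increasing) auto
    then show ?thesis by (simp add: field_simps)
  qed
  let ?u = "(\<not> a) # replicate n a"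
  have vA: "word_val ((\<not> a) # replicate (Suc n) a) = word_val ?u + of_bool a / 2 ^ N"
    "word_val ((\<not> a) # replicate n a @ [\<not> a]) = word_val ?u + of_bool (\<not> a) / 2 ^ N"
    unfolding r using word_val_append[of ?u "[a]"] word_val_append[of ?u "[\<not> a]"] by (simp_all add: word_val_Cons n)
  show ?A
  proof (cases a)
    case False
    then show ?thesis using W_up[of "(\<not> a) # replicate (Suc n) a" "(\<not> a) # replicate n a @ [\<not> a]"] vA n by simp
  next
    case True
    have "word_val ((\<not> a) # replicate (Suc n) a) + 1 / 2 ^ N \<le> 1 / 2"
    proof -
      have "(word_val (replicate (Suc n) a) + 1 / 2 ^ Suc n) / 2 \<le> 1 / 2"
        using word_val_bounds(2)[of "replicate (Suc n) a"] by (intro divide_right_mono) auto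
      moreover have "(1::real) / 2 ^ N = (1 / 2 ^ Suc n) / 2" by (simp add: n)
      ultimately show ?thesis using True by (simp only: word_val_Cons add_divide_distrib) simp
    qed
    then have "W ((\<not> a) # replicate (Suc n) a) \<le> W ((\<not> a) # replicate n a @ [\<not> a])
       + L * (word_val ((\<not> a) # replicate (Suc n) a) - word_val ((\<not> a) # replicate n a @ [\<not> a]))"
      using vA e_bounds True n by (intro W_down_left) auto
    then show ?thesis using True vA n by simp
  qed
  have vB: "word_val (replicate (Suc n) a @ [\<not> a]) = word_val (replicate (Suc n) a) + of_bool (\<not> a) / 2 ^ N"
    "word_val (replicate (Suc n) a @ [a]) = word_val (replicate (Suc n) a) + of_bool a / 2 ^ N"
    by (simp_all add: word_val_append word_val_Cons n)
  have rN: "replicate N a = replicate (Suc n) a @ [a]" by (simp add: n replicate_append_same)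
  show ?B unfolding rN n(2)
  proof (cases a)
    case True
    then show "W (replicate (Suc n) a @ [\<not> a]) \<le> W (replicate (Suc n) a @ [a]) + L / 2 ^ N"
      using W_up[of "replicate (Suc n) a @ [\<not> a]" "replicate (Suc n) a @ [a]"] vB by simp
  next
    case False
    have "word_val (replicate (Suc n) a @ [\<not> a]) + 1 / 2 ^ N = 2 / 2 ^ N"
      using False vB word_val_replicate_False[of "Suc n"] by simp
    also have "(2::real) / 2 ^ N = (1 / 2 ^ n) / 2" by (simp add: n)
    also have "\<dots> \<le> (1 / 4) / 2" by (rule divide_right_mono[OF pn]) simp
    also have "\<dots> \<le> 1 - e" using e_bounds by simp
    finally have "W (replicate (Suc n) a @ [\<not> a]) \<le> W (replicate (Suc n) a @ [a])
      + L * (word_val (replicate (Suc n) a @ [\<not> a]) - word_val (replicate (Suc n) a @ [a]))"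
      using vB False by (intro W_down_left) (auto simp: n)
    then show "W (replicate (Suc n) a @ [\<not> a]) \<le> W (replicate (Suc n) a @ [a]) + L / 2 ^ N" using False vB by simp
  qed
qed

end

section \<open>Walks in quotient de Bruijn graphs\<close>

definition constw :: "bool list \<Rightarrow> bool" where
  "constw u \<longleftrightarrow> (\<exists>a. u = replicate (length u) a)"

lemma constw_iff: "constw u \<longleftrightarrow> u \<in> {replicate (length u) False, replicate (length u) True}"
  by (auto simp: constw_def ex_bool_eq)

lemma glue_eq: "glue u = (if constw u then {replicate (length u) False, replicate (length u) True} else {u})"
  by (simp add: glue_def Let_def constw_iff)

lemma constw_replicate [simp]: "constw (replicate n a)"
  by (auto simp: constw_def)

lemma glue_self: "u \<in> glue u"
  by (auto simp: glue_eq constw_iff)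

lemma glue_mem: "v \<in> glue u \<Longrightarrow> glue v = glue u" "v \<in> glue u \<Longrightarrow> length v = length u"
  unfolding glue_eq by (auto split: if_splits)

lemma glue_eq_iff:
  "glue u = glue v \<longleftrightarrow> u = v \<or> constw u \<and> constw v \<and> length u = length v"
proof
  assume eq: "glue u = glue v"
  then have "u \<in> glue v" "v \<in> glue u" using glue_self[of u] glue_self[of v] by simp_all
  then show "u = v \<or> constw u \<and> constw v \<and> length u = length v"
    by (cases "constw u"; cases "constw v") (auto simp: glue_eq)
qed (auto simp: glue_eq)

lemma butlast_replicate_bool: "butlast (replicate n (a::bool)) = replicate (n - 1) a"
  by (cases n) (auto simp flip: replicate_append_same)

lemma constw_butlast: "constw u \<Longrightarrow> constw (butlast u)"
  by (metis butlast_replicate_bool constw_def constw_replicate)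

lemma constw_tl: "constw u \<Longrightarrow> constw (tl u)"
  by (metis tl_replicate constw_def constw_replicate)

lemma glue_butlast: "v \<in> glue u \<Longrightarrow> glue (butlast v) = glue (butlast u)"
  unfolding glue_eq_iff by (auto simp: glue_eq constw_butlast split: if_splits)

lemma glue_tl: "v \<in> glue u \<Longrightarrow> glue (tl v) = glue (tl u)"
  unfolding glue_eq_iff by (auto simp: glue_eq constw_tl split: if_splits)

abbreviation "QB \<equiv> quotient_de_bruijn"

lemma tail_glue: "tail (QB N) (glue u) = glue (butlast u)"
proof -
  have "(\<Union>v\<in>glue u. glue (butlast v)) = (\<Union>v\<in>glue u. glue (butlast u))"
    by (intro SUP_cong refl glue_butlast)
  then show ?thesis using glue_self[of u] by (auto simp: quotient_de_bruijn_def)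
qed

lemma head_glue: "head (QB N) (glue u) = glue (tl u)"
proof -
  have "(\<Union>v\<in>glue u. glue (tl v)) = (\<Union>v\<in>glue u. glue (tl u))"
    by (intro SUP_cong refl glue_tl)
  then show ?thesis using glue_self[of u] by (auto simp: quotient_de_bruijn_def)
qed

lemma arcs_QB: "arcs (QB N) = glue ` words N" and verts_QB: "verts (QB N) = glue ` words (N - 1)"
  by (simp_all add: quotient_de_bruijn_def)

lemma finite_words: "finite (words n)"
  using finite_lists_length_eq[of "UNIV :: bool set" n] by (simp add: words_def)

lemma fin_digraph_QB: "fin_digraph (QB N)"
proof
  fix e assume "e \<in> arcs (QB N)"
  then obtain u where "u \<in> words N" "e = glue u" by (auto simp: arcs_QB)
  then show "tail (QB N) e \<in> verts (QB N)" "head (QB N) e \<in> verts (QB N)"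
    unfolding verts_QB by (auto simp: tail_glue head_glue words_def)
qed (simp_all add: arcs_QB verts_QB finite_words)

text \<open>The glued loop is the only one: the two halves \<open>butlast u\<close> and
  \<open>tl u\<close> overlap, so if both are constant they have the same letter as soon as the
  length is 3.\<close>

lemma loop_constw:
  assumes "3 \<le> length u" "glue (butlast u) = glue (tl u)"
  shows "constw u"
proof -
  define n where "n = length u"
  have n: "3 \<le> n" using assms by (simp add: n_def)
  have bt: "butlast u ! i = u ! i" "tl u ! i = u ! Suc i" if "i < n - 1" for i
    using that by (auto simp: n_def nth_butlast nth_tl)
  have "u ! i = u ! Suc i" if i: "i < n - 1" for i
  proof -
    from assms(2) consider "butlast u = tl u" | "constw (butlast u)" "constw (tl u)"
      unfolding glue_eq_iff by blast
    then show ?thesis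
    proof cases
      case 1 then show ?thesis using bt[OF i] by simp
    next
      case 2
      obtain a where "butlast u = replicate (n - 1) a" using 2(1) by (auto simp: constw_def n_def)
      then have a: "u ! j = a" if "j < n - 1" for j using bt(1)[OF that] that by simp
      obtain b where "tl u = replicate (n - 1) b" using 2(2) by (auto simp: constw_def n_def)
      then have b: "u ! Suc j = b" if "j < n - 1" for j using bt(2)[OF that] that by simp
      have "a = b" using a[of 1] b[of 0] n by simp
      then show ?thesis using a[OF i] b[OF i] by simp
    qed
  qed
  then have "u ! i = u ! 0" if "i < n" for i
    using that by (induction i) auto
  then have "u = replicate n (u ! 0)" by (intro nth_equalityI) (auto simp: n_def)
  then show ?thesis by (auto simp: constw_def n_def)
qed

section \<open>Removing cycles from walks\<close>

lemma (in pre_digraph) awalk_verts_closed_distinct: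
  assumes "awalk u p u" "distinct (tl (awalk_verts u p))" "p \<noteq> []"
  shows "distinct (map (tail G) p)"
proof -
  obtain e es where p: "p = e # es" using assms(3) by (cases p) auto
  have "u = tail G e" using assms(1) p by (simp add: awalk_def)
  moreover have "head G (last p) = u"
  proof -
    have "cas u p u" using assms(1) by (simp add: awalk_def)
    then have "cas v p w \<Longrightarrow> p \<noteq> [] \<Longrightarrow> head G (last p) = w" for v w p
      by (induction p arbitrary: v) (auto split: if_splits)
    then show ?thesis using assms(3) \<open>cas u p u\<close> by blast
  qed
  ultimately show ?thesis using assms(2) p by (simp add: awalk_verts_conv)
qed

text \<open>Loop erasure from the front: prepending an edge to a path closes at most one simple
  cycle. It consists of edges of p, hence is not \<gamma>, and cutting it off releases at least g
  per edge.\<close>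

lemma (in wf_digraph) walk_remove_cycles:
  fixes w :: "'b \<Rightarrow> real" and g :: real
  assumes cyc: "\<And>c. cycle c \<Longrightarrow> set c \<noteq> \<gamma> \<Longrightarrow> sum_list (map w c) \<le> - g * length c"
    and "awalk u p v" "\<not> \<gamma> \<subseteq> set p"
  shows "\<exists>q. apath u q v \<and> set q \<subseteq> set p \<and> length q \<le> length p \<and>
    sum_list (map w p) \<le> sum_list (map w q) - g * (real (length p) - real (length q))"
  using assms(2,3)
proof (induction p arbitrary: u)
  case Nil
  then show ?case by (intro exI[of _ "[]"]) (auto simp: awalk_Nil_iff apath_Nil_iff)
next
  case (Cons e p)
  then have e: "e \<in> arcs G" "u = tail G e" "awalk (head G e) p v" "\<not> \<gamma> \<subseteq> set p"
    by (auto simp: awalk_Cons_iff)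
  from Cons.IH[OF e(3,4)] obtain q where q: "apath (head G e) q v" "set q \<subseteq> set p" "length q \<le> length p"
    "sum_list (map w p) \<le> sum_list (map w q) - g * (real (length p) - real (length q))" by blast
  show ?case
  proof (cases "u \<in> set (awalk_verts (head G e) q)")
    case False
    then have "apath u (e # q) v" using q(1) e by (simp add: apath_Cons_iff)
    then show ?thesis using q by (intro exI[of _ "e # q"]) auto
  next
    case True
    have aw: "awalk (head G e) q v" using q(1) by (simp add: apath_def)
    obtain q1 q2 where s: "q = q1 @ q2" "awalk (head G e) q1 u" "awalk u q2 v"
      using awalk_decomp[OF aw True] by blast
    have d: "distinct (awalk_verts (head G e) (q1 @ q2))" using q(1) s by (simp add: apath_def)
    have d12: "distinct (awalk_verts (head G e) q1)" "distinct (awalk_verts u q2)"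
      using apath_append_iff[of "head G e" q1 q2 v] q(1) s awlast_of_awalk[OF s(2)] by (auto simp: apath_def)
    have "cycle (e # q1)"
      unfolding cycle_def
      using e s(2) d12(1) by (intro exI[of _ u]) (auto simp: awalk_Cons_iff)
    moreover have "set (e # q1) \<noteq> \<gamma>" using Cons.prems(2) q(2) s(1) by auto
    ultimately have c: "sum_list (map w (e # q1)) \<le> - g * length (e # q1)" by (rule cyc)
    have "apath u q2 v" using s(3) d12(2) by (simp add: apath_def)
    moreover have "sum_list (map w (e # p)) \<le> sum_list (map w q2) - g * (real (length (e # p)) - real (length q2))"
      using c q(4) s(1) by (simp add: algebra_simps)
    ultimately show ?thesis using q(2,3) s(1) by (intro exI[of _ q2]) auto
  qed
qed

lemma awalk_windows:
  assumes "2 \<le> N"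
  shows "pre_digraph.awalk (QB N) (glue (win (N - 1) s i)) (map (\<lambda>j. glue (win N s j)) [i..<i + n]) (glue (win (N - 1) s (i + n)))"
proof -
  interpret fin_digraph "QB N" by (rule fin_digraph_QB)
  show ?thesis
  proof (induction n arbitrary: i)
    case 0 then show ?case by (auto simp: awalk_Nil_iff verts_QB words_def)
  next
    case (Suc n)
    have "[i..<i + Suc n] = i # [Suc i..<Suc i + n]" by (simp add: upt_rec)
    then show ?case using Suc[of "Suc i"]
      by (auto simp: awalk_Cons_iff arcs_QB words_def tail_glue head_glue butlast_win tl_win)
  qed
qed

section \<open>Weights of walks that miss an edge of the maximal cycle\<close>

locale unique_max_cycle =
  fixes N :: nat and W :: "bool list \<Rightarrow> real" and wt :: "bool list set \<Rightarrow> real" and M g :: real and \<gamma> :: "bool list set set"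
  assumes N: "2 \<le> N" and wt: "\<And>\<omega>. length \<omega> = N \<Longrightarrow> wt (glue \<omega>) = W \<omega>"
    and \<gamma>: "\<gamma> \<in> simple_cycles N" and \<gamma>_mean: "(\<Sum>e\<in>\<gamma>. wt e) = real (card \<gamma>) * M"
    and other: "\<And>C. C \<in> simple_cycles N \<Longrightarrow> C \<noteq> \<gamma> \<Longrightarrow> (\<Sum>e\<in>C. wt e) \<le> real (card C) * (M - g)"
begin

sublocale fin_digraph "QB N" by (rule fin_digraph_QB)

abbreviation "Z \<equiv> glue (replicate N True)"

lemma cycle_weight:
  assumes "cycle c" "set c \<noteq> \<gamma>"
  shows "sum_list (map (\<lambda>e. wt e - M) c) \<le> - g * length c"
proof -
  have d: "distinct c" using assms(1) by (auto simp: cycle_conv)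
  have "set c \<in> simple_cycles N" using assms(1) by (auto simp: simple_cycles_def)
  then have "(\<Sum>e\<in>set c. wt e) \<le> real (length c) * (M - g)"
    using other assms(2) d by (metis distinct_card)
  moreover have "sum_list (map (\<lambda>e. wt e - M) c) = (\<Sum>e\<in>set c. wt e) - real (length c) * M"
    using d by (simp add: sum_list_distinct_conv_sum_set sum_subtractf distinct_card)
  ultimately show ?thesis by (simp add: algebra_simps)
qed

text \<open>Erasing all cycles from a closed walk leaves the empty path, so every single edge has
  paid g.\<close>

lemma closed_walk_weight:
  assumes "awalk u p u" "\<not> \<gamma> \<subseteq> set p"
  shows "sum_list (map wt p) \<le> real (length p) * (M - g)"
proof -
  from walk_remove_cycles[OF cycle_weight assms] obtain q where
    q: "apath u q u" "sum_list (map (\<lambda>e. wt e - M) p) \<le> sum_list (map (\<lambda>e. wt e - M) q) - g * (real (length p) - real (length q))"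
    by blast
  have "q = []" using apath_nonempty_ends[of u q u] q(1) by blast
  moreover have "sum_list (map (\<lambda>e. wt e - M) p) = sum_list (map wt p) - real (length p) * M"
    by (induction p) (auto simp: algebra_simps)
  ultimately show ?thesis using q(2) by (simp add: algebra_simps)
qed

lemma walk_weight:
  "\<exists>K. \<forall>u p v. awalk u p v \<longrightarrow> \<not> \<gamma> \<subseteq> set p \<longrightarrow> sum_list (map wt p) \<le> K + real (length p) * (M - g)"
proof -
  \<comment> \<open>B bounds one edge of the path that remains, together with the g refunded for it;
    the path has at most as many edges as the graph has nodes.\<close>
  define B where "B = Max (insert 0 ((\<lambda>e. \<bar>wt e - M\<bar>) ` arcs (QB N))) + \<bar>g\<bar>"
  have B: "\<bar>wt e - M\<bar> + \<bar>g\<bar> \<le> B" if "e \<in> arcs (QB N)" for e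
    unfolding B_def using that finite_arcs by (intro add_right_mono Max_ge) auto
  have B0: "0 \<le> B" unfolding B_def using finite_arcs by (intro add_nonneg_nonneg Max_ge) auto
  have "sum_list (map wt p) \<le> B * card (verts (QB N)) + real (length p) * (M - g)"
    if p: "awalk u p v" "\<not> \<gamma> \<subseteq> set p" for u p v
  proof -
    from walk_remove_cycles[OF cycle_weight p] obtain q where
      q: "apath u q v" "set q \<subseteq> set p" "sum_list (map (\<lambda>e. wt e - M) p) \<le> sum_list (map (\<lambda>e. wt e - M) q) - g * (real (length p) - real (length q))"
      by blast
    have "set q \<subseteq> arcs (QB N)" using q(1) by (auto simp: apath_def awalk_def)
    then have "sum_list (map (\<lambda>e. wt e - M) q) + g * real (length q) \<le> B * real (length q)"
    proof (induction q)
      case (Cons e q)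
      then show ?case using B[of e] by (simp add: algebra_simps)
    qed simp
    also have "\<dots> \<le> B * card (verts (QB N))" using length_apath[OF q(1)] B0 by (intro mult_left_mono) auto
    moreover have "sum_list (map (\<lambda>e. wt e - M) p) = sum_list (map wt p) - real (length p) * M"
      by (induction p) (auto simp: algebra_simps)
    ultimately show ?thesis using q(3) by (simp add: algebra_simps)
  qed
  then show ?thesis by blast
qed

lemma sum_list_windows: "sum_list (map wt (map (\<lambda>j. glue (win N s j)) [i..<j])) = (\<Sum>k\<in>{i..<j}. W (win N s k))"
  by (simp add: interv_sum_list_conv_sum_set_nat wt o_def)

lemma periodic_weight:
  assumes "\<And>k. s (k + n) = s k" "\<not> \<gamma> \<subseteq> (\<lambda>i. glue (win N s i)) ` {..<n}"
  shows "(\<Sum>i<n. W (win N s i)) \<le> real n * (M - g)"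
proof -
  have "win (N - 1) s (0 + n) = win (N - 1) s 0" using assms(1) by (intro win_eqI) (simp add: add.commute)
  then have "awalk (glue (win (N - 1) s 0)) (map (\<lambda>j. glue (win N s j)) [0..<0 + n]) (glue (win (N - 1) s 0))"
    using awalk_windows[of N s 0 n] N by simp
  from closed_walk_weight[OF this] assms(2) show ?thesis
    using sum_list_windows[of s 0 n] by (simp add: lessThan_atLeast0)
qed

text \<open>Enumerating the edges periodically over all naturals makes the closing edge an ordinary
  one and lets the starting point be moved freely.\<close>

lemma cycle_enum:
  obtains E :: "nat \<Rightarrow> bool list set" and l :: nat where "0 < l" "\<gamma> = E ` {..<l}" "inj_on (\<lambda>k. tail (QB N) (E k)) {..<l}"
    "\<And>k. E (k + l) = E k" "\<And>k. tail (QB N) (E (Suc k)) = head (QB N) (E k)" "\<And>k. E k \<in> arcs (QB N)"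
proof -
  from \<gamma> obtain c where c: "\<gamma> = set c" "cycle c" by (auto simp: simple_cycles_def)
  then obtain u where u: "awalk u c u" "distinct (tl (awalk_verts u c))" "c \<noteq> []" by (auto simp: cycle_def)
  define l where "l = length c"
  define E where "E k = c ! (k mod l)" for k
  have l: "0 < l" using u by (simp add: l_def)
  have d: "distinct (map (tail (QB N)) c)" by (rule awalk_verts_closed_distinct[OF u])
  have conn: "cas v p w \<Longrightarrow> Suc i < length p \<Longrightarrow> tail (QB N) (p ! Suc i) = head (QB N) (p ! i)" for v w p i
  proof (induction p arbitrary: v i)
    case (Cons e p) then show ?case by (cases i; cases p) auto
  qed simp
  have ends: "cas v p w \<Longrightarrow> p \<noteq> [] \<Longrightarrow> tail (QB N) (hd p) = v \<and> head (QB N) (last p) = w" for v w p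
    by (induction p arbitrary: v) auto
  have cas: "cas u c u" using u(1) by (simp add: awalk_def)
  show thesis
  proof
    show "0 < l" by (rule l)
    show "\<gamma> = E ` {..<l}" using l unfolding c(1) by (auto simp: E_def l_def set_conv_nth intro!: image_eqI)
    show "inj_on (\<lambda>k. tail (QB N) (E k)) {..<l}"
      using d by (auto simp: inj_on_def E_def l_def distinct_conv_nth)
    show "E (k + l) = E k" for k by (simp add: E_def)
    show "E k \<in> arcs (QB N)" for k
    proof -
      have "set c \<subseteq> arcs (QB N)" using u(1) by (simp add: awalk_def)
      moreover have "k mod l < length c" using l by (simp add: l_def)
      ultimately show ?thesis unfolding E_def using nth_mem by blast
    qed
    show "tail (QB N) (E (Suc k)) = head (QB N) (E k)" for k
    proof (cases "Suc (k mod l) = l")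
      case True
      then have "Suc k mod l = 0" "k mod l = length c - 1" by (simp_all add: mod_Suc l_def)
      then show ?thesis using ends[OF cas u(3)] u(3)
        by (simp add: E_def hd_conv_nth last_conv_nth)
    next
      case False
      then have "Suc (k mod l) < length c" "Suc k mod l = Suc (k mod l)"
        using mod_less_divisor[OF l, of k] by (auto simp: mod_Suc l_def)
      then show ?thesis using conn[OF cas] by (simp add: E_def)
    qed
  qed
qed

end

section \<open>Periodic enumerations and the letters they spell\<close>

lemma periodic_add_mult: "(\<And>k. f (k + l) = f k) \<Longrightarrow> f (k + n * l) = f (k::nat)"
  by (induction n) (simp_all add: add.assoc[symmetric] add.commute[of l])

lemma periodic_mod:
  assumes "\<And>k. f (k + l) = f (k::nat)" shows "f (k mod l) = f k"
  using periodic_add_mult[of f l "k mod l" "k div l", OF assms] by simp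

lemma periodic_range:
  assumes "0 < l" "\<And>k. f (k + l) = f (k::nat)" shows "range f = f ` {..<l}"
proof
  show "range f \<subseteq> f ` {..<l}"
  proof
    fix x assume "x \<in> range f"
    then obtain k where "x = f k" by blast
    then have "x = f (k mod l)" using periodic_mod[of f l, OF assms(2)] by simp
    then show "x \<in> f ` {..<l}" using assms(1) by auto
  qed
qed auto

lemma periodic_range_shift:
  assumes "0 < l" "\<And>k. f (k + l) = f (k::nat)" shows "range (\<lambda>k. f (k + j)) = range f"
proof
  show "range f \<subseteq> range (\<lambda>k. f (k + j))"
  proof
    fix x assume "x \<in> range f"
    then obtain k where "x = f k" by blast
    then have "x = f (k + j * l)" using periodic_add_mult[of f l, OF assms(2)] by simp
    moreover have "j \<le> k + j * l" using assms(1) by (simp add: trans_le_add2)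
    ultimately have "x = f ((k + j * l - j) + j)" by simp
    then show "x \<in> range (\<lambda>k. f (k + j))" by blast
  qed
qed auto

text \<open>Consecutive words overlap in N - 1 letters, so letter i of a word is the first letter of
  the word i steps later.\<close>

lemma overlap_win:
  assumes "\<And>k. length (v k) = N" "\<And>k. butlast (v (Suc k)) = tl (v k)" "0 < N"
  shows "v k = win N (\<lambda>k. hd (v k)) k"
proof (rule nth_equalityI)
  have "v k ! i = hd (v (k + i))" if "i < N" for i k using that
  proof (induction i arbitrary: k)
    case 0 then show ?case using assms(1)[of k] by (cases "v k") auto
  next
    case (Suc i)
    have "v k ! Suc i = tl (v k) ! i" using Suc.prems assms(1)[of k] by (simp add: nth_tl)
    also have "\<dots> = butlast (v (Suc k)) ! i" by (simp add: assms(2))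
    also have "\<dots> = v (Suc k) ! i" using Suc.prems assms(1)[of "Suc k"] by (simp add: nth_butlast)
    also have "\<dots> = hd (v (Suc k + i))" using Suc by auto
    finally show ?case by simp
  qed
  then show "v k ! i = win N (\<lambda>k. hd (v k)) k ! i" if "i < length (v k)" for i
    using that assms(1) by (simp add: nth_win)
qed (simp add: assms(1))

text \<open>Beyond the last word the missing letters are supplied by its constant tail.\<close>

lemma overlap_win_finite:
  assumes "\<And>k. length (v k) = N" "\<And>k. Suc k < l \<Longrightarrow> butlast (v (Suc k)) = tl (v k)" "0 < N"
    and "tl (v (l - 1)) = replicate (N - 1) b" and "k < l"
  shows "v k = win N (\<lambda>k. if k < l then hd (v k) else b) k"
proof (rule nth_equalityI)
  have "v k ! i = (if k + i < l then hd (v (k + i)) else b)" if "i < N" "k < l" for i k using that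
  proof (induction i arbitrary: k)
    case 0 then show ?case using assms(1)[of k] by (cases "v k") auto
  next
    case (Suc i)
    have t: "v k ! Suc i = tl (v k) ! i" using Suc.prems assms(1)[of k] by (simp add: nth_tl)
    show ?case
    proof (cases "Suc k < l")
      case True
      note t
      also have "tl (v k) ! i = butlast (v (Suc k)) ! i" using True by (simp add: assms(2))
      also have "\<dots> = v (Suc k) ! i" using Suc.prems assms(1)[of "Suc k"] by (simp add: nth_butlast)
      also have "\<dots> = (if Suc k + i < l then hd (v (Suc k + i)) else b)" using Suc True by auto
      finally show ?thesis by simp
    next
      case False
      then have "k = l - 1" using Suc.prems by simp
      then show ?thesis using t assms(4) Suc.prems by simp
    qed
  qed
  then show "v k ! i = win N (\<lambda>k. if k < l then hd (v k) else b) k ! i" if "i < length (v k)" for i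
    using that assms(1,5) by (simp add: nth_win)
qed (simp add: assms(1))

lemma constwE: assumes "constw u" obtains a where "u = replicate (length u) a"
  using assms by (auto simp: constw_def)

context unique_max_cycle
begin

lemma gamma_enum:
  obtains E :: "nat \<Rightarrow> bool list set" and l :: nat where "0 < l" "\<gamma> = range E" "card \<gamma> = l"
    "\<And>i j. tail (QB N) (E i) = tail (QB N) (E j) \<Longrightarrow> i mod l = j mod l"
    "\<And>k. E (k + l) = E k" "\<And>k. tail (QB N) (E (Suc k)) = head (QB N) (E k)" "\<And>k. E k \<in> arcs (QB N)"
proof -
  obtain E :: "nat \<Rightarrow> bool list set" and l where
    E: "0 < l" "\<gamma> = E ` {..<l}" "inj_on (\<lambda>k. tail (QB N) (E k)) {..<l}" "\<And>k. E (k + l) = E k"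
    "\<And>k. tail (QB N) (E (Suc k)) = head (QB N) (E k)" "\<And>k. E k \<in> arcs (QB N)" by (rule cycle_enum, rule that)
  show thesis
  proof
    show "\<gamma> = range E" using E(2) periodic_range[OF E(1), of E] E(4) by simp
    show "card \<gamma> = l"
    proof -
      have "inj_on E {..<l}" using E(3) by (auto simp: inj_on_def)
      then show ?thesis by (simp add: E(2) card_image)
    qed
    fix i j assume eq: "tail (QB N) (E i) = tail (QB N) (E j)"
    have "E (i mod l) = E i" "E (j mod l) = E j" using periodic_mod[of E l, OF E(4)] by simp_all
    then have "tail (QB N) (E (i mod l)) = tail (QB N) (E (j mod l))" using eq by simp
    then show "i mod l = j mod l" using E(1) by (intro inj_onD[OF E(3)]) auto
  qed (use E in auto)
qed

lemma gamma_words: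
  assumes "\<gamma> \<noteq> {Z}"
  obtains v :: "nat \<Rightarrow> bool list" and l :: nat where "0 < l" "\<gamma> = range (\<lambda>k. glue (v k))" "card \<gamma> = l"
    "\<And>i j. glue (butlast (v i)) = glue (butlast (v j)) \<Longrightarrow> i mod l = j mod l"
    "\<And>k. v (k + l) = v k" "\<And>k. glue (butlast (v (Suc k))) = glue (tl (v k))"
    "\<And>k. length (v k) = N" "\<And>k. \<not> constw (v k)"
proof -
  obtain E :: "nat \<Rightarrow> bool list set" and l where
    E: "0 < l" "\<gamma> = range E" "card \<gamma> = l"
    "\<And>i j. tail (QB N) (E i) = tail (QB N) (E j) \<Longrightarrow> i mod l = j mod l"
    "\<And>k. E (k + l) = E k" "\<And>k. tail (QB N) (E (Suc k)) = head (QB N) (E k)" "\<And>k. E k \<in> arcs (QB N)" by (rule gamma_enum, rule that)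
  have nZ: "E k \<noteq> Z" for k
  proof
    assume Z: "E k = Z"
    have "glue (butlast (replicate N True)) = glue (tl (replicate N True))"
      by (simp add: glue_eq_iff butlast_replicate_bool)
    \<comment> \<open>After the loop the cycle stands at the same node again, which a simple cycle
      of length above 1 cannot do.\<close>
    then have "tail (QB N) (E (Suc k)) = tail (QB N) (E k)"
      unfolding E(6) Z tail_glue head_glue by simp
    then have "Suc k mod l = k mod l" by (rule E(4))
    then have "l = 1" using E(1) by (auto simp: mod_Suc split: if_splits)
    then have E_Suc: "E (Suc j) = E j" for j using E(5)[of j] by simp
    have E0: "E j = E 0" for j by (induction j) (simp_all add: E_Suc)
    have "E 0 = Z" using Z E0[of k] by simp
    then have "E j = Z" for j using E0[of j] by simp
    then have "\<gamma> = {Z}" using E(2) by auto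
    then show False using assms by simp
  qed
  define v where "v k = (SOME u. u \<in> words N \<and> E k = glue u)" for k
  have v: "v k \<in> words N \<and> E k = glue (v k)" for k
    unfolding v_def by (rule someI_ex) (use E(7)[of k] in \<open>auto simp: arcs_QB\<close>)
  show thesis
  proof
    show "\<gamma> = range (\<lambda>k. glue (v k))" using E(2) v by (simp add: image_def)
    show "v (k + l) = v k" for k by (simp add: v_def E(5))
    show "length (v k) = N" for k using v[of k] by (simp add: words_def)
    show "\<not> constw (v k)" for k
    proof
      assume "constw (v k)"
      then have "glue (v k) = Z" using v[of k] by (simp add: glue_eq_iff words_def)
      then show False using nZ[of k] v[of k] by simp
    qed
    show "glue (butlast (v (Suc k))) = glue (tl (v k))" for k
      using E(6)[of k] v[of k] v[of "Suc k"] by (simp add: tail_glue head_glue)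
    show "i mod l = j mod l" if "glue (butlast (v i)) = glue (butlast (v j))" for i j
      using E(4)[of i j] that v[of i] v[of j] by (simp add: tail_glue)
  qed (use E in auto)
qed

lemma sum_gamma:
  assumes "0 < l" "\<gamma> = (\<lambda>k. glue (u k)) ` {..<l}" "card \<gamma> = l" "\<And>k. length (u k) = N"
  shows "(\<Sum>i<l. W (u i)) = real l * M"
proof -
  have "inj_on (\<lambda>k. glue (u k)) {..<l}" using assms by (intro eq_card_imp_inj_on) auto
  then have "(\<Sum>e\<in>\<gamma>. wt e) = (\<Sum>i<l. wt (glue (u i)))" by (simp add: assms(2) sum.reindex)
  then show ?thesis using \<gamma>_mean assms(3,4) by (simp add: wt)
qed

lemma gamma_not_subset_small:
  assumes "n < card \<gamma>" shows "\<not> \<gamma> \<subseteq> f ` {..<n}"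
  using card_mono[of "f ` {..<n}" \<gamma>] card_image_le[of "{..<n}" f] assms by auto

lemma Z_weight: "\<gamma> \<noteq> {Z} \<Longrightarrow> W (replicate N a) \<le> M - g"
proof -
  assume nZ: "\<gamma> \<noteq> {Z}"
  obtain v :: "nat \<Rightarrow> bool list" where "\<gamma> = range (\<lambda>k. glue (v k))" "\<And>k. \<not> constw (v k)"
    by (rule gamma_words[OF nZ], rule that)
  have "\<not> \<gamma> \<subseteq> (\<lambda>i. glue (win N (\<lambda>_. a) i)) ` {..<1::nat}"
  proof
    assume *: "\<gamma> \<subseteq> (\<lambda>i. glue (win N (\<lambda>_. a) i)) ` {..<1::nat}"
    have "glue (v 0) \<in> \<gamma>" using \<open>\<gamma> = _\<close> by auto
    then have "glue (v 0) = glue (win N (\<lambda>_. a) 0)" using * by auto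
    then have "constw (v 0)" using win_const[of N "\<lambda>_. a" 0 a] by (auto simp: glue_eq_iff)
    then show False using \<open>\<And>k. \<not> constw (v k)\<close> by blast
  qed
  from periodic_weight[OF _ this] show ?thesis using win_const[of N "\<lambda>_. a" 0 a] by simp
qed

text \<open>Away from the glued node equal classes are equal words, so the words of \<gamma> overlap
  and spell a sequence; only at the node can this fail. Starting the enumeration there leaves a
  single seam, entered by N - 1 letters b and left by N - 1 letters a. The case b = a is refuted by
  shortening the block, b different from a by \<open>no_mixed\<close>.\<close>

theorem gamma_avoids_constant:
  assumes N3: "3 \<le> N" and nZ: "\<gamma> \<noteq> {Z}" and K: "0 \<le> K" and gK: "5 / 2 * K / 2 ^ N < g"
    and no_mixed: "\<And>\<tau> a l. (\<And>k. k < N - 1 \<Longrightarrow> \<tau> k = a) \<Longrightarrow> (\<And>k. l \<le> k \<Longrightarrow> \<tau> k = (\<not> a)) \<Longrightarrow> N - 1 \<le> l \<Longrightarrow>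
      \<tau> (N - 1) = (\<not> a) \<Longrightarrow> \<tau> (l - 1) = a \<Longrightarrow>
      (\<And>s. (\<And>k. s (k + l) = s k) \<Longrightarrow> (\<Sum>i<l. W (win N s i)) \<le> (\<Sum>i<l. W (win N \<tau> i)) - real l * g) \<Longrightarrow> False"
    and neighbours: "\<And>a. W ((\<not> a) # replicate (N - 1) a) \<le> W ((\<not> a) # replicate (N - 2) a @ [\<not> a]) + K / 2 ^ N"
      "\<And>a. W (replicate (N - 1) a @ [\<not> a]) \<le> W (replicate N a) + K / 2 ^ N"
  obtains \<tau> :: "nat \<Rightarrow> bool" and l :: nat where "0 < l" "\<And>k. \<tau> (k + l) = \<tau> k" "\<gamma> = range (\<lambda>k. glue (win N \<tau> k))"
    "card \<gamma> = l" "\<And>k. \<not> constw (win (N - 1) \<tau> k)"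
    "\<And>i j. glue (win (N - 1) \<tau> i) = glue (win (N - 1) \<tau> j) \<Longrightarrow> i mod l = j mod l"
proof -
  obtain v :: "nat \<Rightarrow> bool list" and l where v: "0 < l" "\<gamma> = range (\<lambda>k. glue (v k))" "card \<gamma> = l"
    "\<And>i j. glue (butlast (v i)) = glue (butlast (v j)) \<Longrightarrow> i mod l = j mod l"
    "\<And>k. v (k + l) = v k" "\<And>k. glue (butlast (v (Suc k))) = glue (tl (v k))"
    "\<And>k. length (v k) = N" "\<And>k. \<not> constw (v k)"
    by (rule gamma_words[OF nZ], rule that)
  have N0: "0 < N" using N by simp
  have overlap: "butlast (v (Suc k)) = tl (v k)" if "\<not> constw (butlast (v (Suc k)))" for k
    using v(6)[of k] that by (simp add: glue_eq_iff)
  show thesis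
  proof (cases "\<exists>j. constw (butlast (v j))")
    case False
    then have w: "v k = win N (\<lambda>k. hd (v k)) k" for k
      using overlap v(7) N0 by (intro overlap_win) auto
    have bw: "butlast (v k) = win (N - 1) (\<lambda>k. hd (v k)) k" for k
      using w[of k] by (metis butlast_win)
    show thesis
    proof (rule that[of l "\<lambda>k. hd (v k)"])
      show "\<gamma> = range (\<lambda>k. glue (win N (\<lambda>k. hd (v k)) k))" using v(2) by (simp flip: w)
      show "\<not> constw (win (N - 1) (\<lambda>k. hd (v k)) k)" for k using False unfolding bw[symmetric] by simp
      show "i mod l = j mod l" if "glue (win (N - 1) (\<lambda>k. hd (v k)) i) = glue (win (N - 1) (\<lambda>k. hd (v k)) j)" for i j
        using that unfolding bw[symmetric] by (rule v(4))
    qed (use v in auto)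
  next
    case True
    then obtain j where j: "constw (butlast (v j))" by blast
    define u where "u k = v (k + j)" for k
    have u: "\<gamma> = range (\<lambda>k. glue (u k))" "\<And>k. u (k + l) = u k" "\<And>k. glue (butlast (u (Suc k))) = glue (tl (u k))"
      "\<And>k. length (u k) = N" "\<And>k. \<not> constw (u k)" "constw (butlast (u 0))"
    proof -
      show "\<gamma> = range (\<lambda>k. glue (u k))"
        using periodic_range_shift[OF v(1), of "\<lambda>k. glue (v k)" j] v(2,5) by (simp add: u_def)
      show "u (k + l) = u k" for k using v(5)[of "k + j"] by (simp add: u_def add.commute add.left_commute)
    qed (use v(6,7,8) j in \<open>auto simp: u_def\<close>)
    have inj: "k mod l = 0" if "constw (butlast (u k))" for k
    proof -
      have "glue (butlast (v (k + j))) = glue (butlast (v j))"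
        using that j v(7) by (auto simp: glue_eq_iff u_def)
      from v(4)[OF this] have "(k + j) mod l = (0 + j) mod l" by simp
      then have "l dvd k + j - j" using mod_eq_dvd_iff_nat[of j "k + j" l] by simp
      then show ?thesis by simp
    qed
    have ov: "butlast (u (Suc k)) = tl (u k)" if "Suc k < l" for k
      using inj[of "Suc k"] that u(3)[of k] by (auto simp: glue_eq_iff)
    have \<gamma>l: "\<gamma> = (\<lambda>k. glue (u k)) ` {..<l}"
      using u(1) periodic_range[OF v(1), of "\<lambda>k. glue (u k)"] u(2) by simp
    obtain a where a: "butlast (u 0) = replicate (N - 1) a"
      using constwE[OF u(6)] u(4)[of 0] by (metis length_butlast)
    have Sl: "Suc (l - 1) = l" using v(1) by simp
    have "glue (butlast (u 0)) = glue (tl (u (l - 1)))" using u(3)[of "l - 1"] u(2)[of 0] Sl by simp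
    then have "constw (tl (u (l - 1)))" using u(6) by (auto simp: glue_eq_iff)
    then obtain b where b: "tl (u (l - 1)) = replicate (N - 1) b"
      using u(4)[of "l - 1"] constwE by (metis length_tl)
    \<comment> \<open>The last word ends in N - 1 letters b without being constant, so its first
      letter differs.\<close>
    have hd0: "hd (u (l - 1)) = (\<not> b)"
    proof (rule ccontr)
      assume "hd (u (l - 1)) \<noteq> (\<not> b)"
      then have "u (l - 1) = b # replicate (N - 1) b" using b u(4)[of "l - 1"] N0 by (cases "u (l - 1)") auto
      then have "constw (u (l - 1))" by (metis constw_replicate replicate_Suc)
      then show False using u(5) by blast
    qed
    have not_all: "\<tau> (N - 1) = (\<not> a)" if init: "u 0 = win N \<tau> 0" "\<And>k. k < N - 1 \<Longrightarrow> \<tau> k = a" for \<tau>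
    proof (rule ccontr)
      assume "\<tau> (N - 1) \<noteq> (\<not> a)"
      then have "\<tau> k = a" if "k < N" for k using that init(2)[of k] N0 by (cases "k = N - 1") auto
      then have "win N \<tau> 0 = replicate N a" by (intro win_const) auto
      then show False using u(5)[of 0] init(1) by simp
    qed
    have init: "\<tau> k = a" if "u 0 = win N \<tau> 0" "k < N - 1" for \<tau> k
    proof -
      have "butlast (u 0) ! k = win (N - 1) \<tau> 0 ! k" using that(1) by (simp add: butlast_win)
      then show ?thesis using that(2) a by (simp add: nth_win)
    qed
    show thesis
    proof (cases "b = a")
      case True
      define \<tau> where "\<tau> k = hd (u k)" for k
      have "butlast (u (Suc k)) = tl (u k)" for k
      proof (cases "constw (butlast (u (Suc k)))")
        case c: True
        have "Suc k mod l = 0" using inj[OF c] .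
        then have m: "k mod l = l - 1" using v(1) by (auto simp: mod_Suc split: if_splits)
        have "u (Suc k) = u 0" using periodic_mod[of u l "Suc k"] u(2) \<open>Suc k mod l = 0\<close> by simp
        moreover have "u k = u (l - 1)" using periodic_mod[of u l k] u(2) m by simp
        ultimately show ?thesis using a b True by simp
      next
        case False
        then show ?thesis using u(3)[of k] by (simp add: glue_eq_iff)
      qed
      then have w: "u k = win N \<tau> k" for k unfolding \<tau>_def using u(4) N0 by (intro overlap_win) auto
      have \<tau>per: "\<tau> (k + l) = \<tau> k" for k by (simp add: \<tau>_def u(2))
      have False
      proof (rule no_pure[of N K W a \<tau> l M g])
        show "\<tau> (N - 1) = (\<not> a)" using w[of 0] init[of \<tau>] by (intro not_all) auto
        show "\<tau> (l - 1) = (\<not> a)" using hd0 True by (simp add: \<tau>_def)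
        show "(\<Sum>i<l. W (win N \<tau> i)) = real l * M"
          using \<gamma>l w v(1,3) by (intro sum_gamma) auto
        show "(\<Sum>i<l - 1. W (win N s i)) \<le> real (l - 1) * (M - g)" if "\<And>k. s (k + (l - 1)) = s k" for s
          using that v(1,3) by (intro periodic_weight gamma_not_subset_small) auto
      qed (use N3 K gK neighbours Z_weight[OF nZ] \<tau>per v(1) init[OF w] in auto)
      then show thesis ..
    next
      case False
      then have ba: "b = (\<not> a)" by auto
      define \<tau> where "\<tau> k = (if k < l then hd (u k) else b)" for k
      have w: "u k = win N \<tau> k" if "k < l" for k unfolding \<tau>_def
        using u(4) ov N0 b that by (intro overlap_win_finite) auto
      have \<tau>0: "\<tau> k = a" if "k < N - 1" for k using init[OF w[OF v(1)] that] .
      have \<tau>1: "\<tau> k = (\<not> a)" if "l \<le> k" for k using that ba by (simp add: \<tau>_def)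
      have lN: "N - 1 \<le> l"
      proof (rule ccontr)
        assume "\<not> N - 1 \<le> l"
        then have "\<tau> l = a" by (intro \<tau>0) simp
        then show False using \<tau>1[of l] by simp
      qed
      have sum: "(\<Sum>i<l. W (win N \<tau> i)) = real l * M"
      proof -
        have "(\<Sum>i<l. W (win N \<tau> i)) = (\<Sum>i<l. W (u i))" using w by (intro sum.cong) auto
        also have "\<dots> = real l * M" using \<gamma>l v(1,3) u(4) by (intro sum_gamma)
        finally show ?thesis .
      qed
      have False
      proof (rule no_mixed[of \<tau> a l])
        show "\<tau> (N - 1) = (\<not> a)" using w[OF v(1)] \<tau>0 by (intro not_all) auto
        show "\<tau> (l - 1) = a" using hd0 ba v(1) by (simp add: \<tau>_def)
        show "(\<Sum>i<l. W (win N s i)) \<le> (\<Sum>i<l. W (win N \<tau> i)) - real l * g" if s: "\<And>k. s (k + l) = s k" for s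
        proof -
          let ?S = "(\<lambda>i. glue (win N s i)) ` {..<l}"
          have per: "win N s (i + l) = win N s i" for i using s by (intro win_eqI) (metis add.assoc add.commute)
          \<comment> \<open>A sequence of period l that covers \<gamma> has no other edges. After
            the word ending in N - 1 letters b it continues with a word beginning with these,
            whereas the only edge of \<gamma> that leaves the node begins with N - 1 letters
            a.\<close>
          have "\<not> \<gamma> \<subseteq> ?S"
          proof
            assume sub: "\<gamma> \<subseteq> ?S"
            have "card ?S \<le> l" using card_image_le[of "{..<l}"] by simp
            then have eq: "\<gamma> = ?S" using sub v(3) by (intro card_seteq) auto
            have "glue (u (l - 1)) \<in> ?S" using u(1) eq by blast
            then obtain i where i: "i < l" "glue (u (l - 1)) = glue (win N s i)" by auto
            then have "u (l - 1) = win N s i" using u(5) by (auto simp: glue_eq_iff)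
            then have bs: "butlast (win N s (Suc i)) = replicate (N - 1) b" using b by (simp add: butlast_win tl_win)
            have "win N s (Suc i) = win N s (Suc i mod l)" using periodic_mod[of "win N s" l "Suc i"] per by simp
            then have "glue (win N s (Suc i)) \<in> ?S" using v(1) by (metis imageI lessThan_iff mod_less_divisor)
            then have "glue (win N s (Suc i)) \<in> (\<lambda>k. glue (u k)) ` {..<l}" using eq \<gamma>l by simp
            then obtain k where k: "k < l" "glue (win N s (Suc i)) = glue (u k)" by auto
            then have uk: "u k = win N s (Suc i)" using u(5) by (auto simp: glue_eq_iff)
            then have "constw (butlast (u k))" using bs by simp
            then have "k = 0" using inj[of k] k(1) by simp
            then show False using uk bs a ba N3 by (auto simp: replicate_eq_replicate)
          qed
          then show ?thesis using periodic_weight[of s l, OF s] sum by (simp add: algebra_simps)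
        qed
      qed (use \<tau>0 \<tau>1 lN in auto)
      then show thesis ..
    qed
  qed
qed

end

section \<open>Excursions from the maximal cycle\<close>

definition circle_dist :: "real \<Rightarrow> real \<Rightarrow> real" where
  "circle_dist a b = min \<bar>a - b\<bar> (1 - \<bar>a - b\<bar>)"

lemma circle_dist_doubling:
  assumes "a \<in> {0..<1}" "b \<in> {0..<1}" "circle_dist a b \<le> 1 / 4"
  shows "circle_dist (doubling a) (doubling b) = 2 * circle_dist a b"
  using assms(3) unfolding doubling_eq[OF assms(1)] doubling_eq[OF assms(2)]
  using assms(1,2) by (cases "1 / 2 \<le> a"; cases "1 / 2 \<le> b") (auto simp: circle_dist_def min_def abs_if split: if_splits)

lemma circle_dist_eq_0: "a \<in> {0..<1} \<Longrightarrow> b \<in> {0..<1} \<Longrightarrow> circle_dist a b \<le> 0 \<Longrightarrow> a = b"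
  by (auto simp: circle_dist_def min_def abs_if split: if_splits)

text \<open>The distances double, so their sum is twice the last one minus the first. Keeping the
  subtracted first distance is what lets the induction close.\<close>

lemma circle_dist_sum:
  assumes "x \<in> {0..<1}" "y \<in> {0..<1}" "\<And>t. t < r \<Longrightarrow> circle_dist ((doubling ^^ t) x) ((doubling ^^ t) y) \<le> h" "h \<le> 1 / 4" "0 < r"
  shows "(\<Sum>t<r. circle_dist ((doubling ^^ t) x) ((doubling ^^ t) y)) \<le> 2 * h - circle_dist x y"
  using assms(5,1-3)
proof (induction r arbitrary: x y rule: nat_induct_non_zero)
  case 1 then show ?case using "1.prems"(3)[of 0] by simp
next
  case (Suc r)
  have "(\<Sum>t<r. circle_dist ((doubling ^^ t) (doubling x)) ((doubling ^^ t) (doubling y))) \<le> 2 * h - circle_dist (doubling x) (doubling y)"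
  proof (rule Suc.IH)
    fix t assume "t < r"
    then show "circle_dist ((doubling ^^ t) (doubling x)) ((doubling ^^ t) (doubling y)) \<le> h"
      using Suc.prems(3)[of "Suc t"] by (simp add: funpow_swap1)
  qed (simp_all only: doubling_in)
  moreover have "circle_dist (doubling x) (doubling y) = 2 * circle_dist x y"
    using Suc.prems(3)[of 0] assms(4) by (intro circle_dist_doubling Suc.prems(1,2)) simp
  ultimately show ?case unfolding sum.lessThan_Suc_shift by (simp add: funpow_swap1)
qed

lemma circle_dist_power:
  assumes "x \<in> {0..<1}" "y \<in> {0..<1}" "\<And>t. circle_dist ((doubling ^^ t) x) ((doubling ^^ t) y) \<le> 1 / 4"
  shows "circle_dist ((doubling ^^ n) x) ((doubling ^^ n) y) = 2 ^ n * circle_dist x y"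
proof (induction n)
  case (Suc n)
  have "circle_dist (doubling ((doubling ^^ n) x)) (doubling ((doubling ^^ n) y)) = 2 * circle_dist ((doubling ^^ n) x) ((doubling ^^ n) y)"
    by (intro circle_dist_doubling funpow_doubling_in assms)
  then show ?case using Suc by simp
qed simp

text \<open>Expansivity: a positive distance would double for ever without exceeding 1/4.\<close>

lemma circle_dist_shadow:
  assumes "x \<in> {0..<1}" "y \<in> {0..<1}" "\<And>t. circle_dist ((doubling ^^ t) x) ((doubling ^^ t) y) \<le> 1 / 4"
  shows "x = y"
proof (rule circle_dist_eq_0[OF assms(1,2)], rule ccontr)
  assume "\<not> circle_dist x y \<le> 0"
  then have "0 < circle_dist x y" by simp
  then obtain n where "1 / circle_dist x y < 2 ^ n" using real_arch_pow[of 2 "1 / circle_dist x y"] by auto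
  then have "1 < 2 ^ n * circle_dist x y" using \<open>0 < circle_dist x y\<close> by (simp add: field_simps)
  also have "\<dots> \<le> 1 / 4" using assms(3)[of n] circle_dist_power[OF assms, of n] by simp
  finally show False by simp
qed

lemma first_failure:
  fixes i j :: nat
  assumes "i \<le> j"
  obtains k where "i \<le> k" "k \<le> j" "\<And>t. t \<in> {i..<k} \<Longrightarrow> P t" "k = j \<or> \<not> P k"
proof -
  define k where "k = (LEAST k. i \<le> k \<and> (k = j \<or> \<not> P k))"
  have 1: "i \<le> k \<and> (k = j \<or> \<not> P k)"
    unfolding k_def by (rule LeastI[of _ j]) (use assms in simp)
  have 2: "k \<le> j" unfolding k_def by (rule Least_le) (use assms in simp)
  have "P t" if "t \<in> {i..<k}" for t
    using not_less_Least[of t "\<lambda>k. i \<le> k \<and> (k = j \<or> \<not> P k)"] that by (auto simp: k_def)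
  then show thesis using that 1 2 by blast
qed

lemma glue_butlast_cong: "glue u = glue v \<Longrightarrow> glue (butlast u) = glue (butlast v)"
  by (metis tail_glue)

lemma glue_tl_cong: "glue u = glue v \<Longrightarrow> glue (tl u) = glue (tl v)"
  by (metis head_glue)

lemma ex_mod_shift:
  assumes "0 < (l::nat)" shows "\<exists>s<l. (a + s) mod l = b mod l"
proof (intro exI conjI)
  let ?s = "(b + (l - a mod l)) mod l"
  show "?s < l" using assms by simp
  have "a mod l \<le> l" using assms by (simp add: less_imp_le)
  moreover have "a = l * (a div l) + a mod l" by simp
  ultimately have "a + (b + (l - a mod l)) = b + l * (a div l + 1)" unfolding distrib_left by linarith
  then show "(a + ?s) mod l = b mod l" by (metis mod_add_right_eq mod_mult_self2)
qed

text \<open>Here \<gamma> is coded by a genuine periodic point y. Either y = 0 and \<gamma> is the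
  glued loop, or \<gamma> avoids the node. In the first case \<open>zero\<close> treats the points
  of the last cylinder, which are close to 0 on the circle only.\<close>

locale dominant_orbit = unique_max_cycle +
  fixes \<phi> :: "real \<Rightarrow> real" and L y B :: real and l :: nat
  assumes N3: "3 \<le> N" and L: "0 \<le> L" and g: "2 * L / 2 ^ N < g"
    and meas: "\<phi> \<in> borel_measurable borel" and bdd: "\<And>x. \<bar>\<phi> x\<bar> \<le> B"
    and W_near: "\<And>\<omega> z. length \<omega> = N \<Longrightarrow> z \<in> cylinder \<omega> \<Longrightarrow> \<bar>W \<omega> - \<phi> z\<bar> \<le> L / 2 / 2 ^ N"
    and lip: "\<And>\<omega> x z. length \<omega> = N \<Longrightarrow> x \<in> cylinder \<omega> \<Longrightarrow> z \<in> cylinder \<omega> \<Longrightarrow> \<bar>\<phi> x - \<phi> z\<bar> \<le> L * \<bar>x - z\<bar>"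
    and zero: "\<And>x. x \<in> cylinder (replicate N True) \<Longrightarrow> \<phi> x \<le> \<phi> 0 + L * (1 - x)"
    and y: "y \<in> {0..<1}" and l: "0 < l" and period: "(doubling ^^ l) y = y"
    and \<gamma>_eq: "\<gamma> = range (\<lambda>k. glue (win N (digits y) k))" and card_\<gamma>: "card \<gamma> = l"
    and nodes: "\<And>i j. glue (win (N - 1) (digits y) i) = glue (win (N - 1) (digits y) j) \<Longrightarrow> i mod l = j mod l"
    and avoid: "y = 0 \<or> (\<forall>k. \<not> constw (win (N - 1) (digits y) k))"
begin

abbreviation "Y k \<equiv> (doubling ^^ k) y"
abbreviation "h \<equiv> 1 / 2 ^ N :: real"
abbreviation "good x i \<equiv> glue (win N (digits x) i) \<in> \<gamma>"
abbreviation "phase x i a \<equiv> glue (win (N - 1) (digits x) i) = glue (win (N - 1) (digits y) a)"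
abbreviation "match x i a \<equiv> glue (win N (digits x) i) = glue (win N (digits y) a)"

definition "\<beta> = (\<Sum>i<l. \<phi> (Y i)) / l"
text \<open>A transfer function along the orbit of y: it is l-periodic because \<beta> is the mean
  over the orbit, and it turns sums along runs into differences.\<close>

definition "A k = (\<Sum>i<k. \<phi> (Y i) - \<beta>)"
definition "\<epsilon> = g - 2 * L * h"

text \<open>Steps off \<gamma> carry the surcharge \<open>\<epsilon>\<close>, the part of the gap
  left after \<open>2 * L * h\<close>, so that a bound on the sums also controls the time spent off
  \<gamma>.\<close>

definition "excess x t = \<phi> ((doubling ^^ t) x) - \<beta> + \<epsilon> * of_bool (\<not> good x t)"

lemma h_le: "h \<le> 1 / 8"
proof -
  have "(2::real) ^ 3 \<le> 2 ^ N" using N3 by (intro power_increasing) auto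
  then show ?thesis by (simp add: field_simps)
qed

lemma eps_pos: "0 < \<epsilon>" using g by (simp add: \<epsilon>_def)

lemma Y_period: "Y (k + l) = Y k"
  by (simp add: funpow_add period)

lemma digits_period: "digits y (k + l) = digits y k"
  using digits_funpow[of l y k] by (simp add: period add.commute)

lemma win_mod: "a mod l = b mod l \<Longrightarrow> win n (digits y) a = win n (digits y) b"
proof -
  assume ab: "a mod l = b mod l"
  have "win n (digits y) (k + l) = win n (digits y) k" for k
  proof (rule win_eqI)
    fix j show "digits y (k + l + j) = digits y (k + j)"
      using digits_period[of "k + j"] by (simp add: algebra_simps)
  qed
  then have m: "win n (digits y) (k mod l) = win n (digits y) k" for k
    by (rule periodic_mod)
  show ?thesis using m[of a] m[of b] ab by simp
qed

lemma Y_in: "Y k \<in> {0..<1}" by (rule funpow_doubling_in[OF y])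

lemma A_period: "A (k + l) = A k"
proof (induction k)
  case 0 show ?case using l by (simp add: A_def \<beta>_def sum_subtractf)
next
  case (Suc k)
  have "A (Suc k + l) = A (k + l) + (\<phi> (Y (k + l)) - \<beta>)" by (simp add: A_def)
  then show ?case using Suc by (simp add: Y_period) (simp add: A_def)
qed

lemma A_mod: "a mod l = b mod l \<Longrightarrow> A a = A b"
  using periodic_mod[of A l, OF A_period, of a] periodic_mod[of A l, OF A_period, of b] by simp

lemma A_bounded: "\<exists>B. \<forall>k. A k \<le> B"
proof (intro exI allI)
  fix k
  have "A k = A (k mod l)" by (rule A_mod) simp
  also have "\<dots> \<le> (\<Sum>i<k mod l. \<bar>\<phi> (Y i) - \<beta>\<bar>)" unfolding A_def by (intro sum_mono) simp
  also have "\<dots> \<le> (\<Sum>i<l. \<bar>\<phi> (Y i) - \<beta>\<bar>)"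
  proof (rule sum_mono2)
    show "{..<k mod l} \<subseteq> {..<l}" using mod_less_divisor[OF l, of k] by auto
  qed auto
  finally show "A k \<le> (\<Sum>i<l. \<bar>\<phi> (Y i) - \<beta>\<bar>)" .
qed

lemma A_diff: "a \<le> b \<Longrightarrow> (\<Sum>i\<in>{a..<b}. \<phi> (Y i) - \<beta>) = A b - A a"
  unfolding A_def lessThan_atLeast0 using sum.atLeastLessThan_concat[of 0 a b "\<lambda>i. \<phi> (Y i) - \<beta>"] by simp

lemma phi_W: "x \<in> {0..<1} \<Longrightarrow> \<bar>W (win N (digits x) i) - \<phi> ((doubling ^^ i) x)\<bar> \<le> L / 2 * h"
  using W_near[OF _ in_cylinder_funpow[of x i N]] by simp

lemma M_beta: "M \<le> \<beta> + L / 2 * h"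
proof -
  have "(\<Sum>i<l. W (win N (digits y) i)) = real l * M"
  proof (rule sum_gamma)
    have "glue (win N (digits y) (k + l)) = glue (win N (digits y) k)" for k
      using win_mod[of "k + l" k N] by simp
    then show "\<gamma> = (\<lambda>k. glue (win N (digits y) k)) ` {..<l}"
      using \<gamma>_eq periodic_range[OF l, of "\<lambda>k. glue (win N (digits y) k)"] by simp
  qed (use l card_\<gamma> in auto)
  moreover have "(\<Sum>i<l. W (win N (digits y) i)) \<le> (\<Sum>i<l. \<phi> (Y i) + L / 2 * h)"
    using phi_W[OF y] by (intro sum_mono) (simp add: abs_le_iff algebra_simps)
  ultimately have "real l * M \<le> (\<Sum>i<l. \<phi> (Y i)) + real l * (L / 2 * h)" by (simp add: sum.distrib)
  then have "real l * M \<le> real l * (\<beta> + L / 2 * h)" using l by (simp add: \<beta>_def distrib_left)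
  then show ?thesis using l by (simp only: mult_le_cancel_left_pos of_nat_0_less_iff)
qed

lemma match_phase: "match x i a \<Longrightarrow> phase x i a" "match x i a \<Longrightarrow> phase x (Suc i) (Suc a)"
  using glue_butlast_cong[of "win N (digits x) i" "win N (digits y) a"]
    glue_tl_cong[of "win N (digits x) i" "win N (digits y) a"] by (simp_all add: butlast_win tl_win)

lemma good_match: "good x i \<Longrightarrow> \<exists>a. match x i a"
  by (auto simp: \<gamma>_eq)

text \<open>A simple cycle passes each node once, so the node fixes the position on \<gamma> modulo
  l, and with it the only edge of \<gamma> that leaves there.\<close>

lemma phase_match: "phase x i a \<Longrightarrow> good x i \<Longrightarrow> match x i a"
proof -
  assume p: "phase x i a" and "good x i"
  then obtain k where k: "match x i k" using good_match by blast
  then have "glue (win (N - 1) (digits y) a) = glue (win (N - 1) (digits y) k)" using match_phase(1)[OF k] p by simp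
  then have "a mod l = k mod l" by (rule nodes)
  then show "match x i a" using win_mod[of a k N] k by simp
qed

lemma match_close:
  assumes x: "x \<in> {0..<1}" and m: "match x i a"
  shows "circle_dist ((doubling ^^ i) x) (Y a) \<le> h" "\<phi> ((doubling ^^ i) x) \<le> \<phi> (Y a) + L * circle_dist ((doubling ^^ i) x) (Y a)"
proof -
  let ?x = "(doubling ^^ i) x" and ?u = "win N (digits x) i" and ?v = "win N (digits y) a"
  have X: "?x \<in> {0..<1}" by (rule funpow_doubling_in[OF x])
  have xu: "?x \<in> cylinder ?u" by (rule in_cylinder_funpow[OF x])
  have yv: "Y a \<in> cylinder ?v" by (rule in_cylinder_funpow[OF y])
  have same: "circle_dist ?x z \<le> h \<and> \<phi> ?x \<le> \<phi> z + L * circle_dist ?x z" if "z \<in> cylinder ?u" for z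
  proof -
    have "\<bar>?x - z\<bar> \<le> h" using xu that by (auto simp: cylinder_def abs_le_iff)
    moreover then have "circle_dist ?x z = \<bar>?x - z\<bar>" using h_le unfolding circle_dist_def by (intro min_absorb1) linarith
    ultimately show ?thesis using lip[OF _ xu that] by (simp add: abs_le_iff)
  qed
  have "circle_dist ?x (Y a) \<le> h \<and> \<phi> ?x \<le> \<phi> (Y a) + L * circle_dist ?x (Y a)"
  proof (cases "?u = ?v")
    case True then show ?thesis using same[of "Y a"] yv by simp
  next
    case False
    \<comment> \<open>Two different words name one edge only as the glued loop. Then y = 0, and x
      may shadow this fixed point from just below 1.\<close>
    then have c: "constw ?u" "constw ?v" using m by (auto simp: glue_eq_iff)
    then have "constw (win (N - 1) (digits y) a)" using constw_butlast[of ?v] by (simp add: butlast_win)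
    then have y0: "y = 0" using avoid by blast
    have Y0: "Y a = 0" by (induction a) (simp_all add: y0 doubling_def)
    obtain b where b: "?u = replicate N b" using c(1) by (auto simp: constw_def)
    show ?thesis
    proof (cases b)
      case False
      then have "0 \<in> cylinder ?u" by (simp add: b cylinder_def word_val_replicate_False)
      then show ?thesis using same[of 0] Y0 by simp
    next
      case True
      then have xc: "?x \<in> cylinder (replicate N True)" using xu b by simp
      then have "1 - h \<le> ?x" "?x < 1" by (auto simp: cylinder_def word_val_replicate_True)
      then have "7 / 8 \<le> ?x" "?x < 1" "1 - ?x \<le> h" using h_le by linarith+
      then have "circle_dist ?x 0 = 1 - ?x" "1 - ?x \<le> h" by (auto simp: circle_dist_def min_def)
      then show ?thesis using zero[OF xc] Y0 by simp
    qed
  qed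
  then show "circle_dist ?x (Y a) \<le> h" "\<phi> ?x \<le> \<phi> (Y a) + L * circle_dist ?x (Y a)" by simp_all
qed

lemma run:
  assumes "phase x i a" "\<And>t. t \<in> {i..<i + r} \<Longrightarrow> good x t"
  shows "phase x (i + r) (a + r) \<and> (\<forall>t<r. match x (i + t) (a + t))"
  using assms(2)
proof (induction r)
  case 0 show ?case using assms(1) by simp
next
  case (Suc r)
  then have IH: "phase x (i + r) (a + r)" "\<forall>t<r. match x (i + t) (a + t)" by auto
  have "match x (i + r) (a + r)" using IH(1) Suc.prems[of "i + r"] by (intro phase_match) auto
  then show ?case using IH(2) match_phase(2)[of x "i + r" "a + r"] by (auto simp: less_Suc_eq)
qed

text \<open>The values along \<gamma> telescope through A, and the errors are L times the shadowing
  distances, a geometric sum. The loss is therefore independent of the length r.\<close>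

lemma good_run:
  assumes x: "x \<in> {0..<1}" and "phase x i a" "\<And>t. t \<in> {i..<i + r} \<Longrightarrow> good x t"
  shows "(\<Sum>t\<in>{i..<i + r}. excess x t) \<le> A (a + r) - A a + 2 * L * h"
proof (cases "r = 0")
  case True then show ?thesis using L by simp
next
  case False
  let ?X = "(doubling ^^ i) x"
  let ?d = "\<lambda>t. circle_dist ((doubling ^^ t) ?X) ((doubling ^^ t) (Y a))"
  have eq: "(doubling ^^ t) ((doubling ^^ k) z) = (doubling ^^ (k + t)) z" for t k z
    using funpow_add[of t k doubling] by (simp add: add.commute)
  have m: "match x (i + t) (a + t)" if "t < r" for t using run[of x i a r] assms(2,3) that by blast
  have "(\<Sum>t\<in>{i..<i + r}. excess x t) = (\<Sum>t\<in>{i..<i + r}. \<phi> ((doubling ^^ t) x) - \<beta>)"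
    using assms(3) by (intro sum.cong) (auto simp: excess_def)
  also have "\<dots> = (\<Sum>t<r. \<phi> ((doubling ^^ (i + t)) x) - \<beta>)"
    using sum.shift_bounds_nat_ivl[of "\<lambda>t. \<phi> ((doubling ^^ t) x) - \<beta>" 0 i r] by (simp add: add.commute lessThan_atLeast0)
  also have "\<dots> \<le> (\<Sum>t<r. (\<phi> (Y (a + t)) - \<beta>) + L * ?d t)"
    using match_close(2)[OF x m] by (intro sum_mono) (simp add: eq algebra_simps)
  also have "\<dots> = (\<Sum>t<r. \<phi> (Y (a + t)) - \<beta>) + L * (\<Sum>t<r. ?d t)"
    by (simp add: sum.distrib sum_distrib_left)
  also have "(\<Sum>t<r. \<phi> (Y (a + t)) - \<beta>) = A (a + r) - A a"
    using sum.shift_bounds_nat_ivl[of "\<lambda>t. \<phi> (Y t) - \<beta>" 0 a r] A_diff[of a "a + r"]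
    by (simp add: add.commute lessThan_atLeast0)
  also have "L * (\<Sum>t<r. ?d t) \<le> L * (2 * h)"
  proof (rule mult_left_mono[OF _ L])
    have hd: "?d t \<le> h" if "t < r" for t using match_close(1)[OF x m[OF that]] by (simp only: eq)
    have "(\<Sum>t<r. ?d t) \<le> 2 * h - circle_dist ?X (Y a)"
      using hd h_le False by (intro circle_dist_sum funpow_doubling_in[OF x] Y_in) auto
    also have "0 \<le> circle_dist ?X (Y a)"
      using funpow_doubling_in[OF x, of i] Y_in[of a] by (auto simp: circle_dist_def abs_le_iff)
    then have "2 * h - circle_dist ?X (Y a) \<le> 2 * h" by simp
    finally show "(\<Sum>t<r. ?d t) \<le> 2 * h" .
  qed
  finally show ?thesis by (simp add: mult.commute)
qed

lemma bad_run_le_W: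
  assumes "x \<in> {0..<1}" and "\<And>t. t \<in> {i..<j} \<Longrightarrow> \<not> good x t" "i \<le> j"
  shows "(\<Sum>t\<in>{i..<j}. excess x t) \<le> (\<Sum>t\<in>{i..<j}. W (win N (digits x) t)) + real (j - i) * (L / 2 * h - \<beta> + \<epsilon>)"
proof -
  have "(\<Sum>t\<in>{i..<j}. excess x t) \<le> (\<Sum>t\<in>{i..<j}. W (win N (digits x) t) + (L / 2 * h - \<beta> + \<epsilon>))"
    using assms(2) phi_W[OF assms(1)] by (intro sum_mono) (simp add: excess_def abs_le_iff algebra_simps)
  then show ?thesis using assms(3) by (simp add: sum.distrib of_nat_diff)
qed

text \<open>Covers the excursions at the beginning or the end of an orbit segment, which no arc of
  \<gamma> closes up. They do not accumulate, so a constant bound suffices.\<close>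

lemma open_excursion:
  "\<exists>K. \<forall>x i j. x \<in> {0..<1} \<longrightarrow> i \<le> j \<longrightarrow> (\<forall>t\<in>{i..<j}. \<not> good x t) \<longrightarrow> (\<Sum>t\<in>{i..<j}. excess x t) \<le> K"
proof -
  obtain K where K: "\<And>u p v. awalk u p v \<Longrightarrow> \<not> \<gamma> \<subseteq> set p \<Longrightarrow> sum_list (map wt p) \<le> K + real (length p) * (M - g)"
    using walk_weight by blast
  show ?thesis
  proof (intro exI[of _ K] allI impI)
    fix x i j assume x: "x \<in> {0..<1}" and ij: "i \<le> (j::nat)" and bad: "\<forall>t\<in>{i..<j}. \<not> good x t"
    let ?p = "map (\<lambda>j. glue (win N (digits x) j)) [i..<j]"
    have "awalk (glue (win (N - 1) (digits x) i)) ?p (glue (win (N - 1) (digits x) j))"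
      using awalk_windows[of N "digits x" i "j - i"] N ij by simp
    moreover have "\<not> \<gamma> \<subseteq> set ?p"
    proof
      assume "\<gamma> \<subseteq> set ?p"
      moreover have "glue (win N (digits y) 0) \<in> \<gamma>" by (auto simp: \<gamma>_eq)
      ultimately have "glue (win N (digits y) 0) \<in> set ?p" by blast
      then show False using bad \<open>glue (win N (digits y) 0) \<in> \<gamma>\<close> by auto
    qed
    ultimately have "sum_list (map wt ?p) \<le> K + real (length ?p) * (M - g)" by (rule K)
    then have "(\<Sum>t\<in>{i..<j}. W (win N (digits x) t)) \<le> K + real (j - i) * (M - g)"
      unfolding sum_list_windows by simp
    moreover have "(\<Sum>t\<in>{i..<j}. excess x t) \<le> (\<Sum>t\<in>{i..<j}. W (win N (digits x) t)) + real (j - i) * (L / 2 * h - \<beta> + \<epsilon>)"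
      using bad by (intro bad_run_le_W x ij) auto
    moreover have "real (j - i) * (M - g) + real (j - i) * (L / 2 * h - \<beta> + \<epsilon>) \<le> 0"
    proof -
      have "M - g + (L / 2 * h - \<beta> + \<epsilon>) \<le> 0" 
      proof -
        have "L / 2 * h = L * h / 2" "2 * L * h = 2 * (L * h)" "0 \<le> L * h" using L by simp_all
        then show ?thesis using M_beta unfolding \<epsilon>_def by linarith
      qed
      then have "real (j - i) * (M - g + (L / 2 * h - \<beta> + \<epsilon>)) \<le> 0" by (simp add: mult_nonneg_nonpos)
      then show ?thesis by (simp only: distrib_left)
    qed
    ultimately show "(\<Sum>t\<in>{i..<j}. excess x t) \<le> K" by linarith
  qed
qed

text \<open>An excursion away from \<open>\<gamma>\<close> is closed up by an arc of \<open>\<gamma>\<close>. The closed walk has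
  length at least 2, which pays for the \<open>2 * L * h\<close> lost on the following run along \<open>\<gamma>\<close>.\<close>

lemma closed_excursion:
  assumes x: "x \<in> {0..<1}" and ij: "i < j" and bad: "\<And>t. t \<in> {i..<j} \<Longrightarrow> \<not> good x t"
    and b: "phase x i b" and a: "phase x j a"
  shows "(\<Sum>t\<in>{i..<j}. excess x t) \<le> A a - A b - 2 * L * h"
proof -
  \<comment> \<open>The arc leads from position a on to the next occurrence of position b. With
    fewer than l edges it cannot contain \<gamma>, and the excursion itself has no edge of
    \<gamma>.\<close>
  obtain s where s: "s < l" "(a + s) mod l = b mod l" using ex_mod_shift[OF l] by blast
  let ?p = "map (\<lambda>t. glue (win N (digits x) t)) [i..<j]" and ?q = "map (\<lambda>t. glue (win N (digits y) t)) [a..<a + s]"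
  let ?u = "glue (win (N - 1) (digits x) i)" and ?v = "glue (win (N - 1) (digits x) j)"
  have "awalk ?u ?p ?v" using awalk_windows[of N "digits x" i "j - i"] N ij by simp
  moreover have "awalk ?v ?q ?u"
    using awalk_windows[of N "digits y" a s] N a b win_mod[OF s(2), of "N - 1"] by simp
  ultimately have walk: "awalk ?u (?p @ ?q) ?u" by (rule awalk_appendI)
  have "\<not> \<gamma> \<subseteq> set (?p @ ?q)"
  proof
    assume sub: "\<gamma> \<subseteq> set (?p @ ?q)"
    have "\<gamma> \<subseteq> set ?q"
    proof
      fix e assume e: "e \<in> \<gamma>"
      then have "e \<in> set ?p \<or> e \<in> set ?q" using sub by auto
      moreover have "e \<notin> set ?p" using bad e by auto
      ultimately show "e \<in> set ?q" by blast
    qed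
    then have "card \<gamma> \<le> card (set ?q)" by (intro card_mono) auto
    also have "\<dots> \<le> length ?q" by (rule card_length)
    finally show False using s(1) card_\<gamma> by simp
  qed
  from closed_walk_weight[OF walk this]
  have cl: "(\<Sum>t\<in>{i..<j}. W (win N (digits x) t)) + (\<Sum>t\<in>{a..<a + s}. W (win N (digits y) t)) \<le> real (j - i + s) * (M - g)"
    using sum_list_windows[of "digits x" i j] sum_list_windows[of "digits y" a "a + s"] by simp
  have arc: "A b - A a + real s * (\<beta> - L / 2 * h) \<le> (\<Sum>t\<in>{a..<a + s}. W (win N (digits y) t))"
  proof -
    have "(\<Sum>t\<in>{a..<a + s}. (\<phi> (Y t) - \<beta>) + (\<beta> - L / 2 * h)) \<le> (\<Sum>t\<in>{a..<a + s}. W (win N (digits y) t))"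
      using phi_W[OF y] by (intro sum_mono) (simp add: abs_le_iff algebra_simps)
    moreover have "(\<Sum>t\<in>{a..<a + s}. (\<phi> (Y t) - \<beta>) + (\<beta> - L / 2 * h)) = A (a + s) - A a + real s * (\<beta> - L / 2 * h)"
      unfolding sum.distrib using A_diff[of a "a + s"] by simp
    ultimately show ?thesis using A_mod[OF s(2)] by simp
  qed
  have bad_le: "(\<Sum>t\<in>{i..<j}. excess x t) \<le> (\<Sum>t\<in>{i..<j}. W (win N (digits x) t)) + real (j - i) * (L / 2 * h - \<beta> + \<epsilon>)"
    using bad ij by (intro bad_run_le_W x) auto
  \<comment> \<open>A closed walk of length 1 is the glued loop. Then y = 0 and this loop is
    \<gamma>, so the step would be good.\<close>
  have len: "2 \<le> j - i + s"
  proof (rule ccontr)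
    assume "\<not> 2 \<le> j - i + s"
    then have j: "j = Suc i" and s0: "s = 0" using ij by auto
    have "glue (butlast (win N (digits x) i)) = glue (tl (win N (digits x) i))"
      using a b s(2) win_mod[of a b "N - 1"] unfolding j s0 by (simp add: butlast_win tl_win)
    then have c: "constw (win N (digits x) i)" using N3 by (intro loop_constw) auto
    then have "constw (win (N - 1) (digits x) i)" using constw_butlast by (metis butlast_win)
    then have "constw (win (N - 1) (digits y) b)" using b by (metis glue_eq_iff)
    then have y0: "y = 0" using avoid by blast
    have "(doubling ^^ k) 0 = 0" for k by (induction k) (simp_all add: doubling_def)
    then have "digits y k = False" for k using y0 by (simp add: digits_def)
    then have "win N (digits y) 0 = replicate N False" by (intro win_const) auto
    then have "match x i 0" using c by (simp add: glue_eq_iff)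
    then have "good x i" by (auto simp: \<gamma>_eq)
    then show False using bad[of i] ij by simp
  qed
  \<comment> \<open>Of the \<open>2 * L * h\<close> taken off in \<open>\<epsilon>\<close>, one half
    per step is spent on exchanging averages and values, here and in \<open>M_beta\<close>. The
    other half, over at least 2 steps, is the \<open>2 * L * h\<close> of the claim.\<close>
  define n m where "n = real (j - i + s)" and "m = real (j - i)"
  have nm: "2 \<le> n" "m \<le> n" "n = m + real s" using len by (simp_all add: n_def m_def)
  have "n * M \<le> n * (\<beta> + L / 2 * h)" using M_beta nm by (intro mult_left_mono) auto
  moreover have "m * \<epsilon> \<le> n * \<epsilon>" using eps_pos nm by (intro mult_right_mono) auto
  moreover have "2 * (L * h) \<le> n * (L * h)" using L nm by (intro mult_right_mono) auto
  moreover have "n * \<epsilon> = n * g - 2 * (n * (L * h))" by (simp add: \<epsilon>_def algebra_simps)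
  moreover have "(\<Sum>t\<in>{i..<j}. excess x t) \<le> n * (M - g) - (A b - A a + real s * (\<beta> - L / 2 * h)) + m * (L / 2 * h - \<beta> + \<epsilon>)"
    using cl arc bad_le unfolding n_def m_def by linarith
  moreover have "n * (M - g) - (A b - A a + real s * (\<beta> - L / 2 * h)) + m * (L / 2 * h - \<beta> + \<epsilon>)
      = n * M - n * g - A b + A a - n * (\<beta> + L / 2 * h) + n * (L * h) + m * \<epsilon>"
    unfolding nm(3) by (simp add: algebra_simps add_divide_distrib)
  ultimately show ?thesis by linarith
qed

text \<open>A closed excursion gains the \<open>2 * L * h\<close> that the run before it may have
  lost, and A telescopes across both, so repeating the pair costs nothing. The constant only pays
  for the last, incomplete pair.\<close>

lemma excess_from_phase:
  "\<exists>K. \<forall>x i j a. x \<in> {0..<1} \<longrightarrow> i \<le> j \<longrightarrow> phase x i a \<longrightarrow> (\<Sum>t\<in>{i..<j}. excess x t) \<le> K - A a"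
proof -
  obtain K where K: "\<And>x i j. x \<in> {0..<1} \<Longrightarrow> i \<le> j \<Longrightarrow> (\<And>t. t \<in> {i..<j} \<Longrightarrow> \<not> good x t) \<Longrightarrow> (\<Sum>t\<in>{i..<j}. excess x t) \<le> K"
    using open_excursion by blast
  obtain B where B: "\<And>k. A k \<le> B" using A_bounded by blast
  define C where "C = B + 2 * L * h + \<bar>K\<bar>"
  have "(\<Sum>t\<in>{i..<j}. excess x t) \<le> C - A a" if "x \<in> {0..<1}" "i \<le> j" "phase x i a" for x i j a
    using that
  proof (induction "j - i" arbitrary: i a rule: less_induct)
    case less
    note x = less.prems(1)
    obtain k where k: "i \<le> k" "k \<le> j" "\<And>t. t \<in> {i..<k} \<Longrightarrow> good x t" "k = j \<or> \<not> good x k"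
      using first_failure[OF less.prems(2), of "good x"] by blast
    define b where "b = a + (k - i)"
    have ki: "k = i + (k - i)" using k(1) by simp
    have g1: "(\<Sum>t\<in>{i..<k}. excess x t) \<le> A b - A a + 2 * L * h"
      using good_run[OF x less.prems(3), of "k - i"] k(1,3) by (simp add: b_def)
    have pb: "phase x k b" using run[OF less.prems(3), of "k - i"] k(1,3) by (simp add: b_def)
    show ?case
    proof (cases "k = j")
      case True then show ?thesis using g1 B[of b] by (simp add: C_def)
    next
      case False
      then have kj: "k < j" "\<not> good x k" using k by auto
      obtain n where n: "k \<le> n" "n \<le> j" "\<And>t. t \<in> {k..<n} \<Longrightarrow> \<not> good x t" "n = j \<or> \<not> \<not> good x n"
        using first_failure[OF k(2), of "\<lambda>t. \<not> good x t"] by blast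
      have split: "(\<Sum>t\<in>{i..<j}. excess x t) = (\<Sum>t\<in>{i..<k}. excess x t) + (\<Sum>t\<in>{k..<n}. excess x t) + (\<Sum>t\<in>{n..<j}. excess x t)"
        using k(1,2) n(1,2) by (simp add: sum.atLeastLessThan_concat)
      show ?thesis
      proof (cases "n = j")
        case True
        then show ?thesis using split g1 B[of b] K[OF x n(1,3)] by (simp add: C_def)
      next
        case False
        then have gn: "good x n" using n(4) by blast
        then obtain a' where a': "match x n a'" using good_match by blast
        have kn: "k < n" using kj(2) gn n(1) by (cases "k = n") auto
        have "(\<Sum>t\<in>{k..<n}. excess x t) \<le> A a' - A b - 2 * L * h"
          by (rule closed_excursion[OF x kn n(3) pb match_phase(1)[OF a']])
        moreover have "(\<Sum>t\<in>{n..<j}. excess x t) \<le> C - A a'"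
          using kn k(1) n(2) False by (intro less.hyps x match_phase(1)[OF a']) auto
        ultimately show ?thesis using split g1 by linarith
      qed
    qed
  qed
  then show ?thesis by blast
qed

theorem excess_bounded:
  "\<exists>K. \<forall>x n. x \<in> {0..<1} \<longrightarrow> (\<Sum>t<n. excess x t) \<le> K"
proof -
  obtain K where K: "\<And>x i j. x \<in> {0..<1} \<Longrightarrow> i \<le> j \<Longrightarrow> (\<And>t. t \<in> {i..<j} \<Longrightarrow> \<not> good x t) \<Longrightarrow> (\<Sum>t\<in>{i..<j}. excess x t) \<le> K"
    using open_excursion by blast
  obtain C where C: "\<And>x i j a. x \<in> {0..<1} \<Longrightarrow> i \<le> j \<Longrightarrow> phase x i a \<Longrightarrow> (\<Sum>t\<in>{i..<j}. excess x t) \<le> C - A a"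
    using excess_from_phase by blast
  define D where "D = (\<Sum>i<l. \<bar>A i\<bar>)"
  have D: "- A a \<le> D" for a
  proof -
    have "A a = A (a mod l)" by (rule A_mod) simp
    moreover have "\<bar>A (a mod l)\<bar> \<le> D" unfolding D_def
      using l by (intro member_le_sum) auto
    ultimately show ?thesis by linarith
  qed
  have "(\<Sum>t<n. excess x t) \<le> K + \<bar>C + D\<bar>" if x: "x \<in> {0..<1}" for x n
  proof -
    obtain k where k: "0 \<le> k" "k \<le> n" "\<And>t. t \<in> {0..<k} \<Longrightarrow> \<not> good x t" "k = n \<or> \<not> \<not> good x k"
      using first_failure[of 0 n "\<lambda>t. \<not> good x t"] by blast
    have 1: "(\<Sum>t\<in>{0..<k}. excess x t) \<le> K" by (rule K[OF x k(1,3)])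
    show ?thesis
    proof (cases "k = n")
      case True then show ?thesis using 1 by (simp add: lessThan_atLeast0)
    next
      case False
      then obtain a where a: "match x k a" using k(4) good_match by blast
      have "(\<Sum>t\<in>{k..<n}. excess x t) \<le> C - A a" by (rule C[OF x k(2) match_phase(1)[OF a]])
      moreover have "(\<Sum>t<n. excess x t) = (\<Sum>t\<in>{0..<k}. excess x t) + (\<Sum>t\<in>{k..<n}. excess x t)"
        using k(2) by (simp add: lessThan_atLeast0 sum.atLeastLessThan_concat)
      ultimately show ?thesis using 1 D[of a] by linarith
    qed
  qed
  then show ?thesis by blast
qed

text \<open>An orbit that never leaves \<gamma> keeps its phase and stays close to an orbit point of
  y for ever; expansivity makes them equal.\<close>

lemma all_good_orbit:
  assumes x: "x \<in> {0..<1}" and "\<And>i. good x i" shows "\<exists>k<l. x = Y k"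
proof -
  obtain a where "match x 0 a" using good_match[OF assms(2)] by blast
  then have p: "phase x 0 a" by (rule match_phase)
  have m: "match x t (a + t)" for t using run[OF p, of "Suc t"] assms(2) by auto
  have "x = Y a"
  proof (rule circle_dist_shadow[OF x Y_in])
    fix t
    show "circle_dist ((doubling ^^ t) x) ((doubling ^^ t) (Y a)) \<le> 1 / 4"
      using order_trans[OF match_close(1)[OF x m[of t]] h_le] by (simp add: funpow_add add.commute[of a])
  qed
  moreover have "Y a = Y (a mod l)" using periodic_mod[of Y l, OF Y_period] by simp
  ultimately show ?thesis using l mod_less_divisor by blast
qed

end

section \<open>Invariant measures\<close>

lemma frac_Ico: "x \<in> {0..<1} \<Longrightarrow> frac x = (x::real)"
  by (simp add: frac_eq)

lemma open_frac_vimage: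
  assumes "open U" "U \<subseteq> {0<..<1}" shows "open (frac -` U :: real set)"
proof -
  have "frac -` U = (\<Union>n::int. (\<lambda>x. x - of_int n) -` U)"
  proof (intro set_eqI iffI)
    fix x :: real assume "x \<in> frac -` U"
    then have "x - of_int \<lfloor>x\<rfloor> \<in> U" by (simp add: frac_def)
    then show "x \<in> (\<Union>n::int. (\<lambda>x. x - of_int n) -` U)" by blast
  next
    fix x :: real assume "x \<in> (\<Union>n::int. (\<lambda>x. x - of_int n) -` U)"
    then obtain n :: int where *: "x - of_int n \<in> U" by blast
    then have "0 < x - of_int n" "x - of_int n < 1" using assms(2) by auto
    then have "frac x = x - of_int n" by (simp add: frac_unique_iff)
    then show "x \<in> frac -` U" using * by simp
  qed
  then show ?thesis using assms(1) by (auto intro!: open_UN open_vimage continuous_intros)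
qed

lemma circle_open_Pow: "{U. circle_open U} \<subseteq> Pow {0..<1}"
  unfolding circle_open_def by blast

lemma space_circle_borel [simp]: "space circle_borel = {0..<1}"
  unfolding circle_borel_def by (rule space_measure_of[OF circle_open_Pow])

lemma circle_open_sets: "circle_open U \<Longrightarrow> U \<in> sets circle_borel"
  unfolding circle_borel_def by (simp add: sets_measure_of[OF circle_open_Pow] sigma_sets.Basic)

text \<open>The circle topology differs from the subspace topology only at 0, and the singleton of 0
  is measurable as the complement of the open interval.\<close>

lemma sets_circle_borel: "sets circle_borel = sets (restrict_space borel {0..<1})"
proof -
  have c: "sets circle_borel = sigma_sets {0..<1} {U. circle_open U}"
    unfolding circle_borel_def by (rule sets_measure_of[OF circle_open_Pow])
  have "sets (restrict_space borel {0..<1::real}) = (\<inter>) {0..<1} ` sigma_sets UNIV {S. open S}"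
    by (simp add: sets_restrict_space borel_def)
  also have "\<dots> = sigma_sets {0..<1} ((\<inter>) {0..<1} ` {S::real set. open S})"
  proof (rule sigma_sets_Int)
    have "{0..<1::real} \<in> sets borel" by simp
    then show "{0..<1::real} \<in> sigma_sets UNIV {S. open S}" by (simp add: borel_def)
  qed simp
  also have "\<dots> = sigma_sets {0..<1} {U. circle_open U}"
  proof (rule sigma_sets_eqI)
    fix V assume "V \<in> (\<inter>) {0..<1} ` {S::real set. open S}"
    then obtain S :: "real set" where S: "open S" "V = {0..<1} \<inter> S" by blast
    have op: "T \<inter> {0<..<1} \<in> sigma_sets {0..<1} {U. circle_open U}" if "open T" for T
    proof (rule sigma_sets.Basic)
      have "open (frac -` (T \<inter> {0<..<1}) :: real set)" using that by (intro open_frac_vimage) auto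
      then show "T \<inter> {0<..<1} \<in> {U. circle_open U}" by (auto simp: circle_open_def)
    qed
    have "{0..<1} - UNIV \<inter> {0<..<1::real} \<in> sigma_sets {0..<1} {U. circle_open U}"
      using op[of UNIV] by (intro sigma_sets.Compl) simp
    also have "{0..<1} - UNIV \<inter> {0<..<1::real} = {0}" by auto
    finally have 0: "{0} \<in> sigma_sets {0..<1} {U. circle_open U}" .
    have "V = (if 0 \<in> S then {0} else {}) \<union> (S \<inter> {0<..<1})" using S(2) by (auto simp: less_le)
    then show "V \<in> sigma_sets {0..<1} {U. circle_open U}"
      using sigma_sets_Un[OF 0 op[OF S(1)]] op[OF S(1)] by (cases "0 \<in> S") simp_all
  next
    fix U assume "U \<in> {U. circle_open U}"
    then have U: "U \<subseteq> {0..<1}" "open (frac -` U)" by (auto simp: circle_open_def)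
    have "U = {0..<1} \<inter> frac -` U" using U(1) frac_Ico by force
    then show "U \<in> sigma_sets {0..<1} ((\<inter>) {0..<1} ` {S::real set. open S})"
      using U(2) by (intro sigma_sets.Basic) blast
  qed
  finally show ?thesis using c by simp
qed

lemma sets_circle_borelI: "A \<in> sets borel \<Longrightarrow> A \<subseteq> {0..<1} \<Longrightarrow> A \<in> sets circle_borel"
  unfolding sets_circle_borel sets_restrict_space by (auto intro!: image_eqI[of _ _ A])

lemma circle_measurable: "f \<in> borel_measurable borel \<Longrightarrow> f \<in> borel_measurable circle_borel"
  using measurable_restrict_space1[of f borel borel "{0..<1}"] measurable_cong_sets[OF sets_circle_borel refl] by blast

lemma doubling_measurable: "doubling \<in> measurable circle_borel circle_borel"
proof -
  have "(\<lambda>x. 2 * x - of_int \<lfloor>2 * x\<rfloor>) \<in> borel_measurable (borel :: real measure)" by measurable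
  then have "doubling \<in> borel_measurable borel" by (simp add: doubling_def[abs_def] frac_def)
  then have "doubling \<in> measurable (restrict_space borel {0..<1}) (restrict_space borel {0..<1})"
    using doubling_in by (intro measurable_restrict_space3) (auto simp del: atLeastLessThan_iff)
  then show ?thesis using measurable_cong_sets[OF sets_circle_borel sets_circle_borel] by blast
qed

lemma cylinder_sets: "cylinder \<omega> \<in> sets circle_borel"
  using cylinder_subset by (intro sets_circle_borelI) (auto simp: cylinder_def)

lemma invariantD:
  assumes "\<nu> \<in> invariant_measures"
  shows "prob_space \<nu>" "space \<nu> = {0..<1}" "sets \<nu> = sets circle_borel" "distr \<nu> circle_borel doubling = \<nu>"
proof -
  show *: "prob_space \<nu>" "space \<nu> = {0..<1}" "sets \<nu> = sets circle_borel"
    using assms by (auto simp: invariant_measures_def)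
  have m: "doubling \<in> measurable \<nu> circle_borel"
    using doubling_measurable measurable_cong_sets[OF *(3) refl] by blast
  show "distr \<nu> circle_borel doubling = \<nu>"
  proof (rule measure_eqI)
    fix A assume "A \<in> sets (distr \<nu> circle_borel doubling)"
    then show "emeasure (distr \<nu> circle_borel doubling) A = emeasure \<nu> A"
      using assms *(3) by (subst emeasure_distr[OF m]) (auto simp: invariant_measures_def)
  qed (simp add: *(3))
qed

lemma invariant_measurable:
  assumes "\<nu> \<in> invariant_measures" shows "measurable \<nu> M = measurable circle_borel M"
  by (rule measurable_cong_sets[OF invariantD(3)[OF assms] refl])

lemma invariant_integral:
  fixes f :: "real \<Rightarrow> real"
  assumes "\<nu> \<in> invariant_measures" "f \<in> borel_measurable circle_borel"
  shows "(\<integral>x. f ((doubling ^^ t) x) \<partial>\<nu>) = (\<integral>x. f x \<partial>\<nu>)"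
proof (induction t)
  case (Suc t)
  have m: "doubling \<in> measurable \<nu> circle_borel"
    using doubling_measurable by (simp add: invariant_measurable[OF assms(1)])
  have "(\<lambda>x. f ((doubling ^^ t) x)) \<in> borel_measurable circle_borel"
    using assms(2) measurable_compose_n[OF doubling_measurable] by (rule measurable_compose[rotated])
  then have "(\<integral>x. f ((doubling ^^ t) x) \<partial>distr \<nu> circle_borel doubling) = (\<integral>x. f ((doubling ^^ t) (doubling x)) \<partial>\<nu>)"
    by (rule integral_distr[OF m])
  then show ?case using Suc by (simp add: invariantD(4)[OF assms(1)] funpow_swap1)
qed simp

lemma ereal_integral_bounded:
  fixes \<phi> :: "real \<Rightarrow> real"
  assumes "\<nu> \<in> invariant_measures" "\<phi> \<in> borel_measurable borel" "\<And>x. \<bar>\<phi> x\<bar> \<le> B"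
    and F: "\<And>x. x \<in> {0..<1} \<Longrightarrow> F x = ereal (\<phi> x)"
  shows "ereal_integral \<nu> F = ereal (\<integral>x. \<phi> x \<partial>\<nu>)"
proof -
  interpret prob_space \<nu> by (rule invariantD(1)[OF assms(1)])
  have m: "\<phi> \<in> borel_measurable \<nu>"
    using circle_measurable[OF assms(2)] by (simp add: invariant_measurable[OF assms(1)])
  have int: "integrable \<nu> \<phi>"
    using assms(3) by (intro integrable_const_bound[of _ B] m) auto
  have fin: "(\<integral>\<^sup>+x. ennreal (\<phi> x) \<partial>\<nu>) < \<infinity>" "(\<integral>\<^sup>+x. ennreal (- \<phi> x) \<partial>\<nu>) < \<infinity>"
    using int by (auto simp: real_integrable_def less_top)
  have "(\<integral>\<^sup>+x. e2ennreal (F x) \<partial>\<nu>) = (\<integral>\<^sup>+x. ennreal (\<phi> x) \<partial>\<nu>)"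
    using F invariantD(2)[OF assms(1)] by (intro nn_integral_cong) (simp add: ennreal.abs_eq[symmetric] e2ennreal_ereal)
  moreover have "(\<integral>\<^sup>+x. e2ennreal (- F x) \<partial>\<nu>) = (\<integral>\<^sup>+x. ennreal (- \<phi> x) \<partial>\<nu>)"
    using F invariantD(2)[OF assms(1)] by (intro nn_integral_cong) (simp add: e2ennreal_ereal)
  moreover have "enn2ereal a - enn2ereal b = ereal (enn2real a - enn2real b)" if "a < \<infinity>" "b < \<infinity>" for a b
    using that by (cases a; cases b) (simp_all add: enn2ereal_ennreal)
  ultimately show ?thesis
    using fin by (simp add: ereal_integral_def real_lebesgue_integral_def[OF int])
qed

lemma ereal_integral_mono:
  assumes "\<And>x. x \<in> space M \<Longrightarrow> F x \<le> G x" shows "ereal_integral M F \<le> ereal_integral M G"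
  unfolding ereal_integral_def
proof (rule ereal_minus_mono)
  show "enn2ereal (\<integral>\<^sup>+x. e2ennreal (F x) \<partial>M) \<le> enn2ereal (\<integral>\<^sup>+x. e2ennreal (G x) \<partial>M)"
    using assms by (intro less_eq_ennreal.rep_eq[THEN iffD1] nn_integral_mono e2ennreal_mono)
  show "enn2ereal (\<integral>\<^sup>+x. e2ennreal (- G x) \<partial>M) \<le> enn2ereal (\<integral>\<^sup>+x. e2ennreal (- F x) \<partial>M)"
    using assms by (intro less_eq_ennreal.rep_eq[THEN iffD1] nn_integral_mono e2ennreal_mono) simp
qed

lemma ereal_integral_cong_AE:
  assumes "AE x in M. F x = G x" shows "ereal_integral M F = ereal_integral M G"
proof -
  have "(\<integral>\<^sup>+x. e2ennreal (F x) \<partial>M) = (\<integral>\<^sup>+x. e2ennreal (G x) \<partial>M)"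
    by (rule nn_integral_cong_AE) (use assms in eventually_elim, simp)
  moreover have "(\<integral>\<^sup>+x. e2ennreal (- F x) \<partial>M) = (\<integral>\<^sup>+x. e2ennreal (- G x) \<partial>M)"
    by (rule nn_integral_cong_AE) (use assms in eventually_elim, simp)
  ultimately show ?thesis by (simp add: ereal_integral_def)
qed

lemma circle_open_Compl_finite:
  assumes "finite X" "X \<subseteq> {0..<1}" shows "circle_open ({0..<1} - X)"
proof -
  have "frac -` ({0..<1} - X) = (\<Inter>a\<in>X. - ((\<lambda>x. x - a) -` \<int>))"
  proof -
    have *: "frac x = a \<longleftrightarrow> x - a \<in> \<int>" if "a \<in> X" for a x :: real
    proof -
      have "0 \<le> a" "a < 1" using that assms(2) by auto
      then show ?thesis by (simp add: frac_unique_iff)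
    qed
    then have "x \<in> frac -` ({0..<1} - X) \<longleftrightarrow> x \<in> (\<Inter>a\<in>X. - ((\<lambda>x. x - a) -` \<int>))" for x
    proof -
      have "x \<in> frac -` ({0..<1} - X) \<longleftrightarrow> (\<forall>a\<in>X. frac x \<noteq> a)" using frac_lt_1[of x] by auto
      also have "\<dots> \<longleftrightarrow> (\<forall>a\<in>X. x - a \<notin> \<int>)" using * by blast
      finally show ?thesis by simp
    qed
    then show ?thesis by blast
  qed
  also have "open \<dots>" using assms(1)
    by (intro open_INT ballI open_Compl closed_vimage closed_Ints continuous_intros) auto
  finally show ?thesis by (auto simp: circle_open_def)
qed

section \<open>The measure on the periodic orbit and its uniqueness\<close>

context dominant_orbit
begin

definition "\<mu> = distr (measure_pmf (pmf_of_set {..<l})) circle_borel (\<lambda>k. Y k)"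

abbreviation "Orb \<equiv> {Y k |k. k < l}"

lemma Y_meas: "(\<lambda>k. Y k) \<in> measurable (measure_pmf p) circle_borel"
  using Y_in by (simp add: measurable_pmf_measure1 Pi_def del: atLeastLessThan_iff)

lemma ne: "{..<l} \<noteq> {}" using l by auto

lemma emeasure_mu: "U \<in> sets circle_borel \<Longrightarrow> emeasure \<mu> U = ennreal (real (card {k. k < l \<and> Y k \<in> U}) / real l)"
proof -
  assume U: "U \<in> sets circle_borel"
  have "{..<l} \<inter> (\<lambda>k. Y k) -` U = {k. k < l \<and> Y k \<in> U}" by auto
  then show ?thesis
    using U ne unfolding \<mu>_def by (subst emeasure_distr[OF Y_meas]) (simp_all add: emeasure_pmf_of_set)
qed

lemma card_shift: "card {k. k < l \<and> P (Y (Suc k))} = card {k. k < l \<and> P (Y k)}"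
proof (rule bij_betw_same_card[of "\<lambda>k. Suc k mod l"])
  have Ym: "Y (k mod l) = Y k" for k using periodic_mod[of Y l, OF Y_period] .
  have inj: "inj_on (\<lambda>k. Suc k mod l) {..<l}"
    using l by (auto simp: inj_on_def mod_Suc split: if_splits)
  have img: "(\<lambda>k. Suc k mod l) ` {..<l} = {..<l}"
    using inj l by (intro endo_inj_surj) auto
  then have surj: "\<exists>j<l. k = Suc j mod l" if "k < l" for k
  proof -
    have "k \<in> (\<lambda>k. Suc k mod l) ` {..<l}" using that unfolding img by simp
    then show ?thesis by blast
  qed
  show "bij_betw (\<lambda>k. Suc k mod l) {k. k < l \<and> P (Y (Suc k))} {k. k < l \<and> P (Y k)}"
    unfolding bij_betw_def
  proof
    show "inj_on (\<lambda>k. Suc k mod l) {k. k < l \<and> P (Y (Suc k))}" using inj by (rule inj_on_subset) auto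
    show "(\<lambda>k. Suc k mod l) ` {k. k < l \<and> P (Y (Suc k))} = {k. k < l \<and> P (Y k)}"
    proof safe
      fix k assume "P (Y (Suc k))"
      then show "P (Y (Suc k mod l))" by (simp only: Ym)
    next
      fix k assume k: "k < l" "P (Y k)"
      then obtain j where j: "j < l" "k = Suc j mod l" using surj by blast
      then have "P (Y (Suc j))" using k(2) Ym[of "Suc j"] by simp
      then show "k \<in> (\<lambda>k. Suc k mod l) ` {k. k < l \<and> P (Y (Suc k))}" using j by blast
    qed (use l in auto)
  qed
qed

lemma mu_invariant: "\<mu> \<in> invariant_measures"
  unfolding invariant_measures_def
proof (intro CollectI conjI ballI)
  show "prob_space \<mu>" unfolding \<mu>_def by (rule measure_pmf.prob_space_distr[OF Y_meas])
  show s: "space \<mu> = {0..<1}" and ss: "sets \<mu> = sets circle_borel" by (simp_all add: \<mu>_def)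
  fix A assume "A \<in> sets \<mu>"
  then have A: "A \<in> sets circle_borel" by (simp add: ss)
  have A': "doubling -` A \<inter> space \<mu> \<in> sets circle_borel"
    using measurable_sets[OF doubling_measurable A] by (simp add: s)
  have "{k. k < l \<and> Y k \<in> doubling -` A \<inter> space \<mu>} = {k. k < l \<and> Y (Suc k) \<in> A}"
    using Y_in by (auto simp: s simp del: atLeastLessThan_iff)
  then show "emeasure \<mu> (doubling -` A \<inter> space \<mu>) = emeasure \<mu> A"
    using card_shift[of "\<lambda>z. z \<in> A"] by (simp add: emeasure_mu A A')
qed

lemma integral_mu: "(\<integral>x. \<phi> x \<partial>\<mu>) = \<beta>"
proof -
  have "(\<integral>x. \<phi> x \<partial>\<mu>) = measure_pmf.expectation (pmf_of_set {..<l}) (\<lambda>k. \<phi> (Y k))"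
    unfolding \<mu>_def by (rule integral_distr[OF Y_meas circle_measurable[OF meas]])
  also have "\<dots> = \<beta>" using ne by (simp add: integral_pmf_of_set \<beta>_def)
  finally show ?thesis .
qed

definition "Bad = {x \<in> {0..<1}. \<not> good x 0}"

lemma Bad_sets: "Bad \<in> sets circle_borel"
proof -
  have "Bad = {0..<1} - (\<Union>\<omega>\<in>{\<omega> \<in> words N. glue \<omega> \<in> \<gamma>}. cylinder \<omega>)"
  proof (intro set_eqI iffI)
    fix x assume "x \<in> Bad"
    then have x: "x \<in> {0..<1}" "\<not> good x 0" by (simp_all add: Bad_def)
    have "x \<notin> cylinder \<omega>" if "\<omega> \<in> words N" "glue \<omega> \<in> \<gamma>" for \<omega>
      using cylinder_unique[of x \<omega>] that x(2) by (auto simp: words_def)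
    then show "x \<in> {0..<1} - (\<Union>\<omega>\<in>{\<omega> \<in> words N. glue \<omega> \<in> \<gamma>}. cylinder \<omega>)" using x(1) by blast
  next
    fix x assume x: "x \<in> {0..<1} - (\<Union>\<omega>\<in>{\<omega> \<in> words N. glue \<omega> \<in> \<gamma>}. cylinder \<omega>)"
    then have "x \<in> cylinder (win N (digits x) 0)" by (intro in_cylinder_digits) simp
    moreover have "win N (digits x) 0 \<in> words N" by (simp add: words_def)
    ultimately show "x \<in> Bad" using x unfolding Bad_def by blast
  qed
  also have "\<dots> \<in> sets circle_borel"
    using sets.top[of circle_borel] finite_words[of N]
    by (intro sets.Diff sets.finite_UN cylinder_sets) auto
  finally show ?thesis .
qed

lemma funpow_good: "good ((doubling ^^ t) x) 0 \<longleftrightarrow> good x t"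
proof -
  have "win N (digits ((doubling ^^ t) x)) 0 = win N (digits x) t"
    by (rule win_eqI) (simp add: digits_funpow)
  then show ?thesis by simp
qed

text \<open>By invariance the integral of a Birkhoff sum of length n is n times the integral of E.
  It stays below K for all n, so the integral of E is not positive.\<close>

lemma integral_le:
  assumes \<nu>: "\<nu> \<in> invariant_measures"
  shows "(\<integral>x. \<phi> x \<partial>\<nu>) + \<epsilon> * measure \<nu> Bad \<le> \<beta>"
proof -
  interpret prob_space \<nu> by (rule invariantD(1)[OF \<nu>])
  have mc: "measurable \<nu> borel = measurable circle_borel borel" by (rule invariant_measurable[OF \<nu>])
  define E where "E x = \<phi> x - \<beta> + \<epsilon> * indicator Bad x" for x
  have E: "E ((doubling ^^ t) x) = excess x t" if "x \<in> {0..<1}" for x t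
    using funpow_doubling_in[OF that, of t] funpow_good[of t x]
    by (simp add: E_def excess_def Bad_def indicator_def del: atLeastLessThan_iff)
  have Em: "E \<in> borel_measurable circle_borel"
    unfolding E_def using circle_measurable[OF meas] Bad_sets by measurable
  have Eb: "\<bar>E x\<bar> \<le> B + \<bar>\<beta>\<bar> + \<epsilon>" for x
    using bdd[of x] eps_pos unfolding E_def by (auto simp: indicator_def)
  have B0: "0 \<le> B + \<bar>\<beta>\<bar> + \<epsilon>" using Eb[of 0] by linarith
  have int: "integrable \<nu> (\<lambda>x. E ((doubling ^^ t) x))" for t
  proof (rule integrable_const_bound[of _ "B + \<bar>\<beta>\<bar> + \<epsilon>"])
    show "(\<lambda>x. E ((doubling ^^ t) x)) \<in> borel_measurable \<nu>"
      unfolding mc using Em measurable_compose_n[OF doubling_measurable] by (rule measurable_compose[rotated])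
  qed (use Eb in auto)
  obtain K where K: "\<And>x n. x \<in> {0..<1} \<Longrightarrow> (\<Sum>t<n. excess x t) \<le> K" using excess_bounded by blast
  have n: "real n * (\<integral>x. E x \<partial>\<nu>) \<le> K" for n
  proof -
    have "real n * (\<integral>x. E x \<partial>\<nu>) = (\<Sum>t<n. \<integral>x. E ((doubling ^^ t) x) \<partial>\<nu>)"
      by (simp add: invariant_integral[OF \<nu> Em])
    also have "\<dots> = (\<integral>x. (\<Sum>t<n. E ((doubling ^^ t) x)) \<partial>\<nu>)" using int by simp
    also have "\<dots> \<le> (\<integral>x. K \<partial>\<nu>)"
    proof (rule integral_mono)
      fix x assume "x \<in> space \<nu>"
      then have "x \<in> {0..<1}" by (simp only: invariantD(2)[OF \<nu>])
      then show "(\<Sum>t<n. E ((doubling ^^ t) x)) \<le> K" using K by (simp add: E del: atLeastLessThan_iff)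
    qed (use int in auto)
    finally show ?thesis by (simp add: prob_space)
  qed
  have "(\<integral>x. E x \<partial>\<nu>) \<le> 0"
  proof (rule ccontr)
    assume "\<not> (\<integral>x. E x \<partial>\<nu>) \<le> 0"
    then obtain n where "K < real n * (\<integral>x. E x \<partial>\<nu>)" using reals_Archimedean3[of "\<integral>x. E x \<partial>\<nu>"] by auto
    then show False using n[of n] by simp
  qed
  moreover have "(\<integral>x. E x \<partial>\<nu>) = (\<integral>x. \<phi> x \<partial>\<nu>) - \<beta> + \<epsilon> * measure \<nu> Bad"
  proof -
    have "integrable \<nu> \<phi>" using bdd circle_measurable[OF meas] by (intro integrable_const_bound[of _ B]) (auto simp: mc)
    moreover have "integrable \<nu> (indicator Bad :: real \<Rightarrow> real)"
      using Bad_sets invariantD(3)[OF \<nu>] by (simp add: emeasure_eq_measure)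
    moreover have "Bad \<inter> space \<nu> = Bad" by (auto simp: invariantD(2)[OF \<nu>] Bad_def)
    ultimately show ?thesis unfolding E_def by (simp add: prob_space)
  qed
  ultimately show ?thesis by simp
qed

text \<open>Almost every point is good at all times and hence lies on the orbit of y. By invariance
  the point masses do not decrease along this orbit; as it is cyclic they are all equal.\<close>

lemma orbit_measure_unique:
  assumes \<nu>: "\<nu> \<in> invariant_measures" and null: "measure \<nu> Bad = 0"
  shows "\<nu> = \<mu>"
proof -
  interpret prob_space \<nu> by (rule invariantD(1)[OF \<nu>])
  have s: "sets \<nu> = sets circle_borel" and sp: "space \<nu> = {0..<1}" by (rule invariantD[OF \<nu>])+
  have pt: "{z} \<in> sets \<nu>" if "z \<in> {0..<1}" for z
    unfolding s using that by (intro sets_circle_borelI) auto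
  have inv: "measure \<nu> (doubling -` A \<inter> {0..<1}) = measure \<nu> A" if "A \<in> sets circle_borel" for A
    
  proof -
    have "emeasure \<nu> (doubling -` A \<inter> space \<nu>) = emeasure \<nu> A"
      using \<nu> that s unfolding invariant_measures_def by blast
    then show ?thesis by (simp add: measure_def sp)
  qed
  define Bt where "Bt t = (doubling ^^ t) -` Bad \<inter> {0..<1}" for t
  have Bt: "Bt t \<in> sets circle_borel" for t
    using measurable_sets[OF measurable_compose_n[OF doubling_measurable] Bad_sets, of t] by (simp add: Bt_def)
  have Bt_null: "measure \<nu> (Bt t) = 0" for t
  proof (induction t)
    case 0
    have "Bt 0 = Bad" by (auto simp: Bt_def Bad_def)
    then show ?case using null by simp
  next
    case (Suc t)
    have "Bt (Suc t) = doubling -` Bt t \<inter> {0..<1}"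
      using doubling_in by (auto simp: Bt_def funpow_swap1 simp del: atLeastLessThan_iff)
    then show ?case using inv[OF Bt] Suc by simp
  qed
  have AE: "AE x in \<nu>. x \<in> Orb"
  proof -
    have "AE x in \<nu>. x \<notin> Bt t" for t
      using Bt[of t] Bt_null[of t] s by (intro AE_not_in) (simp add: null_sets_def emeasure_eq_measure)
    then have "AE x in \<nu>. \<forall>t. x \<notin> Bt t" by (simp add: AE_all_countable)
    then show ?thesis
    proof (rule AE_mp, intro AE_I2 impI)
      fix x assume x: "x \<in> space \<nu>" and nb: "\<forall>t. x \<notin> Bt t"
      have x1: "x \<in> {0..<1}" using x sp by simp
      have "good x t" for t
        using nb funpow_doubling_in[OF x1, of t] x1 funpow_good[of t x] by (auto simp: Bt_def Bad_def)
      then obtain k where "k < l" "x = Y k" using all_good_orbit[OF x1] by blast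
      then show "x \<in> Orb" by blast
    qed
  qed
  have inj: "inj_on (\<lambda>k. Y k) {..<l}"
  proof (rule inj_onI)
    fix i j assume ij: "i \<in> {..<l}" "j \<in> {..<l}" "Y i = Y j"
    have "win (N - 1) (digits y) i = win (N - 1) (digits y) j"
      using digits_funpow[of i y] digits_funpow[of j y] ij(3) by (intro win_eqI) (metis)
    then have "i mod l = j mod l" by (intro nodes) simp
    then show "i = j" using ij by simp
  qed
  have step: "measure \<nu> {Y k} \<le> measure \<nu> {Y (Suc k)}" for k
  proof -
    have "measure \<nu> {Y k} \<le> measure \<nu> (doubling -` {Y (Suc k)} \<inter> {0..<1})"
    proof (rule finite_measure_mono)
      show "doubling -` {Y (Suc k)} \<inter> {0..<1} \<in> sets \<nu>"
        using measurable_sets[OF doubling_measurable, of "{Y (Suc k)}"] pt[OF Y_in, of "Suc k"] by (simp only: s space_circle_borel)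
    qed (use Y_in[of k] in auto)
    also have "\<dots> = measure \<nu> {Y (Suc k)}" using pt[OF Y_in, of "Suc k"] unfolding s by (rule inv)
    finally show ?thesis .
  qed
  have mono: "measure \<nu> {Y i} \<le> measure \<nu> {Y (i + n)}" for i n
    by (induction n) (use step order_trans in auto)
  have const: "measure \<nu> {Y k} = measure \<nu> {Y 0}" if "k < l" for k
    using mono[of 0 k] mono[of k "l - k"] that Y_period[of 0] by simp
  define q where "q = measure \<nu> {Y 0}"
  have meas_eq: "measure \<nu> A = card {k. k < l \<and> Y k \<in> A} * q" if A: "A \<in> sets circle_borel" for A
  proof -
    let ?I = "{k. k < l \<and> Y k \<in> A}"
    have fin: "finite ((\<lambda>k. {Y k}) ` ?I)" by simp
    have "measure \<nu> A = measure \<nu> (\<Union>k\<in>?I. {Y k})"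
    proof (rule measure_eq_AE)
      show "AE x in \<nu>. x \<in> A \<longleftrightarrow> x \<in> (\<Union>k\<in>?I. {Y k})" using AE by (rule AE_mp) (auto intro!: AE_I2)
      show "(\<Union>k\<in>?I. {Y k}) \<in> sets \<nu>" using pt[OF Y_in] by (intro sets.finite_UN) auto
    qed (use A s in simp)
    also have "\<dots> = (\<Sum>k\<in>?I. measure \<nu> {Y k})"
      using pt[OF Y_in] inj by (intro finite_measure_finite_Union) (auto simp: disjoint_family_on_def inj_on_def)
    also have "\<dots> = card ?I * q" using const by (simp add: q_def)
    finally show ?thesis .
  qed
  have "real l * q = 1"
  proof -
    have "{k. k < l \<and> Y k \<in> {0..<1}} = {..<l}" using Y_in by auto
    then show ?thesis
      using meas_eq[of "{0..<1}"] prob_space sets.top[of circle_borel] by (simp add: sp)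
  qed
  then have q: "q = 1 / real l" using l by (simp add: field_simps)
  show ?thesis
  proof (rule measure_eqI)
    show "sets \<nu> = sets \<mu>" by (simp add: s \<mu>_def)
    fix A assume "A \<in> sets \<nu>"
    then show "emeasure \<nu> A = emeasure \<mu> A"
      using meas_eq[of A] by (simp add: s emeasure_mu emeasure_eq_measure q)
  qed
qed

lemma msupport_mu: "msupport \<mu> = Orb"
proof (intro set_eqI iffI)
  fix x assume "x \<in> Orb"
  then obtain k where k: "k < l" "x = Y k" by blast
  have "0 < emeasure \<mu> U" if "circle_open U" "x \<in> U" for U
  proof -
    have "U \<in> sets circle_borel" using that(1) by (rule circle_open_sets)
    moreover have "0 < card {k. k < l \<and> Y k \<in> U}" using k that(2) by (intro card_gt_0_iff[THEN iffD2]) auto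
    ultimately show ?thesis using l by (simp add: emeasure_mu)
  qed
  then show "x \<in> msupport \<mu>" using k(2) Y_in[of k] unfolding msupport_def by blast
next
  fix x assume x: "x \<in> msupport \<mu>"
  have fin: "finite Orb" by simp
  have op: "circle_open ({0..<1} - Orb)" using Y_in by (intro circle_open_Compl_finite fin) auto
  show "x \<in> Orb"
  proof (rule ccontr)
    assume "x \<notin> Orb"
    then have "0 < emeasure \<mu> ({0..<1} - Orb)" using x op unfolding msupport_def by blast
    moreover have "{0..<1} - Orb \<in> sets circle_borel" using op by (rule circle_open_sets)
    moreover have "{k. k < l \<and> Y k \<in> {0..<1} - Orb} = {}" by blast
    ultimately show False by (simp only: emeasure_mu) simp
  qed
qed

text \<open>Uniqueness passes from F to G: integrals of G are at most those of F, and \<mu> attains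
  the same value \<beta> for both when they agree on its support. A maximizing measure for G then
  reaches \<beta> for F as well.\<close>

theorem unique_maximizing_orbit:
  assumes F: "\<And>x. x \<in> {0..<1} \<Longrightarrow> F x = ereal (\<phi> x)" and G: "\<And>x. x \<in> {0..<1} \<Longrightarrow> G x \<le> F x"
  shows "\<exists>\<mu>. unique_maximizing F \<mu> \<and> (\<exists>X. periodic_orbit X \<and> msupport \<mu> \<subseteq> X)
    \<and> ((\<forall>x\<in>msupport \<mu>. F x = G x) \<longrightarrow> unique_maximizing G \<mu>)"
proof (intro exI conjI impI)
  have I: "ereal_integral \<nu> F = ereal (\<integral>x. \<phi> x \<partial>\<nu>)" if "\<nu> \<in> invariant_measures" for \<nu>
    by (rule ereal_integral_bounded[OF that meas bdd F])
  have le: "ereal_integral \<nu> F \<le> ereal \<beta>" if "\<nu> \<in> invariant_measures" for \<nu>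
  proof -
    have "0 \<le> \<epsilon> * measure \<nu> Bad" using eps_pos by simp
    then show ?thesis using integral_le[OF that] by (simp add: I that)
  qed
  have eq: "\<nu> = \<mu>" if "\<nu> \<in> invariant_measures" "ereal \<beta> \<le> ereal_integral \<nu> F" for \<nu>
  proof (rule orbit_measure_unique[OF that(1)])
    have "\<epsilon> * measure \<nu> Bad \<le> 0" using integral_le[OF that(1)] that by (simp add: I)
    then show "measure \<nu> Bad = 0" using eps_pos by (simp add: mult_le_0_iff measure_le_0_iff)
  qed
  have mu: "ereal_integral \<mu> F = ereal \<beta>" by (simp add: I mu_invariant integral_mu)
  have unique: "unique_maximizing H \<mu>"
    if H: "\<And>\<nu>. \<nu> \<in> invariant_measures \<Longrightarrow> ereal_integral \<nu> H \<le> ereal_integral \<nu> F" and H\<mu>: "ereal_integral \<mu> H = ereal \<beta>" for H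
  proof -
    have S: "(SUP \<nu>\<in>invariant_measures. ereal_integral \<nu> H) = ereal \<beta>"
    proof (rule antisym)
      show "(SUP \<nu>\<in>invariant_measures. ereal_integral \<nu> H) \<le> ereal \<beta>"
        by (rule SUP_least) (use H le order_trans in blast)
      show "ereal \<beta> \<le> (SUP \<nu>\<in>invariant_measures. ereal_integral \<nu> H)"
        using SUP_upper[OF mu_invariant, of "\<lambda>\<nu>. ereal_integral \<nu> H"] by (simp add: H\<mu>)
    qed
    show ?thesis unfolding unique_maximizing_def maximizing_def S
      
    proof (intro conjI allI impI mu_invariant H\<mu>)
      fix \<nu> assume "\<nu> \<in> invariant_measures \<and> ereal_integral \<nu> H = ereal \<beta>"
      then show "\<nu> = \<mu>" using eq[of \<nu>] H[of \<nu>] by simp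
    qed
  qed
  show "unique_maximizing F \<mu>" using mu by (intro unique) auto
  show "periodic_orbit Orb" unfolding periodic_orbit_def using y l period by blast
  show "msupport \<mu> \<subseteq> Orb" by (simp add: msupport_mu)
  assume FG: "\<forall>x\<in>msupport \<mu>. F x = G x"
  show "unique_maximizing G \<mu>"
  proof (rule unique)
    show "ereal_integral \<nu> G \<le> ereal_integral \<nu> F" if "\<nu> \<in> invariant_measures" for \<nu>
      using G by (intro ereal_integral_mono) (simp only: invariantD(2)[OF that])
    have "AE x in \<mu>. x \<in> Orb"
    proof (rule AE_I)
      have "circle_open ({0..<1} - Orb)" using Y_in by (intro circle_open_Compl_finite) auto
      then show s: "{0..<1} - Orb \<in> sets \<mu>" unfolding \<mu>_def sets_distr by (rule circle_open_sets)
      have "{k. k < l \<and> Y k \<in> {0..<1} - Orb} = {}" by blast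
      then show "emeasure \<mu> ({0..<1} - Orb) = 0" using s unfolding \<mu>_def[THEN arg_cong[where f=sets]] sets_distr by (simp only: emeasure_mu) simp
      show "{x \<in> space \<mu>. x \<notin> Orb} \<subseteq> {0..<1} - Orb" by (auto simp: invariantD(2)[OF mu_invariant])
    qed
    then have "AE x in \<mu>. G x = F x" by (rule AE_mp) (use FG in \<open>auto simp: msupport_mu intro!: AE_I2\<close>)
    then show "ereal_integral \<mu> G = ereal \<beta>" using ereal_integral_cong_AE mu by metis
  qed
qed

end

section \<open>From the gap to the maximizing measure\<close>

text \<open>With \<open>t = cot \<alpha>\<close> one has
  \<open>(sin \<alpha>)\<^sup>2 * (1 + t\<^sup>2) = 1\<close>, so the claim amounts to
  \<open>1 + t\<^sup>2 \<le> exp t\<close>.\<close>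

lemma neg_ln_sin_le:
  assumes \<alpha>: "0 < \<alpha>" "\<alpha> \<le> pi / 4"
  shows "- ln (sin \<alpha>) \<le> cot \<alpha> / 2"
proof -
  define t where "t = cot \<alpha>"
  have s: "0 < sin \<alpha>" by (rule sin_alpha_pos[OF \<alpha>])
  have t: "1 \<le> t" unfolding t_def by (rule cot_alpha_ge_1[OF \<alpha>])
  have "(sin \<alpha>)\<^sup>2 * (1 + t\<^sup>2) = (sin \<alpha>)\<^sup>2 + (cos \<alpha>)\<^sup>2"
    using s by (simp add: t_def cot_def power_divide field_simps)
  then have "(sin \<alpha>)\<^sup>2 * (1 + t\<^sup>2) = 1" by simp
  then have "ln ((sin \<alpha>)\<^sup>2 * (1 + t\<^sup>2)) = 0" by simp
  moreover have t2: "0 < 1 + t\<^sup>2" by (simp add: add_pos_nonneg)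
  ultimately have "2 * ln (sin \<alpha>) + ln (1 + t\<^sup>2) = 0" using s by (simp add: ln_mult ln_realpow)
  moreover have "ln (1 + t\<^sup>2) \<le> t"
  proof -
    \<comment> \<open>The quadratic Taylor bound at t / 2, squared, supplies the cubic term that
      dominates the missing half of \<open>t\<^sup>2\<close>; a completed square shows this.\<close>
    have "1 + t / 2 + (t / 2)\<^sup>2 / 2 \<le> exp (t / 2)" using t by (intro exp_lower_Taylor_quadratic) simp
    then have "(1 + t / 2 + (t / 2)\<^sup>2 / 2)\<^sup>2 \<le> (exp (t / 2))\<^sup>2" using t by (intro power_mono) auto
    also have "(exp (t / 2))\<^sup>2 = exp t" by (simp flip: exp_double)
    finally have "1 + t + t\<^sup>2 / 2 + t ^ 3 / 8 + t ^ 4 / 64 \<le> exp t"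
      by (simp add: power2_eq_square power3_eq_cube power4_eq_xxxx algebra_simps)
    moreover have "t * ((t - 2)\<^sup>2 / 8 + 1 / 2) = t ^ 3 / 8 - t\<^sup>2 / 2 + t"
      by (simp add: power2_eq_square power3_eq_cube field_simps)
    moreover have "0 \<le> t * ((t - 2)\<^sup>2 / 8 + 1 / 2)" "0 \<le> t ^ 4 / 64" using t by auto
    ultimately have "1 + t\<^sup>2 \<le> exp t" by linarith
    then have "ln (1 + t\<^sup>2) \<le> ln (exp t)" using t2 by (subst ln_le_cancel_iff) auto
    then show ?thesis by simp
  qed
  ultimately show ?thesis by (simp add: t_def)
qed

section \<open>The size of the gap and a lower bound for N\<close>

context unique_max_cycle
begin

text \<open>Some periodic walk misses \<gamma>: the alternating word if \<gamma> is the glued loop,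
  the loop otherwise. Its mean is at least s and at most M - g, while M is not positive.\<close>

lemma gap_bound:
  assumes W: "\<And>\<omega>. length \<omega> = N \<Longrightarrow> s \<le> W \<omega>" "\<And>\<omega>. length \<omega> = N \<Longrightarrow> W \<omega> \<le> 0"
  shows "g \<le> - s"
proof -
  obtain E :: "nat \<Rightarrow> bool list set" and l where
    E: "0 < l" "\<gamma> = range E" "card \<gamma> = l"
    "\<And>i j. tail (QB N) (E i) = tail (QB N) (E j) \<Longrightarrow> i mod l = j mod l"
    "\<And>k. E (k + l) = E k" "\<And>k. tail (QB N) (E (Suc k)) = head (QB N) (E k)" "\<And>k. E k \<in> arcs (QB N)"
    by (rule gamma_enum, rule that)
  have M0: "M \<le> 0"
  proof -
    have "wt e \<le> 0" if "e \<in> \<gamma>" for e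
    proof -
      have "e \<in> arcs (QB N)" using that E(2,7) by auto
      then show ?thesis using W(2) wt by (auto simp: arcs_QB words_def)
    qed
    then have "real l * M \<le> 0" using \<gamma>_mean E(3) sum_nonpos[of \<gamma> wt] by simp
    then show ?thesis using E(1) by (simp add: mult_le_0_iff)
  qed
  have "\<exists>n s. 0 < n \<and> (\<forall>k. s (k + n) = s k) \<and> \<not> \<gamma> \<subseteq> (\<lambda>i. glue (win N s i)) ` {..<n}"
  proof (cases "\<gamma> = {Z}")
    case True
    have "glue (win N odd i) \<noteq> Z" for i
    proof
      assume "glue (win N odd i) = Z"
      then have "constw (win N odd i)" by (auto simp: glue_eq_iff)
      then obtain a where a: "win N odd i = replicate N a" by (auto simp: constw_def)
      have "odd (i + k) = a" if "k < N" for k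
        using arg_cong[OF a, of "\<lambda>u. u ! k"] that by (simp add: nth_win)
      from this[of 0] this[of 1] show False using N by auto
    qed
    then show ?thesis using True by (intro exI[of _ "2::nat"] exI[of _ odd]) auto
  next
    case False
    have "\<not> \<gamma> \<subseteq> {Z}" using False E(2) by auto
    moreover have "glue (win N (\<lambda>_. True) 0) = Z" using win_const[of N "\<lambda>_. True" 0 True] by simp
    ultimately show ?thesis by (intro exI[of _ "1::nat"] exI[of _ "\<lambda>_. True"]) (auto simp: lessThan_Suc)
  qed
  then obtain n t where n: "0 < n" "\<And>k. t (k + n) = t k" "\<not> \<gamma> \<subseteq> (\<lambda>i. glue (win N t i)) ` {..<n}" by blast
  have "(\<Sum>i<n. s) \<le> (\<Sum>i<n. W (win N t i))" using W(1) by (intro sum_mono) simp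
  also have "\<dots> \<le> real n * (M - g)" by (rule periodic_weight[of t n, OF n(2,3)])
  finally have "s \<le> M - g" using n(1) by simp
  then show ?thesis using M0 by simp
qed

end

text \<open>By \<open>- ln (sin \<alpha>) \<le> cot \<alpha> / 2\<close> the cotangent cancels and
  \<open>5 * pi < 2 ^ N\<close> remains, which fails up to N = 3.\<close>

lemma four_le_N:
  assumes \<alpha>: "0 < \<alpha>" "\<alpha> \<le> pi / 4" and g: "5 * pi / 2 * cot \<alpha> * (1 / 2 ^ N) < g" "g \<le> - ln (sin \<alpha>)"
  shows "4 \<le> N"
proof (rule ccontr)
  assume "\<not> 4 \<le> N"
  then have "(2::real) ^ N \<le> 2 ^ 3" by (intro power_increasing) auto
  then have "1 / 8 \<le> 1 / (2::real) ^ N" by (simp add: field_simps)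
  moreover have "0 < cot \<alpha>" using cot_alpha_ge_1[OF \<alpha>] by simp
  ultimately have "5 * pi / 2 * cot \<alpha> * (1 / 8) \<le> 5 * pi / 2 * cot \<alpha> * (1 / 2 ^ N)"
    by (intro mult_left_mono) auto
  moreover have "3 * cot \<alpha> \<le> pi * cot \<alpha>" using pi_gt3 \<open>0 < cot \<alpha>\<close> by (intro mult_right_mono) auto
  ultimately show False using g neg_ln_sin_le[OF \<alpha>] \<open>0 < cot \<alpha>\<close> by linarith
qed

lemma maximizing_of_gap:
  assumes umc: "unique_max_cycle N (avg \<phi>) wt M g \<gamma>" and N4: "4 \<le> N" and L: "0 \<le> L" and gL: "5 / 2 * L / 2 ^ N < g"
    and meas: "\<phi> \<in> borel_measurable borel" and bdd: "\<And>x. \<bar>\<phi> x\<bar> \<le> B"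
    and lip: "\<And>\<omega> x z. length \<omega> = N \<Longrightarrow> x \<in> cylinder \<omega> \<Longrightarrow> z \<in> cylinder \<omega> \<Longrightarrow> \<bar>\<phi> x - \<phi> z\<bar> \<le> L * \<bar>x - z\<bar>"
    and zero: "\<And>x. x \<in> cylinder (replicate N True) \<Longrightarrow> \<phi> x \<le> \<phi> 0 + L * (1 - x)"
    and no_mixed: "\<And>\<tau> a l. (\<And>k. k < N - 1 \<Longrightarrow> \<tau> k = a) \<Longrightarrow> (\<And>k. l \<le> k \<Longrightarrow> \<tau> k = (\<not> a)) \<Longrightarrow> N - 1 \<le> l \<Longrightarrow>
      \<tau> (N - 1) = (\<not> a) \<Longrightarrow> \<tau> (l - 1) = a \<Longrightarrow>
      (\<And>s. (\<And>k. s (k + l) = s k) \<Longrightarrow> (\<Sum>i<l. avg \<phi> (win N s i)) \<le> (\<Sum>i<l. avg \<phi> (win N \<tau> i)) - real l * g) \<Longrightarrow> False"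
    and neighbours: "\<And>a. avg \<phi> ((\<not> a) # replicate (N - 1) a) \<le> avg \<phi> ((\<not> a) # replicate (N - 2) a @ [\<not> a]) + L / 2 ^ N"
      "\<And>a. avg \<phi> (replicate (N - 1) a @ [\<not> a]) \<le> avg \<phi> (replicate N a) + L / 2 ^ N"
    and F: "\<And>x. x \<in> {0..<1} \<Longrightarrow> F x = ereal (\<phi> x)" and G: "\<And>x. x \<in> {0..<1} \<Longrightarrow> G x \<le> F x"
  shows "\<exists>\<mu>. unique_maximizing F \<mu> \<and> (\<exists>X. periodic_orbit X \<and> msupport \<mu> \<subseteq> X)
    \<and> ((\<forall>x\<in>msupport \<mu>. F x = G x) \<longrightarrow> unique_maximizing G \<mu>)"
proof -
  interpret unique_max_cycle N "avg \<phi>" wt M g \<gamma> by (rule umc)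
  have "L / 2 ^ N \<ge> 0" using L by simp
  then have gL2: "2 * L / 2 ^ N < g" using gL by simp
  have near: "\<bar>avg \<phi> \<omega> - \<phi> z\<bar> \<le> L / 2 / 2 ^ N" if "length \<omega> = N" "z \<in> cylinder \<omega>" for \<omega> z
    using avg_point[OF meas bdd L that(2)] lip[OF that(1) _ that(2)] that(1) by simp
  have N3: "3 \<le> N" using N4 by simp
  show ?thesis
  proof (cases "\<gamma> = {Z}")
    case True
    \<comment> \<open>The glued loop is traversed by the fixed point 0, which serves as y with
      period 1.\<close>
    have d0: "digits 0 = (\<lambda>_. False)"
    proof
      fix k have "(doubling ^^ k) 0 = 0" by (induction k) (simp_all add: doubling_def)
      then show "digits 0 k = False" by (simp add: digits_def)
    qed
    have w0: "win N (digits 0) k = replicate N False" for k unfolding d0 by (intro win_const) simp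
    have "dominant_orbit N (avg \<phi>) wt M g \<gamma> \<phi> L 0 B 1"
    proof (intro dominant_orbit.intro umc dominant_orbit_axioms.intro N3 L gL2 meas bdd near lip zero)
      show "\<gamma> = range (\<lambda>k. glue (win N (digits 0) k))" using True by (simp add: w0 glue_eq_iff image_def)
      show "card \<gamma> = 1" using True by simp
    qed (simp_all add: doubling_def)
    from dominant_orbit.unique_maximizing_orbit[OF this F G] show ?thesis .
  next
    case False
    show ?thesis
    proof (rule gamma_avoids_constant[OF N3 False L gL _ neighbours])
      fix \<tau> :: "nat \<Rightarrow> bool" and a l
      assume "\<And>k. k < N - 1 \<Longrightarrow> \<tau> k = a" "\<And>k. l \<le> k \<Longrightarrow> \<tau> k = (\<not> a)" "N - 1 \<le> l" "\<tau> (N - 1) = (\<not> a)" "\<tau> (l - 1) = a"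
        "\<And>s. (\<And>k. s (k + l) = s k) \<Longrightarrow> (\<Sum>i<l. avg \<phi> (win N s i)) \<le> (\<Sum>i<l. avg \<phi> (win N \<tau> i)) - real l * g"
      then show False by (rule no_mixed)
    next
      fix \<tau> :: "nat \<Rightarrow> bool" and l :: nat
      assume \<tau>: "0 < l" "\<And>k. \<tau> (k + l) = \<tau> k" "\<gamma> = range (\<lambda>k. glue (win N \<tau> k))"
        "card \<gamma> = l" "\<And>k. \<not> constw (win (N - 1) \<tau> k)"
        "\<And>i j. glue (win (N - 1) \<tau> i) = glue (win (N - 1) \<tau> j) \<Longrightarrow> i mod l = j mod l"
      \<comment> \<open>A tail of ones would visit the glued node. Hence \<tau> is the proper
        expansion of \<open>bval \<tau>\<close>, which can serve as y.\<close>
      have zeros: "\<exists>k\<ge>i. \<not> \<tau> k" for i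
      proof (rule ccontr)
        assume "\<not> (\<exists>k\<ge>i. \<not> \<tau> k)"
        then have "win (N - 1) \<tau> i = replicate (N - 1) True" by (intro win_const) auto
        then show False using \<tau>(5)[of i] by simp
      qed
      have d: "digits (bval \<tau>) = \<tau>" by (rule digits_bval[OF zeros])
      have per: "(doubling ^^ l) (bval \<tau>) = bval \<tau>"
        using funpow_doubling_bval[OF zeros, of l] \<tau>(2) by (simp add: add.commute)
      have "dominant_orbit N (avg \<phi>) wt M g \<gamma> \<phi> L (bval \<tau>) B l"
      proof (intro dominant_orbit.intro umc dominant_orbit_axioms.intro N3 L gL2 meas bdd near lip zero)
        show "bval \<tau> \<in> {0..<1}" by (rule bval_in[OF zeros])
        show "i mod l = j mod l" if "glue (win (N - 1) (digits (bval \<tau>)) i) = glue (win (N - 1) (digits (bval \<tau>)) j)" for i j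
          using that unfolding d by (rule \<tau>(6))
        show "bval \<tau> = 0 \<or> (\<forall>k. \<not> constw (win (N - 1) (digits (bval \<tau>)) k))" unfolding d using \<tau>(5) by blast
        show "\<gamma> = range (\<lambda>k. glue (win N (digits (bval \<tau>)) k))" using \<tau>(3) by (simp only: d)
      qed (use \<tau>(1,4) per in simp_all)
      from dominant_orbit.unique_maximizing_orbit[OF this F G] show ?thesis .
    qed
  qed
qed

section \<open>Edge weights and the gap in terms of averages\<close>

context
  fixes F :: "real \<Rightarrow> ereal" and \<phi> :: "real \<Rightarrow> real" and N :: nat
  assumes F: "\<And>x. x \<in> {0..<1} \<Longrightarrow> F x = ereal (\<phi> x)"
    and sym: "avg \<phi> (replicate N False) = avg \<phi> (replicate N True)"
begin

lemma truncation_cylinder: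
  assumes "length \<omega> = N" "x \<in> cylinder \<omega>" shows "truncation N F x = avg \<phi> \<omega>"
proof -
  have a: "2 ^ N * (LINT y:cylinder \<omega>'|lborel. real_of_ereal (F y)) = avg \<phi> \<omega>'" if "length \<omega>' = N" for \<omega>'
  proof -
    have "(LINT y:cylinder \<omega>'|lborel. real_of_ereal (F y)) = (LINT y:cylinder \<omega>'|lborel. \<phi> y)"
    proof (rule set_lebesgue_integral_cong)
      show "cylinder \<omega>' \<in> sets lborel" by (simp add: cylinder_def)
      show "\<forall>x. x \<in> cylinder \<omega>' \<longrightarrow> real_of_ereal (F x) = \<phi> x" using cylinder_subset[of \<omega>'] F by fastforce
    qed
    then show ?thesis using that by (simp add: avg_def)
  qed
  have i: "indicator (cylinder \<omega>') x = (if \<omega>' = \<omega> then 1 else 0 :: real)" if "length \<omega>' = N" for \<omega>'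
  proof (cases "\<omega>' = \<omega>")
    case False
    have "x \<notin> cylinder \<omega>'" using cylinder_unique[of x \<omega>'] cylinder_unique[OF assms(2)] False that assms(1) by auto
    then show ?thesis using False by simp
  qed (use assms(2) in simp)
  have "truncation N F x = (\<Sum>\<omega>'\<in>words N. if \<omega>' = \<omega> then avg \<phi> \<omega>' else 0)"
    unfolding truncation_def by (rule sum.cong) (auto simp: words_def a i)
  also have "\<dots> = avg \<phi> \<omega>" using finite_words[of N] assms(1) by (simp add: words_def)
  finally show ?thesis .
qed

text \<open>The class of the glued loop contains two words; by \<open>sym\<close> both cylinders
  carry the same value, so the description has a solution there too.\<close>

lemma edge_weight_glue:
  assumes "length \<omega> = N" shows "edge_weight (truncation N F) (glue \<omega>) = avg \<phi> \<omega>"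
proof -
  have *: "\<forall>\<omega>'\<in>glue \<omega>. \<forall>x\<in>cylinder \<omega>'. truncation N F x = avg \<phi> \<omega>"
  proof (intro ballI)
    fix \<omega>' x assume u: "\<omega>' \<in> glue \<omega>" "x \<in> cylinder \<omega>'"
    have "length \<omega>' = N" using glue_mem(2)[OF u(1)] assms by simp
    moreover have "avg \<phi> \<omega>' = avg \<phi> \<omega>"
      using glue_mem(1)[OF u(1)] assms sym by (auto simp: glue_eq_iff constw_iff)
    ultimately show "truncation N F x = avg \<phi> \<omega>" using truncation_cylinder u(2) by simp
  qed
  have ne: "word_val \<omega> \<in> cylinder \<omega>" by (simp add: cylinder_def)
  show ?thesis unfolding edge_weight_def
  proof (rule the_equality)
    fix w assume "\<forall>\<omega>'\<in>glue \<omega>. \<forall>x\<in>cylinder \<omega>'. truncation N F x = w"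
    then have "truncation N F (word_val \<omega>) = w" using glue_self[of \<omega>] ne by blast
    then show "w = avg \<phi> \<omega>" using * glue_self[of \<omega>] ne by metis
  qed (rule *)
qed

text \<open>There are finitely many cycles, so the maximum in \<open>gap\<close> bounds the mean of
  every cycle other than \<gamma>; multiplying by the lengths removes the quotients.\<close>

lemma gap_unique_max_cycle:
  assumes N: "2 \<le> N" and ex1: "\<exists>!C. max_cycle N (truncation N F) C"
  obtains \<gamma> where "unique_max_cycle N (avg \<phi>) (edge_weight (truncation N F)) (max_mean N (truncation N F)) (gap N (truncation N F)) \<gamma>"
proof -
  interpret fin_digraph "QB N" by (rule fin_digraph_QB)
  let ?\<psi> = "truncation N F"
  let ?wt = "edge_weight ?\<psi>"
  define \<gamma> where "\<gamma> = (THE C. max_cycle N ?\<psi> C)"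
  have \<gamma>: "max_cycle N ?\<psi> \<gamma>" unfolding \<gamma>_def by (rule theI'[OF ex1])
  have cyc: "C \<subseteq> arcs (QB N) \<and> C \<noteq> {}" if "C \<in> simple_cycles N" for C
    using that by (auto simp: simple_cycles_def cycle_def awalk_def)
  have fin: "finite (simple_cycles N)"
  proof (rule finite_subset)
    show "simple_cycles N \<subseteq> Pow (arcs (QB N))" using cyc by blast
  qed simp
  have card: "0 < card C" if "C \<in> simple_cycles N" for C
    using cyc[OF that] finite_subset[of C "arcs (QB N)"] by (simp add: card_gt_0_iff)
  have "unique_max_cycle N (avg \<phi>) ?wt (max_mean N ?\<psi>) (gap N ?\<psi>) \<gamma>"
  proof
    show "2 \<le> N" by (rule N)
    show "?wt (glue \<omega>) = avg \<phi> \<omega>" if "length \<omega> = N" for \<omega> by (rule edge_weight_glue[OF that])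
    show S: "\<gamma> \<in> simple_cycles N" using \<gamma> by (simp add: max_cycle_def)
    have "mean_weight ?\<psi> \<gamma> = max_mean N ?\<psi>" using \<gamma> by (simp add: max_cycle_def)
    then show "(\<Sum>e\<in>\<gamma>. ?wt e) = real (card \<gamma>) * max_mean N ?\<psi>"
      using card[OF S] by (simp add: mean_weight_def field_simps)
    fix C assume C: "C \<in> simple_cycles N" "C \<noteq> \<gamma>"
    have "mean_weight ?\<psi> C \<le> Max (mean_weight ?\<psi> ` (simple_cycles N - {\<gamma>}))"
      using fin C by (intro Max_ge) auto
    also have "\<dots> = max_mean N ?\<psi> - gap N ?\<psi>" by (simp add: gap_def \<gamma>_def)
    finally show "(\<Sum>e\<in>C. ?wt e) \<le> real (card C) * (max_mean N ?\<psi> - gap N ?\<psi>)"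
      using card[OF C(1)] by (simp add: mean_weight_def field_simps)
  qed
  then show thesis by (rule that)
qed

end

section \<open>The cut potential and the two dominance cases\<close>

lemma angle_bounds: "2 \<le> d \<Longrightarrow> 0 < pi / 2 ^ d \<and> pi / 2 ^ d \<le> pi / 4"
proof -
  assume "2 \<le> d"
  then have "(2::real) ^ 2 \<le> 2 ^ d" by (intro power_increasing) auto
  then have "pi / 2 ^ d \<le> pi / 2 ^ 2" by (intro divide_left_mono) auto
  then show ?thesis by simp
qed

text \<open>x + c and x - (1 - c) differ by 1, which only changes the sign of the cosine. The value
  \<open>-\<infinity>\<close> of \<open>g_pot\<close> disappears under the cut.\<close>

lemma g_cut_eq:
  assumes "2 \<le> d" shows "g_cut c d x = ereal (lcut (pi / 2 ^ d) (1 - c) x)"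
proof -
  have s: "0 < sin (pi / 2 ^ d)" using sin_alpha_pos angle_bounds[OF assms] by blast
  have c: "cos (pi * (x + c)) = - cos (pi * (x - (1 - c)))"
    using cos_minus_pi[of "pi * (x + c)"] by (simp add: algebra_simps)
  show ?thesis
  proof (cases "cos (pi * (x - (1 - c))) = 0")
    case True then show ?thesis using s by (simp add: g_cut_def g_pot_def lcut_def c max_def)
  next
    case False
    then show ?thesis using s by (auto simp: g_cut_def g_pot_def lcut_def c max_def)
  qed
qed

lemma g_pot_le_g_cut: "g_pot c x \<le> g_cut c d x"
  by (simp add: g_cut_def)

text \<open>On the left of 0 the points 1 - s already include \<open>s = 1 / 2 ^ d'\<close>; on the
  right this end point is reached by continuity.\<close>

lemma right_dominantD:
  assumes "right_dominant c d d'" and d: "2 \<le> d" and s: "0 \<le> s" "s \<le> 1 / 2 ^ d'"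
  shows "lcut (pi / 2 ^ d) (1 - c) (- s) \<le> lcut (pi / 2 ^ d) (1 - c) 0 \<and> lcut (pi / 2 ^ d) (1 - c) 0 \<le> lcut (pi / 2 ^ d) (1 - c) s"
proof -
  define f where "f = lcut (pi / 2 ^ d) (1 - c)"
  have \<alpha>: "0 < pi / 2 ^ d" "pi / 2 ^ d \<le> pi / 4" using angle_bounds[OF d] by auto
  have g: "g_cut c d x = ereal (f x)" for x by (simp add: g_cut_eq[OF d] f_def)
  let ?S = "SUP x\<in>{1 - 1 / 2 ^ d'..<1}. g_cut c d x"
  have S: "?S = ereal (f 0)" and I: "ereal (f 0) \<le> (INF x\<in>{0..<1 / 2 ^ d'}. g_cut c d x)"
    using assms(1) by (auto simp: right_dominant_def g)
  have "f (- s) \<le> f 0"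
  proof (cases "s = 0")
    case False
    then have "g_cut c d (1 - s) \<le> ?S" using s by (intro SUP_upper) auto
    then show ?thesis unfolding S by (simp add: g f_def lcut_1_minus[OF \<alpha>])
  qed simp
  moreover have "f 0 \<le> f s"
  proof (rule continuous_ge_on_closure[of "{0..<1 / 2 ^ d'}" f])
    show "continuous_on (closure {0..<1 / 2 ^ d'}) f"
      unfolding f_def by (rule continuous_on_subset[OF continuous_lcut[OF \<alpha>]]) simp
    show "s \<in> closure {0..<1 / 2 ^ d'}" using s by simp
    show "f 0 \<le> f x" if "x \<in> {0..<1 / 2 ^ d'}" for x
      using order_trans[OF I INF_lower[OF that]] by (simp add: g)
  qed
  ultimately show ?thesis by (simp add: f_def)
qed

lemma left_dominantD:
  assumes "left_dominant c d d'" and d: "2 \<le> d" and s: "0 \<le> s" "s \<le> 1 / 2 ^ d'"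
  shows "lcut (pi / 2 ^ d) c (- s) \<le> lcut (pi / 2 ^ d) c 0 \<and> lcut (pi / 2 ^ d) c 0 \<le> lcut (pi / 2 ^ d) c s"
proof -
  define f where "f = lcut (pi / 2 ^ d) (1 - c)"
  have \<alpha>: "0 < pi / 2 ^ d" "pi / 2 ^ d \<le> pi / 4" using angle_bounds[OF d] by auto
  have r: "lcut (pi / 2 ^ d) c x = f (- x)" for x
    using lcut_reflect[OF \<alpha>, of "1 - c" "- x"] lcut_minus_1[OF \<alpha>, of c "1 + x"] by (simp add: f_def)
  have g: "g_cut c d x = ereal (f x)" for x by (simp add: g_cut_eq[OF d] f_def)
  let ?S = "SUP x\<in>{0..<1 / 2 ^ d'}. g_cut c d x"
  have S: "?S = ereal (f 0)" and I: "ereal (f 0) \<le> (INF x\<in>{1 - 1 / 2 ^ d'..<1}. g_cut c d x)"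
    using assms(1) by (auto simp: left_dominant_def g)
  have "f 0 \<le> f (- s)"
  proof (cases "s = 0")
    case False
    then have "1 - s \<in> {1 - 1 / 2 ^ d'..<1}" using s by auto
    from order_trans[OF I INF_lower[OF this]] show ?thesis by (simp add: g f_def lcut_1_minus[OF \<alpha>])
  qed simp
  moreover have "f s \<le> f 0"
  proof (rule continuous_le_on_closure[of "{0..<1 / 2 ^ d'}" f])
    show "continuous_on (closure {0..<1 / 2 ^ d'}) f"
      unfolding f_def by (rule continuous_on_subset[OF continuous_lcut[OF \<alpha>]]) simp
    show "s \<in> closure {0..<1 / 2 ^ d'}" using s by simp
    show "f x \<le> f 0" if "x \<in> {0..<1 / 2 ^ d'}" for x
      using SUP_upper[OF that, of "g_cut c d"] unfolding S by (simp add: g)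
  qed
  ultimately show ?thesis by (simp add: r)
qed

text \<open>Complementing letters exchanges the two sides of 0 and keeps periods, so optimality is
  transported along with the sequence.\<close>

lemma (in right_potential) no_mixed_left:
  assumes W': "\<And>\<omega>. W' \<omega> = W (map Not \<omega>)"
    and \<tau>0: "\<And>k. k < N - 1 \<Longrightarrow> \<tau> k = a" and \<tau>1: "\<And>k. l \<le> k \<Longrightarrow> \<tau> k = (\<not> a)" and l: "N - 1 \<le> l"
    and first: "\<tau> (N - 1) = (\<not> a)" and last: "\<tau> (l - 1) = a"
    and opt: "\<And>s. (\<And>k. s (k + l) = s k) \<Longrightarrow>
      (\<Sum>i<l. W' (win N s i)) \<le> (\<Sum>i<l. W' (win N \<tau> i)) - real l * g"
    and g: "5 / 2 * L / 2 ^ N < g"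
  shows False
proof (rule no_mixed_right[of "\<lambda>k. \<not> \<tau> k" "\<not> a" l g])
  show "(\<Sum>i<l. W (win N s i)) \<le> (\<Sum>i<l. W (win N (\<lambda>k. \<not> \<tau> k) i)) - real l * g"
    if "\<And>k. s (k + l) = s k" for s
    using opt[of "\<lambda>k. \<not> s k"] that by (simp add: W' map_Not_win)
qed (use assms in auto)

lemma (in right_potential) neighbour_weights_left:
  assumes W': "\<And>\<omega>. W' \<omega> = W (map Not \<omega>)"
  shows "W' ((\<not> a) # replicate (N - 1) a) \<le> W' ((\<not> a) # replicate (N - 2) a @ [\<not> a]) + L / 2 ^ N"
    "W' (replicate (N - 1) a @ [\<not> a]) \<le> W' (replicate N a) + L / 2 ^ N"
  using neighbour_weights_right[of "\<not> a"] by (simp_all add: W')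

theorem theorem3p2:
  fixes c :: real and d d' N :: nat
  assumes "0 < c" and "c < 1"
    and "d \<ge> 2" and "d' \<ge> 2" and "N \<ge> d'"
    and "right_dominant c d d' \<or> left_dominant c d d'"
    and "\<exists>!C. max_cycle N (truncation N (g_sym c d d')) C"
    and "gap N (truncation N (g_sym c d d')) > 5 * pi / 2 * cot (pi / 2 ^ d) * (1 / 2 ^ N)"
  shows "\<exists>\<mu>. unique_maximizing (g_sym c d d') \<mu>
           \<and> (\<exists>X. periodic_orbit X \<and> msupport \<mu> \<subseteq> X)
           \<and> ((\<forall>x\<in>msupport \<mu>. g_sym c d d' x = g_pot c x)
                \<longrightarrow> unique_maximizing (g_pot c) \<mu>)"
proof -
  define \<alpha> where "\<alpha> = pi / 2 ^ d"
  define e :: real where "e = 1 / 2 ^ d'"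
  define L where "L = pi * cot \<alpha>"
  let ?F = "g_sym c d d'"
  let ?\<psi> = "truncation N ?F"
  let ?f = "lcut \<alpha> (1 - c)"
  have \<alpha>: "0 < \<alpha>" "\<alpha> \<le> pi / 4" using angle_bounds[OF assms(3)] by (auto simp: \<alpha>_def)
  have L: "0 \<le> L" using cot_alpha_ge_1[OF \<alpha>] by (simp add: L_def)
  have e: "0 < e" "e \<le> 1 / 4"
  proof -
    have "(2::real) ^ 2 \<le> 2 ^ d'" using assms(4) by (intro power_increasing) auto
    then show "0 < e" "e \<le> 1 / 4" by (auto simp: e_def field_simps)
  qed
  have he: "1 / 2 ^ N \<le> e" unfolding e_def using assms(5) by (intro divide_left_mono power_increasing) auto
  have gcut: "g_cut c d x = ereal (?f x)" for x by (simp add: g_cut_eq[OF assms(3)] \<alpha>_def)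
  have flip: "lcut \<alpha> c x = ?f (1 - x)" "lcut \<alpha> c (1 - x) = ?f x" for x
    using lcut_reflect[OF \<alpha>, of c x] lcut_reflect[OF \<alpha>, of "1 - c" x] by simp_all
  have f_lip: "\<bar>?f x - ?f z\<bar> \<le> L * \<bar>x - z\<bar>" for x z using lcut_lipschitz[OF \<alpha>] by (simp add: L_def)
  have f_meas [measurable]: "?f \<in> borel_measurable borel"
    using continuous_lcut[OF \<alpha>] by (rule borel_measurable_continuous_onI)
  have ends: "x \<in> cylinder (replicate N True) \<Longrightarrow> 1 - e \<le> x \<and> x < 1"
    "x \<in> cylinder (replicate N False) \<Longrightarrow> 0 \<le> x \<and> x < e" for x
    using he by (auto simp: cylinder_def word_val_replicate_True word_val_replicate_False)
  have gL: "5 / 2 * L / 2 ^ N < gap N ?\<psi>" using assms(8) by (simp add: L_def \<alpha>_def mult.assoc)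

  \<comment> \<open>Isolates what the two dominance cases have to supply. \<open>no_mixed\<close>
    and \<open>neighbours\<close> may assume \<open>4 \<le> N\<close>, which is derived from the gap
    before they are used.\<close>
  have main: ?thesis
    if F: "\<And>x. x \<in> {0..<1} \<Longrightarrow> ?F x = ereal (\<phi> x)" and meas: "\<phi> \<in> borel_measurable borel"
      and range: "\<And>x. ln (sin \<alpha>) \<le> \<phi> x" "\<And>x. \<phi> x \<le> 0"
      and lip: "\<And>\<omega> x z. length \<omega> = N \<Longrightarrow> x \<in> cylinder \<omega> \<Longrightarrow> z \<in> cylinder \<omega> \<Longrightarrow> \<bar>\<phi> x - \<phi> z\<bar> \<le> L * \<bar>x - z\<bar>"
      and zero: "\<And>x. x \<in> cylinder (replicate N True) \<Longrightarrow> \<phi> x \<le> \<phi> 0 + L * (1 - x)"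
      and sym: "\<And>x. x \<in> cylinder (replicate N False) \<Longrightarrow> \<phi> (1 - x) = \<phi> x"
      and above: "\<And>x. x \<in> {0..<1} \<Longrightarrow> ?f x \<le> \<phi> x"
      and no_mixed: "\<And>\<tau> a l g. 4 \<le> N \<Longrightarrow> (\<And>k. k < N - 1 \<Longrightarrow> \<tau> k = a) \<Longrightarrow> (\<And>k. l \<le> k \<Longrightarrow> \<tau> k = (\<not> a)) \<Longrightarrow> N - 1 \<le> l \<Longrightarrow>
        \<tau> (N - 1) = (\<not> a) \<Longrightarrow> \<tau> (l - 1) = a \<Longrightarrow>
        (\<And>s. (\<And>k. s (k + l) = s k) \<Longrightarrow> (\<Sum>i<l. avg \<phi> (win N s i)) \<le> (\<Sum>i<l. avg \<phi> (win N \<tau> i)) - real l * g) \<Longrightarrow>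
        5 / 2 * L / 2 ^ N < g \<Longrightarrow> False"
      and neighbours: "\<And>a. 4 \<le> N \<Longrightarrow> avg \<phi> ((\<not> a) # replicate (N - 1) a) \<le> avg \<phi> ((\<not> a) # replicate (N - 2) a @ [\<not> a]) + L / 2 ^ N"
        "\<And>a. 4 \<le> N \<Longrightarrow> avg \<phi> (replicate (N - 1) a @ [\<not> a]) \<le> avg \<phi> (replicate N a) + L / 2 ^ N"
    for \<phi>
  proof -
    have bdd: "\<bar>\<phi> x\<bar> \<le> - ln (sin \<alpha>)" for x using range[of x] by simp
    have "avg \<phi> (map Not (replicate N False)) = avg \<phi> (replicate N False)"
      by (rule avg_reflect[of "{}"]) (use sym in auto)
    then have avg_sym: "avg \<phi> (replicate N False) = avg \<phi> (replicate N True)" by simp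
    have N2: "2 \<le> N" using assms(4,5) by simp
    obtain \<gamma> where umc: "unique_max_cycle N (avg \<phi>) (edge_weight ?\<psi>) (max_mean N ?\<psi>) (gap N ?\<psi>) \<gamma>"
      using gap_unique_max_cycle[OF F avg_sym N2 assms(7)] by blast
    have "gap N ?\<psi> \<le> - ln (sin \<alpha>)"
      by (rule unique_max_cycle.gap_bound[OF umc avg_ge[OF meas bdd range(1)] avg_le[OF meas bdd range(2)]])
    then have N4: "4 \<le> N" using assms(8) unfolding \<alpha>_def[symmetric] by (intro four_le_N[OF \<alpha>])
    show ?thesis
    proof (rule maximizing_of_gap[OF umc N4 L gL meas bdd lip zero _ neighbours[OF N4] F])
      fix \<tau> :: "nat \<Rightarrow> bool" and a l
      assume "\<And>k. k < N - 1 \<Longrightarrow> \<tau> k = a" "\<And>k. l \<le> k \<Longrightarrow> \<tau> k = (\<not> a)" "N - 1 \<le> l" "\<tau> (N - 1) = (\<not> a)" "\<tau> (l - 1) = a"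
        "\<And>s. (\<And>k. s (k + l) = s k) \<Longrightarrow> (\<Sum>i<l. avg \<phi> (win N s i)) \<le> (\<Sum>i<l. avg \<phi> (win N \<tau> i)) - real l * gap N ?\<psi>"
      from no_mixed[OF N4 this gL] show False .
    next
      fix x :: real assume x: "x \<in> {0..<1}"
      have "g_pot c x \<le> ereal (?f x)" using g_pot_le_g_cut[of c x d] by (simp add: gcut)
      also have "\<dots> \<le> ?F x" using above[OF x] by (simp add: F[OF x])
      finally show "g_pot c x \<le> ?F x" .
    qed
  qed
  show ?thesis
  proof (cases "right_dominant c d d'")
    case True
    let ?p = "1 - c"
    have dom: "lcut \<alpha> ?p (- s) \<le> lcut \<alpha> ?p 0 \<and> lcut \<alpha> ?p 0 \<le> lcut \<alpha> ?p s" if "0 \<le> s" "s \<le> e" for s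
      using right_dominantD[OF True assms(3), of s] that by (simp add: \<alpha>_def e_def)
    have pot: "right_potential \<alpha> ?p e d' N" if "4 \<le> N"
      using \<alpha> assms(1,2,4,5) that dom by unfold_locales (simp_all add: e_def)
    show ?thesis
    proof (rule main[of "lsym \<alpha> ?p e"])
      show "?F x = ereal (lsym \<alpha> ?p e x)" if "x \<in> {0..<1}" for x
        using True by (simp add: g_sym_def lsym_def gcut e_def)
      show "lsym \<alpha> ?p e \<in> borel_measurable borel" unfolding lsym_def by measurable
      show "ln (sin \<alpha>) \<le> lsym \<alpha> ?p e x" "lsym \<alpha> ?p e x \<le> 0" for x
        by (simp_all add: lsym_def lcut_ge[OF \<alpha>] lcut_le_0[OF \<alpha>])
      show "\<bar>lsym \<alpha> ?p e x - lsym \<alpha> ?p e z\<bar> \<le> L * \<bar>x - z\<bar>"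
        if "length \<omega> = N" "x \<in> cylinder \<omega>" "z \<in> cylinder \<omega>" for \<omega> x z
      proof -
        have "(1 - e) * 2 ^ length \<omega> = of_int (2 ^ N - 2 ^ (N - d'))"
          using dyadic_int[OF assms(5)] that(1) by (simp add: e_def left_diff_distrib)
        from cylinder_dyadic_side[OF this that(2,3)] show ?thesis
          using f_lip[of x z] f_lip[of "1 - x" "1 - z"] by (auto simp: lsym_def abs_minus_commute)
      qed
      show "lsym \<alpha> ?p e x \<le> lsym \<alpha> ?p e 0 + L * (1 - x)" if "x \<in> cylinder (replicate N True)" for x
        using ends(1)[OF that] f_lip[of "1 - x" 0] e by (auto simp: lsym_def)
      show "lsym \<alpha> ?p e (1 - x) = lsym \<alpha> ?p e x" if "x \<in> cylinder (replicate N False)" for x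
        using ends(2)[OF that] e by (auto simp: lsym_def)
      show "?f x \<le> lsym \<alpha> ?p e x" if "x \<in> {0..<1}" for x
        \<comment> \<open>Copying replaces values by larger ones: \<open>dom\<close> orders the
          values at x - 1 and 1 - x through the one at 0.\<close>
        using dom[of "1 - x"] that lcut_minus_1[OF \<alpha>, of ?p x] by (auto simp: lsym_def)
      fix a assume N4: "4 \<le> N"
      note right_potential.neighbour_weights_right[OF pot[OF N4], of a, folded L_def]
      then show "avg (lsym \<alpha> ?p e) ((\<not> a) # replicate (N - 1) a) \<le> avg (lsym \<alpha> ?p e) ((\<not> a) # replicate (N - 2) a @ [\<not> a]) + L / 2 ^ N"
        "avg (lsym \<alpha> ?p e) (replicate (N - 1) a @ [\<not> a]) \<le> avg (lsym \<alpha> ?p e) (replicate N a) + L / 2 ^ N" .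
    next
      fix \<tau> :: "nat \<Rightarrow> bool" and a l g
      assume N4: "4 \<le> N"
      assume "\<And>k. k < N - 1 \<Longrightarrow> \<tau> k = a" "\<And>k. l \<le> k \<Longrightarrow> \<tau> k = (\<not> a)" "N - 1 \<le> l" "\<tau> (N - 1) = (\<not> a)" "\<tau> (l - 1) = a"
        "\<And>s. (\<And>k. s (k + l) = s k) \<Longrightarrow> (\<Sum>i<l. avg (lsym \<alpha> ?p e) (win N s i)) \<le> (\<Sum>i<l. avg (lsym \<alpha> ?p e) (win N \<tau> i)) - real l * g"
        "5 / 2 * L / 2 ^ N < g"
      then show False by (rule right_potential.no_mixed_right[OF pot[OF N4], folded L_def])
    qed
  next
    case False
    then have left: "left_dominant c d d'" using assms(6) by blast
    define \<phi> where "\<phi> x = (if x < e then ?f (1 - x) else ?f x)" for x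
    have dom: "lcut \<alpha> c (- s) \<le> lcut \<alpha> c 0 \<and> lcut \<alpha> c 0 \<le> lcut \<alpha> c s" if "0 \<le> s" "s \<le> e" for s
      using left_dominantD[OF left assms(3), of s] that by (simp add: \<alpha>_def e_def)
    have pot: "right_potential \<alpha> c e d' N" if "4 \<le> N"
      using \<alpha> assms(1,2,4,5) that dom by unfold_locales (simp_all add: e_def)
    have W: "avg \<phi> \<omega> = avg (lsym \<alpha> c e) (map Not \<omega>)" for \<omega>
    \<comment> \<open>The point e is exceptional: its mirror image 1 - e already belongs to the
      copied part of \<open>lsym\<close>, whereas \<phi> still takes the original value at
      e.\<close>
    proof (rule avg_reflect[symmetric, of "{e}"])
      show "lsym \<alpha> c e (1 - x) = \<phi> x" if "x \<notin> {e}" for x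
        using that by (auto simp: lsym_def \<phi>_def flip)
    qed simp
    show ?thesis
    proof (rule main[of \<phi>])
      show "?F x = ereal (\<phi> x)" if "x \<in> {0..<1}" for x
        using False by (simp add: g_sym_def \<phi>_def gcut e_def)
      show "\<phi> \<in> borel_measurable borel" unfolding \<phi>_def by measurable
      show "ln (sin \<alpha>) \<le> \<phi> x" "\<phi> x \<le> 0" for x
        by (simp_all add: \<phi>_def lcut_ge[OF \<alpha>] lcut_le_0[OF \<alpha>])
      show "\<bar>\<phi> x - \<phi> z\<bar> \<le> L * \<bar>x - z\<bar>"
        if "length \<omega> = N" "x \<in> cylinder \<omega>" "z \<in> cylinder \<omega>" for \<omega> x z
      proof -
        have "e * 2 ^ length \<omega> = of_int (2 ^ (N - d'))"
          using dyadic_int[OF assms(5)] that(1) by (simp add: e_def)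
        from cylinder_dyadic_side[OF this that(2,3)] show ?thesis
          using f_lip[of x z] f_lip[of "1 - x" "1 - z"] by (auto simp: \<phi>_def abs_minus_commute)
      qed
      show "\<phi> x \<le> \<phi> 0 + L * (1 - x)" if "x \<in> cylinder (replicate N True)" for x
        using ends(1)[OF that] f_lip[of x 1] e by (auto simp: \<phi>_def)
      show "\<phi> (1 - x) = \<phi> x" if "x \<in> cylinder (replicate N False)" for x
        using ends(2)[OF that] e by (auto simp: \<phi>_def)
      show "?f x \<le> \<phi> x" if "x \<in> {0..<1}" for x
        using dom[of x] that lcut_1_minus[OF \<alpha>, of c x] by (auto simp: \<phi>_def flip)
      fix a assume N4: "4 \<le> N"
      note right_potential.neighbour_weights_left[OF pot[OF N4] W, of a, folded L_def]
      then show "avg \<phi> ((\<not> a) # replicate (N - 1) a) \<le> avg \<phi> ((\<not> a) # replicate (N - 2) a @ [\<not> a]) + L / 2 ^ N"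
        "avg \<phi> (replicate (N - 1) a @ [\<not> a]) \<le> avg \<phi> (replicate N a) + L / 2 ^ N" .
    next
      fix \<tau> :: "nat \<Rightarrow> bool" and a l g
      assume N4: "4 \<le> N"
      assume "\<And>k. k < N - 1 \<Longrightarrow> \<tau> k = a" "\<And>k. l \<le> k \<Longrightarrow> \<tau> k = (\<not> a)" "N - 1 \<le> l" "\<tau> (N - 1) = (\<not> a)" "\<tau> (l - 1) = a"
        "\<And>s. (\<And>k. s (k + l) = s k) \<Longrightarrow> (\<Sum>i<l. avg \<phi> (win N s i)) \<le> (\<Sum>i<l. avg \<phi> (win N \<tau> i)) - real l * g"
        "5 / 2 * L / 2 ^ N < g"
      then show False by (rule right_potential.no_mixed_left[OF pot[OF N4] W, folded L_def])
    qed
  qed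
qed

end
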